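(* Let $R$ be a commutative noetherian graded ring, $\mathscr{T}$ a compactly generated $R$-linear triangulated category with set-indexed coproducts, $X$ an object in $\mathscr{T}$ and $\mathfrak{p}\in\mathrm{Spec}R$. The following are equivalent: (1) $\mathfrak{p}\in\mathrm{cosupp}_RX$; (2) $V^{\mathcal{Z}(\mathfrak{p})}(X/\!/\mathfrak{p})\neq0$; (3) $\Gamma_{\mathcal{V}(\mathfrak{p})}V^{\mathcal{Z}(\mathfrak{p})}X\neq0$; (4) $\mathfrak{p}\in\mathrm{cosupp}_R(V^{\mathcal{Z}(\mathfrak{p})}X)$.
   Context: Setting. $R$ is $\mathbb{Z}$-graded, noetherian, and graded-commutative: $rs=(-1)^{|r||s|}sr$ for homogeneous $r,s$. $\mathrm{Spec}R$ is the set of homogeneous prime ideals; all $R$-modules are graded and localization $M_\mathfrak{p}$ is homogeneous localization. $\mathscr{T}$ is a triangulated category with suspension $\Sigma$ and set-indexed coproducts, generated by a set of compact objects; $\mathscr{T}^c$ is the full subcategory of compact objects. $R$-linear means a homomorphism of graded rings $R\to Z^\ast(\mathscr{T})$ to the graded center is given (degree $n$ elements of $Z^\ast(\mathscr{T})$ are natural transformations $\eta:\mathrm{Id}\to\Sigma^n$ with $\eta\Sigma=(-1)^n\Sigma\eta$). $\mathrm{Hom}^\ast_\mathscr{T}(X,Y)=\bigoplus_{i}\mathrm{Hom}_\mathscr{T}(X,\Sigma^iY)$ is then a graded $R$-module, and $\mathrm{H}^\ast_C(X)=\mathrm{Hom}^\ast_\mathscr{T}(C,X)$ for $C\in\mathscr{T}^c$.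 Local (co)homology. For $\mathcal{V}\subseteq\mathrm{Spec}R$ specialization closed (i.e. $\mathfrak{q}\in\mathcal V$, $\mathfrak q\subseteq\mathfrak p$ imply $\mathfrak p\in\mathcal V$), $\mathscr{T}_\mathcal{V}$ is the localizing subcategory of all $X$ with $\mathrm{H}^\ast_C(X)_\mathfrak{p}=0$ for all $C\in\mathscr{T}^c$, $\mathfrak{p}\notin\mathcal{V}$. There is a localization functor $L_\mathcal{V}$ with kernel $\mathscr{T}_\mathcal{V}$, and functorial exact triangles $\Gamma_\mathcal{V}X\to X\to L_\mathcal{V}X\rightsquigarrow$ with $\Gamma_\mathcal{V}X\in\mathscr{T}_\mathcal{V}$. $\Lambda^\mathcal{V}$ and $V^\mathcal{V}$ denote the right adjoints of $\Gamma_\mathcal{V}$ and $L_\mathcal{V}$ respectively. Set $\mathcal{Z}(\mathfrak{p})=\{\mathfrak{q}\in\mathrm{Spec}R : \mathfrak{q}\nsubseteq\mathfrak{p}\}$ and $\mathcal{V}(\mathfrak{a})=\{\mathfrak{p}\in\mathrm{Spec}R:\mathfrak{a}\subseteq\mathfrak{p}\}$. Cosupport. $\Lambda^\mathfrak{p}=V^{\mathcal{Z}(\mathfrak{p})}\Lambda^{\mathcal{V}(\mathfrak{p})}$ and $\mathrm{cosupp}_RX=\{\mathfrak{p}\in\mathrm{Spec}R:\Lambda^\mathfrak{p}X\neq0\}$. Koszul objects. For homogeneous $r\in R$, $X/\!/r$ is defined by an exact triangle $X\xrightarrow{r}\Sigma^{|r|}X\to X/\!/r\rightsquigarrow$; for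 a homogeneous ideal $\mathfrak{a}$, $X/\!/\mathfrak{a}$ is obtained by iterating over a (chosen) finite sequence of homogeneous generators of $\mathfrak{a}$. *)

theory Defs
  imports
    "HOL-Algebra.Ring_Divisibility"
    "HOL-Algebra.Product_Groups"
    "HOL-Algebra.Free_Abelian_Groups"
begin

section \<open>Graded rings and homogeneous primes\<close>

text \<open>A \<open>\<int>\<close>-graded ring is a ring \<open>R\<close> with a family \<open>Rg\<close> of additive subgroups, \<open>Rg n\<close> being the
  homogeneous elements of degree \<open>n\<close> (so \<open>0\<close> has every degree). The underlying ring need
  not be commutative.\<close>

definition homogeneous_components ::
    "('r, 'z) ring_scheme \<Rightarrow> (int \<Rightarrow> 'r set) \<Rightarrow> 'r \<Rightarrow> (int \<Rightarrow> 'r) \<Rightarrow> bool" where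
  "homogeneous_components R Rg x c \<longleftrightarrow>
     (\<forall>n. c n \<in> Rg n) \<and> finite {n. c n \<noteq> \<zero>\<^bsub>R\<^esub>} \<and>
     x = (\<Oplus>\<^bsub>R\<^esub> n \<in> {n. c n \<noteq> \<zero>\<^bsub>R\<^esub>}. c n)"

locale graded_ring = ring R for R (structure) +
  fixes Rg :: "int \<Rightarrow> 'a set"
  assumes subgroup_degree: "additive_subgroup (Rg n) R"
    and one_degree: "\<one> \<in> Rg 0"
    and mult_degree: "r \<in> Rg m \<Longrightarrow> s \<in> Rg n \<Longrightarrow> r \<otimes> s \<in> Rg (m + n)"
    and direct_sum: "x \<in> carrier R \<Longrightarrow> \<exists>!c. homogeneous_components R Rg x c"

locale graded_commutative_ring = graded_ring +
  assumes graded_commute: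
    "r \<in> Rg m \<Longrightarrow> s \<in> Rg n \<Longrightarrow>
       r \<otimes> s = (if even (m * n) then s \<otimes> r else \<ominus> (s \<otimes> r))"

definition homogeneous_ideal ::
    "('r, 'z) ring_scheme \<Rightarrow> (int \<Rightarrow> 'r set) \<Rightarrow> 'r set \<Rightarrow> bool" where
  "homogeneous_ideal R Rg I \<longleftrightarrow>
     ideal I R \<and> (\<forall>x\<in>I. \<forall>c. homogeneous_components R Rg x c \<longrightarrow> (\<forall>n. c n \<in> I))"

definition Spec :: "('r, 'z) ring_scheme \<Rightarrow> (int \<Rightarrow> 'r set) \<Rightarrow> 'r set set" where
  "Spec R Rg = {\<pp>. homogeneous_ideal R Rg \<pp> \<and> \<pp> \<noteq> carrier R \<and>
     (\<forall>m n. \<forall>r\<in>Rg m. \<forall>s\<in>Rg n. r \<otimes>\<^bsub>R\<^esub> s \<in> \<pp> \<longrightarrow> r \<in> \<pp> \<or> s \<in> \<pp>)}"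

definition specialization_closed ::
    "('r, 'z) ring_scheme \<Rightarrow> (int \<Rightarrow> 'r set) \<Rightarrow> 'r set set \<Rightarrow> bool" where
  "specialization_closed R Rg \<V> \<longleftrightarrow>
     \<V> \<subseteq> Spec R Rg \<and> (\<forall>\<qq>\<in>\<V>. \<forall>\<pp>\<in>Spec R Rg. \<qq> \<subseteq> \<pp> \<longrightarrow> \<pp> \<in> \<V>)"

definition closed_locus ::
    "('r, 'z) ring_scheme \<Rightarrow> (int \<Rightarrow> 'r set) \<Rightarrow> 'r set \<Rightarrow> 'r set set" where
  "closed_locus R Rg \<aa> = {\<pp> \<in> Spec R Rg. \<aa> \<subseteq> \<pp>}"

definition non_generalizations ::
    "('r, 'z) ring_scheme \<Rightarrow> (int \<Rightarrow> 'r set) \<Rightarrow> 'r set \<Rightarrow> 'r set set" where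
  "non_generalizations R Rg \<pp> = {\<qq> \<in> Spec R Rg. \<not> \<qq> \<subseteq> \<pp>}"


section \<open>Homogeneous localization of graded modules\<close>

text \<open>A graded left module is given by its homogeneous components \<open>M n\<close>, abelian groups in
  multiplicative notation, and the action \<open>act k r n : M n \<rightarrow> M (k + n)\<close> of \<open>r \<in> Rg k\<close>.
  A triple \<open>(k, s, m)\<close> stands for the fraction \<open>s\<inverse> m\<close> of degree \<open>n\<close>, with \<open>s\<close>
  homogeneous of degree \<open>k\<close> outside \<open>\<pp>\<close>. Two fractions agree if they have a common expansion
  \<open>(a s)\<inverse> (a m) = (a' s')\<inverse> (a' m')\<close>; this form of the relation needs no signs.\<close>

definition fractions ::
    "(int \<Rightarrow> 'r set) \<Rightarrow> 'r set \<Rightarrow> (int \<Rightarrow> 'm monoid) \<Rightarrow> int \<Rightarrow> (int \<times> 'r \<times> 'm) set" where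
  "fractions Rg \<pp> M n = {(k, s, m). s \<in> Rg k \<and> s \<notin> \<pp> \<and> m \<in> carrier (M (n + k))}"

definition fraction_rel ::
    "('r, 'z) ring_scheme \<Rightarrow> (int \<Rightarrow> 'r set) \<Rightarrow> 'r set \<Rightarrow> (int \<Rightarrow> 'm monoid) \<Rightarrow>
     (int \<Rightarrow> 'r \<Rightarrow> int \<Rightarrow> 'm \<Rightarrow> 'm) \<Rightarrow> int \<Rightarrow> (int \<times> 'r \<times> 'm) rel" where
  "fraction_rel R Rg \<pp> M act n =
     {((k, s, m), (k', s', m')).
        (k, s, m) \<in> fractions Rg \<pp> M n \<and> (k', s', m') \<in> fractions Rg \<pp> M n \<and>
        (\<exists>i i'. \<exists>a\<in>Rg i. \<exists>a'\<in>Rg i'.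
           i + k = i' + k' \<and> a \<otimes>\<^bsub>R\<^esub> s = a' \<otimes>\<^bsub>R\<^esub> s' \<and> a \<otimes>\<^bsub>R\<^esub> s \<notin> \<pp> \<and>
           act i a (n + k) m = act i' a' (n + k') m')}"

definition localization ::
    "('r, 'z) ring_scheme \<Rightarrow> (int \<Rightarrow> 'r set) \<Rightarrow> 'r set \<Rightarrow> (int \<Rightarrow> 'm monoid) \<Rightarrow>
     (int \<Rightarrow> 'r \<Rightarrow> int \<Rightarrow> 'm \<Rightarrow> 'm) \<Rightarrow> int \<Rightarrow> (int \<times> 'r \<times> 'm) set set" where
  "localization R Rg \<pp> M act n = fractions Rg \<pp> M n // fraction_rel R Rg \<pp> M act n"

definition localization_zero ::
    "('r, 'z) ring_scheme \<Rightarrow> (int \<Rightarrow> 'r set) \<Rightarrow> 'r set \<Rightarrow> (int \<Rightarrow> 'm monoid) \<Rightarrow>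
     (int \<Rightarrow> 'r \<Rightarrow> int \<Rightarrow> 'm \<Rightarrow> 'm) \<Rightarrow> int \<Rightarrow> (int \<times> 'r \<times> 'm) set" where
  "localization_zero R Rg \<pp> M act n =
     fraction_rel R Rg \<pp> M act n `` {(0, \<one>\<^bsub>R\<^esub>, \<one>\<^bsub>M n\<^esub>)}"

definition localization_vanishes ::
    "('r, 'z) ring_scheme \<Rightarrow> (int \<Rightarrow> 'r set) \<Rightarrow> 'r set \<Rightarrow> (int \<Rightarrow> 'm monoid) \<Rightarrow>
     (int \<Rightarrow> 'r \<Rightarrow> int \<Rightarrow> 'm \<Rightarrow> 'm) \<Rightarrow> bool" where
  "localization_vanishes R Rg \<pp> M act \<longleftrightarrow>
     (\<forall>n. localization R Rg \<pp> M act n = {localization_zero R Rg \<pp> M act n})"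


section \<open>Triangulated categories\<close>

text \<open>\<open>HomG T X Y\<close> is the abelian group of morphisms \<open>X \<rightarrow> Y\<close>. Since it is a
  \<^typ>\<open>'m monoid\<close>, its group law, zero morphism and negation appear multiplicatively, as
  \<open>\<otimes>\<close>, \<open>\<one>\<close> and \<open>inv\<close>; composition of morphisms is \<open>g \<bullet> f\<close> (first \<open>f\<close>).
  \<open>Tri T X Y Z f g h\<close> says that \<open>X \<rightarrow> Y \<rightarrow> Z \<rightarrow> \<Sigma>X\<close> is an exact triangle.\<close>

record ('o, 'm) tricat =
  Obj :: "'o set"
  HomG :: "'o \<Rightarrow> 'o \<Rightarrow> 'm monoid"
  Comp :: "'m \<Rightarrow> 'm \<Rightarrow> 'm" (infixr "\<bullet>\<index>" 70)
  Ident :: "'o \<Rightarrow> 'm"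
  SuspO :: "'o \<Rightarrow> 'o"
  SuspM :: "'m \<Rightarrow> 'm"
  Tri :: "'o \<Rightarrow> 'o \<Rightarrow> 'o \<Rightarrow> 'm \<Rightarrow> 'm \<Rightarrow> 'm \<Rightarrow> bool"

abbreviation Hom :: "('o, 'm, 'x) tricat_scheme \<Rightarrow> 'o \<Rightarrow> 'o \<Rightarrow> 'm set" where
  "Hom T X Y \<equiv> carrier (HomG T X Y)"

definition Arr :: "('o, 'm, 'x) tricat_scheme \<Rightarrow> 'm set" where
  "Arr T = (\<Union>X\<in>Obj T. \<Union>Y\<in>Obj T. Hom T X Y)"

definition iso_arr :: "('o, 'm, 'x) tricat_scheme \<Rightarrow> 'o \<Rightarrow> 'o \<Rightarrow> 'm \<Rightarrow> bool" where
  "iso_arr T X Y f \<longleftrightarrow> X \<in> Obj T \<and> Y \<in> Obj T \<and> f \<in> Hom T X Y \<and>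
     (\<exists>g\<in>Hom T Y X. g \<bullet>\<^bsub>T\<^esub> f = Ident T X \<and> f \<bullet>\<^bsub>T\<^esub> g = Ident T Y)"

definition zero_object :: "('o, 'm, 'x) tricat_scheme \<Rightarrow> 'o \<Rightarrow> bool" where
  "zero_object T Z \<longleftrightarrow>
     Z \<in> Obj T \<and> (\<forall>X\<in>Obj T. (\<exists>!f. f \<in> Hom T Z X) \<and> (\<exists>!f. f \<in> Hom T X Z))"

definition coproduct ::
    "('o, 'm, 'x) tricat_scheme \<Rightarrow> 'i set \<Rightarrow> ('i \<Rightarrow> 'o) \<Rightarrow> 'o \<Rightarrow> ('i \<Rightarrow> 'm) \<Rightarrow> bool" where
  "coproduct T I F S \<iota> \<longleftrightarrow>
     S \<in> Obj T \<and> (\<forall>i\<in>I. F i \<in> Obj T \<and> \<iota> i \<in> Hom T (F i) S) \<and>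
     (\<forall>Y\<in>Obj T. \<forall>g. (\<forall>i\<in>I. g i \<in> Hom T (F i) Y) \<longrightarrow>
        (\<exists>!h. h \<in> Hom T S Y \<and> (\<forall>i\<in>I. h \<bullet>\<^bsub>T\<^esub> \<iota> i = g i)))"

locale preadditive_category =
  fixes T :: "('o, 'm, 'x) tricat_scheme" (structure)
  assumes hom_disjoint:
      "\<lbrakk>X \<in> Obj T; Y \<in> Obj T; X' \<in> Obj T; Y' \<in> Obj T; f \<in> Hom T X Y; f \<in> Hom T X' Y'\<rbrakk>
        \<Longrightarrow> X = X' \<and> Y = Y'"
    and hom_group: "\<lbrakk>X \<in> Obj T; Y \<in> Obj T\<rbrakk> \<Longrightarrow> comm_group (HomG T X Y)"
    and ident_hom: "X \<in> Obj T \<Longrightarrow> Ident T X \<in> Hom T X X"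
    and comp_hom:
      "\<lbrakk>X \<in> Obj T; Y \<in> Obj T; Z \<in> Obj T; f \<in> Hom T X Y; g \<in> Hom T Y Z\<rbrakk> \<Longrightarrow> g \<bullet> f \<in> Hom T X Z"
    and comp_assoc:
      "\<lbrakk>W \<in> Obj T; X \<in> Obj T; Y \<in> Obj T; Z \<in> Obj T;
        f \<in> Hom T W X; g \<in> Hom T X Y; h \<in> Hom T Y Z\<rbrakk> \<Longrightarrow> (h \<bullet> g) \<bullet> f = h \<bullet> (g \<bullet> f)"
    and ident_left: "\<lbrakk>X \<in> Obj T; Y \<in> Obj T; f \<in> Hom T X Y\<rbrakk> \<Longrightarrow> Ident T Y \<bullet> f = f"
    and ident_right: "\<lbrakk>X \<in> Obj T; Y \<in> Obj T; f \<in> Hom T X Y\<rbrakk> \<Longrightarrow> f \<bullet> Ident T X = f"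
    and comp_add_left:
      "\<lbrakk>X \<in> Obj T; Y \<in> Obj T; Z \<in> Obj T; f \<in> Hom T X Y; g \<in> Hom T Y Z; g' \<in> Hom T Y Z\<rbrakk>
        \<Longrightarrow> (g \<otimes>\<^bsub>HomG T Y Z\<^esub> g') \<bullet> f = (g \<bullet> f) \<otimes>\<^bsub>HomG T X Z\<^esub> (g' \<bullet> f)"
    and comp_add_right:
      "\<lbrakk>X \<in> Obj T; Y \<in> Obj T; Z \<in> Obj T; f \<in> Hom T X Y; f' \<in> Hom T X Y; g \<in> Hom T Y Z\<rbrakk>
        \<Longrightarrow> g \<bullet> (f \<otimes>\<^bsub>HomG T X Y\<^esub> f') = (g \<bullet> f) \<otimes>\<^bsub>HomG T X Z\<^esub> (g \<bullet> f')"

locale additive_category = preadditive_category +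
  assumes zero_object_exists: "\<exists>Z. zero_object T Z"
    and binary_coproducts:
      "\<lbrakk>X \<in> Obj T; Y \<in> Obj T\<rbrakk>
        \<Longrightarrow> \<exists>S \<iota>. coproduct T (UNIV :: bool set) (\<lambda>b. if b then X else Y) S \<iota>"

text \<open>The suspension is an automorphism of the category, not just a self-equivalence, so that its
  integer powers are defined and \<open>\<Sigma>\<^sup>m \<Sigma>\<^sup>n = \<Sigma>\<^sup>m\<^sup>+\<^sup>n\<close> holds on the nose. The last two axioms are the
  completion of a commutative square to a morphism of triangles and the octahedral axiom.\<close>

locale triangulated_category = additive_category +
  assumes susp_obj: "bij_betw (SuspO T) (Obj T) (Obj T)"
    and susp_hom:
      "\<lbrakk>X \<in> Obj T; Y \<in> Obj T\<rbrakk>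
        \<Longrightarrow> SuspM T \<in> iso (HomG T X Y) (HomG T (SuspO T X) (SuspO T Y))"
    and susp_ident: "X \<in> Obj T \<Longrightarrow> SuspM T (Ident T X) = Ident T (SuspO T X)"
    and susp_comp:
      "\<lbrakk>X \<in> Obj T; Y \<in> Obj T; Z \<in> Obj T; f \<in> Hom T X Y; g \<in> Hom T Y Z\<rbrakk>
        \<Longrightarrow> SuspM T (g \<bullet> f) = SuspM T g \<bullet> SuspM T f"
    and tri_typed:
      "Tri T X Y Z f g h \<Longrightarrow> X \<in> Obj T \<and> Y \<in> Obj T \<and> Z \<in> Obj T \<and>
         f \<in> Hom T X Y \<and> g \<in> Hom T Y Z \<and> h \<in> Hom T Z (SuspO T X)"
    and tri_iso:
      "\<lbrakk>Tri T X Y Z f g h; iso_arr T X X' a; iso_arr T Y Y' b; iso_arr T Z Z' c;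
        f' \<in> Hom T X' Y'; g' \<in> Hom T Y' Z'; h' \<in> Hom T Z' (SuspO T X');
        b \<bullet> f = f' \<bullet> a; c \<bullet> g = g' \<bullet> b; SuspM T a \<bullet> h = h' \<bullet> c\<rbrakk>
        \<Longrightarrow> Tri T X' Y' Z' f' g' h'"
    and tri_ident:
      "\<lbrakk>X \<in> Obj T; zero_object T Z\<rbrakk>
        \<Longrightarrow> Tri T X X Z (Ident T X) \<one>\<^bsub>HomG T X Z\<^esub> \<one>\<^bsub>HomG T Z (SuspO T X)\<^esub>"
    and tri_cone:
      "\<lbrakk>X \<in> Obj T; Y \<in> Obj T; f \<in> Hom T X Y\<rbrakk> \<Longrightarrow> \<exists>Z g h. Tri T X Y Z f g h"
    and tri_rotate:
      "\<lbrakk>X \<in> Obj T; Y \<in> Obj T; Z \<in> Obj T;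
        f \<in> Hom T X Y; g \<in> Hom T Y Z; h \<in> Hom T Z (SuspO T X)\<rbrakk>
        \<Longrightarrow> Tri T X Y Z f g h \<longleftrightarrow>
            Tri T Y Z (SuspO T X) g h (inv\<^bsub>HomG T (SuspO T X) (SuspO T Y)\<^esub> (SuspM T f))"
    and tri_complete:
      "\<lbrakk>Tri T X Y Z f g h; Tri T X' Y' Z' f' g' h';
        a \<in> Hom T X X'; b \<in> Hom T Y Y'; b \<bullet> f = f' \<bullet> a\<rbrakk>
        \<Longrightarrow> \<exists>c\<in>Hom T Z Z'. c \<bullet> g = g' \<bullet> b \<and> SuspM T a \<bullet> h = h' \<bullet> c"
    and tri_octahedral:
      "\<lbrakk>Tri T X Y U f a a'; Tri T Y Z W g b b'; Tri T X Z V (g \<bullet> f) c c'\<rbrakk>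
        \<Longrightarrow> \<exists>u v. Tri T U V W u v (SuspM T a \<bullet> b') \<and>
              u \<bullet> a = c \<bullet> g \<and> c' \<bullet> u = a' \<and> v \<bullet> c = b \<and> b' \<bullet> v = SuspM T f \<bullet> c'"

definition suspO :: "('o, 'm, 'x) tricat_scheme \<Rightarrow> int \<Rightarrow> 'o \<Rightarrow> 'o" where
  "suspO T n = (if n \<ge> 0 then SuspO T ^^ nat n
                else inv_into (Obj T) (SuspO T) ^^ nat (- n))"

definition suspM :: "('o, 'm, 'x) tricat_scheme \<Rightarrow> int \<Rightarrow> 'm \<Rightarrow> 'm" where
  "suspM T n = (if n \<ge> 0 then SuspM T ^^ nat n
                else inv_into (Arr T) (SuspM T) ^^ nat (- n))"


section \<open>Functors\<close>

record ('o, 'm) endofun =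
  onO :: "'o \<Rightarrow> 'o"
  onM :: "'m \<Rightarrow> 'm"

definition endofunctor :: "('o, 'm, 'x) tricat_scheme \<Rightarrow> ('o, 'm) endofun \<Rightarrow> bool" where
  "endofunctor T F \<longleftrightarrow>
     (\<forall>X\<in>Obj T. onO F X \<in> Obj T \<and> onM F (Ident T X) = Ident T (onO F X)) \<and>
     (\<forall>X\<in>Obj T. \<forall>Y\<in>Obj T. \<forall>f\<in>Hom T X Y. onM F f \<in> Hom T (onO F X) (onO F Y)) \<and>
     (\<forall>X\<in>Obj T. \<forall>Y\<in>Obj T. \<forall>Z\<in>Obj T. \<forall>f\<in>Hom T X Y. \<forall>g\<in>Hom T Y Z.
        onM F (g \<bullet>\<^bsub>T\<^esub> f) = onM F g \<bullet>\<^bsub>T\<^esub> onM F f)"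

definition id_endofun :: "('o, 'm) endofun" where
  "id_endofun = \<lparr>onO = id, onM = id\<rparr>"

definition susp_endofun :: "('o, 'm, 'x) tricat_scheme \<Rightarrow> int \<Rightarrow> ('o, 'm) endofun" where
  "susp_endofun T n = \<lparr>onO = suspO T n, onM = suspM T n\<rparr>"

definition comp_endofun ::
    "('o, 'm) endofun \<Rightarrow> ('o, 'm) endofun \<Rightarrow> ('o, 'm) endofun" where
  "comp_endofun G F = \<lparr>onO = onO G \<circ> onO F, onM = onM G \<circ> onM F\<rparr>"

definition nat_trans ::
    "('o, 'm, 'x) tricat_scheme \<Rightarrow> ('o, 'm) endofun \<Rightarrow> ('o, 'm) endofun \<Rightarrow> ('o \<Rightarrow> 'm) \<Rightarrow> bool" where
  "nat_trans T F G \<eta> \<longleftrightarrow>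
     (\<forall>X\<in>Obj T. \<eta> X \<in> Hom T (onO F X) (onO G X)) \<and>
     (\<forall>X\<in>Obj T. \<forall>Y\<in>Obj T. \<forall>f\<in>Hom T X Y. \<eta> Y \<bullet>\<^bsub>T\<^esub> onM F f = onM G f \<bullet>\<^bsub>T\<^esub> \<eta> X)"

definition exact_endofunctor :: "('o, 'm, 'x) tricat_scheme \<Rightarrow> ('o, 'm) endofun \<Rightarrow> bool" where
  "exact_endofunctor T F \<longleftrightarrow> endofunctor T F \<and>
     (\<forall>X\<in>Obj T. \<forall>Y\<in>Obj T. onM F \<in> hom (HomG T X Y) (HomG T (onO F X) (onO F Y))) \<and>
     (\<exists>\<tau>. nat_trans T (comp_endofun F (susp_endofun T 1)) (comp_endofun (susp_endofun T 1) F) \<tau> \<and>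
          (\<forall>X\<in>Obj T. iso_arr T (onO F (SuspO T X)) (SuspO T (onO F X)) (\<tau> X)) \<and>
          (\<forall>X Y Z f g h. Tri T X Y Z f g h \<longrightarrow>
             Tri T (onO F X) (onO F Y) (onO F Z) (onM F f) (onM F g) (\<tau> X \<bullet>\<^bsub>T\<^esub> onM F h)))"

definition right_adjoint ::
    "('o, 'm, 'x) tricat_scheme \<Rightarrow> ('o, 'm) endofun \<Rightarrow> ('o, 'm) endofun \<Rightarrow> bool" where
  "right_adjoint T F G \<longleftrightarrow> endofunctor T F \<and> endofunctor T G \<and>
     (\<exists>\<Phi>. (\<forall>A\<in>Obj T. \<forall>Y\<in>Obj T. bij_betw (\<Phi> A Y) (Hom T (onO F A) Y) (Hom T A (onO G Y))) \<and>
          (\<forall>A\<in>Obj T. \<forall>A'\<in>Obj T. \<forall>Y\<in>Obj T. \<forall>Y'\<in>Obj T.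
             \<forall>a\<in>Hom T A' A. \<forall>y\<in>Hom T Y Y'. \<forall>f\<in>Hom T (onO F A) Y.
               \<Phi> A' Y' (y \<bullet>\<^bsub>T\<^esub> f \<bullet>\<^bsub>T\<^esub> onM F a) = onM G y \<bullet>\<^bsub>T\<^esub> \<Phi> A Y f \<bullet>\<^bsub>T\<^esub> a))"

definition localization_functor ::
    "('o, 'm, 'x) tricat_scheme \<Rightarrow> ('o, 'm) endofun \<Rightarrow> ('o \<Rightarrow> 'm) \<Rightarrow> bool" where
  "localization_functor T L \<eta> \<longleftrightarrow>
     exact_endofunctor T L \<and> nat_trans T id_endofun L \<eta> \<and>
     (\<forall>X\<in>Obj T. onM L (\<eta> X) = \<eta> (onO L X) \<and>
        iso_arr T (onO L X) (onO L (onO L X)) (onM L (\<eta> X)))"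

text \<open>\<open>L\<close> is a localization functor with kernel \<open>S\<close>, and there are exact triangles
  \<open>\<Gamma>X \<rightarrow> X \<rightarrow> LX \<rightarrow> \<Sigma>\<Gamma>X\<close>, functorial in \<open>X\<close> and with \<open>\<Gamma>X \<in> S\<close>, whose second map is
  the unit of \<open>L\<close>.\<close>

definition localization_triangle ::
    "('o, 'm, 'x) tricat_scheme \<Rightarrow> 'o set \<Rightarrow> ('o, 'm) endofun \<Rightarrow> ('o, 'm) endofun \<Rightarrow> bool" where
  "localization_triangle T S \<Gamma> L \<longleftrightarrow>
     (\<exists>\<theta> \<eta> \<nu>. localization_functor T L \<eta> \<and>
        {X \<in> Obj T. zero_object T (onO L X)} = S \<and>
        endofunctor T \<Gamma> \<and> nat_trans T \<Gamma> id_endofun \<theta> \<and>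
        nat_trans T L (comp_endofun (susp_endofun T 1) \<Gamma>) \<nu> \<and>
        (\<forall>X\<in>Obj T. onO \<Gamma> X \<in> S \<and> Tri T (onO \<Gamma> X) X (onO L X) (\<theta> X) (\<eta> X) (\<nu> X)))"


section \<open>Coproducts and compact generation\<close>

unbundle cardinal_syntax

text \<open>HOL has no proper classes, so a size bound separates sets from the possibly large
  collection of objects: an index set is small if its cardinality is below the uncountable
  cardinal \<open>\<kappa>\<close>. The set-theoretic reading takes \<open>\<kappa>\<close> to be the cardinality of a Grothendieck
  universe, but no closure properties of \<open>\<kappa>\<close> and no smallness of the Hom groups are required.
  Index sets live in the type of \<open>\<kappa>\<close>, where all smaller cardinalities are realized.\<close>

definition universe_bound :: "'i rel \<Rightarrow> bool" where
  "universe_bound \<kappa> \<longleftrightarrow> Card_order \<kappa> \<and> natLeq <o \<kappa>"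

definition has_small_coproducts :: "('o, 'm, 'x) tricat_scheme \<Rightarrow> 'i rel \<Rightarrow> bool" where
  "has_small_coproducts T \<kappa> \<longleftrightarrow>
     (\<forall>(I :: 'i set) F. |I| <o \<kappa> \<and> F ` I \<subseteq> Obj T \<longrightarrow> (\<exists>S \<iota>. coproduct T I F S \<iota>))"

text \<open>\<open>C\<close> is compact if the canonical maps \<open>\<Oplus>\<^sub>i Hom(C, F i) \<rightarrow> Hom(C, \<Coprod>\<^sub>i F i)\<close> are bijective.\<close>

definition compact_objects :: "('o, 'm, 'x) tricat_scheme \<Rightarrow> 'i rel \<Rightarrow> 'o set" where
  "compact_objects T \<kappa> = {C \<in> Obj T.
     \<forall>(I :: 'i set) F S \<iota>. |I| <o \<kappa> \<and> coproduct T I F S \<iota> \<longrightarrow>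
       (\<lambda>x. gfinprod (HomG T C S) (\<lambda>i. \<iota> i \<bullet>\<^bsub>T\<^esub> x i) I)
         \<in> iso (sum_group I (\<lambda>i. HomG T C (F i))) (HomG T C S)}"

definition compactly_generated :: "('o, 'm, 'x) tricat_scheme \<Rightarrow> 'i rel \<Rightarrow> bool" where
  "compactly_generated T \<kappa> \<longleftrightarrow>
     (\<exists>G. G \<subseteq> compact_objects T \<kappa> \<and> |G| <o \<kappa> \<and>
        (\<forall>X\<in>Obj T. (\<forall>C\<in>G. \<forall>n. Hom T C (suspO T n X) = {\<one>\<^bsub>HomG T C (suspO T n X)\<^esub>}) \<longrightarrow>
           zero_object T X))"


section \<open>Linear structure\<close>

definition graded_center :: "('o, 'm, 'x) tricat_scheme \<Rightarrow> int \<Rightarrow> ('o \<Rightarrow> 'm) set" where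
  "graded_center T n = {\<eta>. nat_trans T id_endofun (susp_endofun T n) \<eta> \<and>
     (\<forall>X\<in>Obj T. \<eta> (SuspO T X) =
        (if even n then SuspM T (\<eta> X)
         else inv\<^bsub>HomG T (SuspO T X) (suspO T n (SuspO T X))\<^esub> (SuspM T (\<eta> X))))}"

text \<open>\<open>\<phi> n r\<close> is the image of \<open>r \<in> Rg n\<close> in the graded center. The product there is the one for
  which evaluation at \<open>X\<close> is multiplicative into \<open>End\<^sup>*(X)\<close>, where \<open>f : X \<rightarrow> \<Sigma>\<^sup>nY\<close> and
  \<open>g : Y \<rightarrow> \<Sigma>\<^sup>mZ\<close> compose to \<open>\<Sigma>\<^sup>n(g) \<bullet> f\<close>.\<close>

definition linear_over ::
    "('r, 'z) ring_scheme \<Rightarrow> (int \<Rightarrow> 'r set) \<Rightarrow> ('o, 'm, 'x) tricat_scheme \<Rightarrow>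
     (int \<Rightarrow> 'r \<Rightarrow> 'o \<Rightarrow> 'm) \<Rightarrow> bool" where
  "linear_over R Rg T \<phi> \<longleftrightarrow>
     (\<forall>n. \<forall>r\<in>Rg n. \<phi> n r \<in> graded_center T n) \<and>
     (\<forall>X\<in>Obj T. \<phi> 0 \<one>\<^bsub>R\<^esub> X = Ident T X) \<and>
     (\<forall>X\<in>Obj T. \<forall>n. \<forall>r\<in>Rg n. \<forall>s\<in>Rg n.
        \<phi> n (r \<oplus>\<^bsub>R\<^esub> s) X = \<phi> n r X \<otimes>\<^bsub>HomG T X (suspO T n X)\<^esub> \<phi> n s X) \<and>
     (\<forall>X\<in>Obj T. \<forall>m n. \<forall>r\<in>Rg m. \<forall>s\<in>Rg n.
        \<phi> (m + n) (r \<otimes>\<^bsub>R\<^esub> s) X = suspM T n (\<phi> m r X) \<bullet>\<^bsub>T\<^esub> \<phi> n s X)"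

text \<open>The graded module \<open>Hom\<^sup>*(X, Y)\<close> and the action of \<open>R\<close> on it through \<open>Y\<close>; for compact
  \<open>X\<close> it is the cohomology \<open>H\<^sup>*\<^sub>X(Y)\<close>.\<close>

definition graded_Hom :: "('o, 'm, 'x) tricat_scheme \<Rightarrow> 'o \<Rightarrow> 'o \<Rightarrow> int \<Rightarrow> 'm monoid" where
  "graded_Hom T X Y n = HomG T X (suspO T n Y)"

definition graded_Hom_act ::
    "('o, 'm, 'x) tricat_scheme \<Rightarrow> (int \<Rightarrow> 'r \<Rightarrow> 'o \<Rightarrow> 'm) \<Rightarrow> 'o \<Rightarrow> int \<Rightarrow> 'r \<Rightarrow> int \<Rightarrow> 'm \<Rightarrow> 'm" where
  "graded_Hom_act T \<phi> Y k r n f = suspM T n (\<phi> k r Y) \<bullet>\<^bsub>T\<^esub> f"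

locale compactly_generated_linear_category =
  graded_commutative_ring R Rg + noetherian_ring R + triangulated_category T
  for R :: "('r, 'z) ring_scheme" (structure)
    and Rg :: "int \<Rightarrow> 'r set"
    and T :: "('o, 'm, 'x) tricat_scheme" +
  fixes \<phi> :: "int \<Rightarrow> 'r \<Rightarrow> 'o \<Rightarrow> 'm"
    and \<kappa> :: "'i rel"
  assumes universe: "universe_bound \<kappa>"
    and small_coproducts: "has_small_coproducts T \<kappa>"
    and compact_generation: "compactly_generated T \<kappa>"
    and linear: "linear_over R Rg T \<phi>"


section \<open>Local cohomology and homology, cosupport, Koszul objects\<close>

definition supported_on ::
    "('r, 'z) ring_scheme \<Rightarrow> (int \<Rightarrow> 'r set) \<Rightarrow> ('o, 'm, 'x) tricat_scheme \<Rightarrow>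
     (int \<Rightarrow> 'r \<Rightarrow> 'o \<Rightarrow> 'm) \<Rightarrow> 'i rel \<Rightarrow> 'r set set \<Rightarrow> 'o set" where
  "supported_on R Rg T \<phi> \<kappa> \<V> = {X \<in> Obj T.
     \<forall>C\<in>compact_objects T \<kappa>. \<forall>\<pp>\<in>Spec R Rg - \<V>.
       localization_vanishes R Rg \<pp> (graded_Hom T C X) (graded_Hom_act T \<phi> X)}"

text \<open>A choice, for every specialization closed subset, of the functors \<open>\<Gamma>\<^sub>\<V>\<close>, \<open>L\<^sub>\<V>\<close> and of
  right adjoints \<open>\<Lambda>\<^sup>\<V>\<close>, \<open>V\<^sup>\<V>\<close> (here \<open>\<Lambda>\<close>, \<open>\<Upsilon>\<close>) of \<open>\<Gamma>\<^sub>\<V>\<close>, \<open>L\<^sub>\<V>\<close>. They are unique up to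
  natural isomorphism.\<close>

definition local_functors ::
    "('r, 'z) ring_scheme \<Rightarrow> (int \<Rightarrow> 'r set) \<Rightarrow> ('o, 'm, 'x) tricat_scheme \<Rightarrow>
     (int \<Rightarrow> 'r \<Rightarrow> 'o \<Rightarrow> 'm) \<Rightarrow> 'i rel \<Rightarrow>
     ('r set set \<Rightarrow> ('o, 'm) endofun) \<Rightarrow> ('r set set \<Rightarrow> ('o, 'm) endofun) \<Rightarrow>
     ('r set set \<Rightarrow> ('o, 'm) endofun) \<Rightarrow> ('r set set \<Rightarrow> ('o, 'm) endofun) \<Rightarrow> bool" where
  "local_functors R Rg T \<phi> \<kappa> \<Gamma> L \<Lambda> \<Upsilon> \<longleftrightarrow>
     (\<forall>\<V>. specialization_closed R Rg \<V> \<longrightarrow>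
        localization_triangle T (supported_on R Rg T \<phi> \<kappa> \<V>) (\<Gamma> \<V>) (L \<V>) \<and>
        right_adjoint T (\<Gamma> \<V>) (\<Lambda> \<V>) \<and> right_adjoint T (L \<V>) (\<Upsilon> \<V>))"

definition cosupp ::
    "('r, 'z) ring_scheme \<Rightarrow> (int \<Rightarrow> 'r set) \<Rightarrow> ('o, 'm, 'x) tricat_scheme \<Rightarrow>
     ('r set set \<Rightarrow> ('o, 'm) endofun) \<Rightarrow> ('r set set \<Rightarrow> ('o, 'm) endofun) \<Rightarrow> 'o \<Rightarrow> 'r set set" where
  "cosupp R Rg T \<Lambda> \<Upsilon> X = {\<pp> \<in> Spec R Rg.
     \<not> zero_object T
         (onO (comp_endofun (\<Upsilon> (non_generalizations R Rg \<pp>)) (\<Lambda> (closed_locus R Rg \<pp>))) X)}"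

text \<open>\<open>koszul T \<phi> X rs Y\<close>: \<open>Y\<close> arises from \<open>X\<close> by successively choosing a cone of the action of
  each \<open>(d, r)\<close> in \<open>rs\<close>, where \<open>d\<close> is the degree of \<open>r\<close>.\<close>

inductive koszul ::
    "('o, 'm, 'x) tricat_scheme \<Rightarrow> (int \<Rightarrow> 'r \<Rightarrow> 'o \<Rightarrow> 'm) \<Rightarrow>
     'o \<Rightarrow> (int \<times> 'r) list \<Rightarrow> 'o \<Rightarrow> bool"
  for T \<phi> where
  koszul_Nil: "X \<in> Obj T \<Longrightarrow> koszul T \<phi> X [] X"
| koszul_Cons: "Tri T X (suspO T d X) Z (\<phi> d r X) g h \<Longrightarrow> koszul T \<phi> Z rs Y
    \<Longrightarrow> koszul T \<phi> X ((d, r) # rs) Y"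

definition koszul_object ::
    "('r, 'z) ring_scheme \<Rightarrow> (int \<Rightarrow> 'r set) \<Rightarrow> ('o, 'm, 'x) tricat_scheme \<Rightarrow>
     (int \<Rightarrow> 'r \<Rightarrow> 'o \<Rightarrow> 'm) \<Rightarrow> 'r set \<Rightarrow> 'o \<Rightarrow> 'o \<Rightarrow> bool" where
  "koszul_object R Rg T \<phi> \<aa> X Y \<longleftrightarrow>
     (\<exists>rs. (\<forall>(d, r)\<in>set rs. r \<in> Rg d) \<and> Idl\<^bsub>R\<^esub> (snd ` set rs) = \<aa> \<and> koszul T \<phi> X rs Y)"

end

theory Submission
  imports Defs
begin

text \<open>
  Write \<open>Z = \<Z>(\<pp>)\<close> and \<open>W = \<V>(\<pp>)\<close>, let \<open>T\<^sub>V\<close> be the objects supported on \<open>V\<close>, and call \<open>Y\<close> local for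
  \<open>V\<close> if \<open>Hom(A, Y) = 0\<close> for all \<open>A \<in> T\<^sub>V\<close>. Each of the four conditions is the negation of

  \<^item> (\<dagger>) \<open>Hom(B, X) = 0\<close> for every \<open>B \<in> T\<^sub>W\<close> that is local for \<open>Z\<close>.

  By adjunction \<open>\<Upsilon>\<^sup>Z \<Lambda>\<^sup>W X = 0\<close> says that \<open>Hom(\<Gamma>\<^sub>W B, X) = 0\<close> for all \<open>B\<close> local for \<open>Z\<close>, and
  \<open>\<Gamma>\<^sub>W \<Upsilon>\<^sup>Z X = 0\<close> says that \<open>Hom(L\<^sub>Z A, X) = 0\<close> for all \<open>A \<in> T\<^sub>W\<close>. Both amount to (\<dagger>) because \<open>\<Gamma>\<^sub>W\<close>
  preserves the local objects for \<open>Z\<close> (\<open>\<Gamma>_local\<close>) and \<open>L\<^sub>Z\<close> preserves \<open>T\<^sub>W\<close> (\<open>L_supported\<close>), and an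
  object as in (\<dagger>) is a retract of its images under both functors. As \<open>\<Upsilon>\<^sup>Z X\<close> is the coreflection of \<open>X\<close> into the
  local objects, (\<dagger>) holds for \<open>X\<close> if and only if it holds for \<open>\<Upsilon>\<^sup>Z X\<close>; this settles the last
  condition.

  The two preservation statements rest on the action of \<open>R\<close>. An object supported on \<open>V\<close> is zero as
  soon as every prime of \<open>V\<close> contains a homogeneous element acting invertibly on it, since otherwise
  its cohomology would have an associated prime, each element of which kills a nonzero class (\<open>supported_invertible_zero\<close>). The cone of the action
  of \<open>s\<close> is annihilated by \<open>s\<^sup>2\<close> and so is supported on the primes containing \<open>s\<close>
  (\<open>cone_supported\<close>). Together they identify the local objects for \<open>Z\<close> with the objects on which
  all homogeneous \<open>s \<notin> \<pp>\<close> are invertible (\<open>local_iff_invertible\<close>), a property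
  inherited by coreflections into classes closed under shifts.

  For the Koszul object, let \<open>\<E>\<close> be a class of objects, closed under shifts and
  cones, into which \<open>X\<close> has a coreflection \<open>c\<close>. Then
  \<open>Hom(B, X//s) = 0\<close> for all \<open>B \<in> \<E>\<close> means that \<open>s\<close> is invertible on \<open>c\<close>, and this means that
  \<open>Hom(B, X) = 0\<close> for those \<open>B \<in> \<E>\<close> that are supported on the primes containing \<open>s\<close>
  (\<open>orth_koszul_step\<close>). Running through generators of \<open>\<pp>\<close>, with \<open>\<E>\<close> shrinking from the local objects
  for \<open>Z\<close> to those that moreover lie in \<open>T\<^sub>W\<close>, turns \<open>\<Upsilon>\<^sup>Z(X//\<pp>) = 0\<close> into (\<dagger>).
\<close>

section \<open>Homogeneous ideals and annihilators\<close>

context graded_ring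
begin

lemma degree_carrier: "x \<in> Rg k \<Longrightarrow> x \<in> carrier R"
  using subgroup_degree[of k] additive_subgroup.a_subset by blast

lemma zero_degree: "\<zero> \<in> Rg k"
  by (simp add: additive_subgroup.zero_closed subgroup_degree)

lemma add_degree: "x \<in> Rg k \<Longrightarrow> y \<in> Rg k \<Longrightarrow> x \<oplus> y \<in> Rg k"
  by (meson additive_subgroup.a_closed subgroup_degree)

lemma minus_degree: "x \<in> Rg k \<Longrightarrow> \<ominus> x \<in> Rg k"
  by (simp add: additive_subgroup.a_inv_closed is_abelian_group subgroup_degree)

lemma homogeneous_componentsI:
  assumes "\<And>n. c n \<in> Rg n" "finite F" "\<And>n. n \<notin> F \<Longrightarrow> c n = \<zero>" "x = (\<Oplus>n\<in>F. c n)"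
  shows "homogeneous_components R Rg x c"
proof -
  have sub: "{n. c n \<noteq> \<zero>} \<subseteq> F" using assms(3) by blast
  have car: "c n \<in> carrier R" for n using degree_carrier[OF assms(1)] .
  have "(\<Oplus>n\<in>{n. c n \<noteq> \<zero>}. c n) = (\<Oplus>n\<in>F. c n)"
    by (rule add.finprod_mono_neutral_cong_left[OF assms(2) sub])
      (use car in auto)
  then show ?thesis
    unfolding homogeneous_components_def
    using assms(1,4) finite_subset[OF sub assms(2)] by simp
qed

lemma homogeneous_components_sum:
  assumes "homogeneous_components R Rg x c" "finite F" "{n. c n \<noteq> \<zero>} \<subseteq> F"
  shows "x = (\<Oplus>n\<in>F. c n)"
proof -
  have c: "\<And>n. c n \<in> Rg n" using assms(1) by (simp add: homogeneous_components_def)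
  have car: "c n \<in> carrier R" for n using degree_carrier[OF c] .
  have "(\<Oplus>n\<in>{n. c n \<noteq> \<zero>}. c n) = (\<Oplus>n\<in>F. c n)"
    by (rule add.finprod_mono_neutral_cong_left[OF assms(2,3)]) (use car in auto)
  then show ?thesis using assms(1) by (simp add: homogeneous_components_def)
qed

lemma homogeneous_components_degree:
  "homogeneous_components R Rg x c \<Longrightarrow> c n \<in> Rg n"
  by (simp add: homogeneous_components_def)

lemma homogeneous_components_finite:
  "homogeneous_components R Rg x c \<Longrightarrow> finite {n. c n \<noteq> \<zero>}"
  by (simp add: homogeneous_components_def)

lemma homogeneous_components_single:
  assumes "x \<in> Rg k"
  shows "homogeneous_components R Rg x (\<lambda>n. if n = k then x else \<zero>)"
  by (rule homogeneous_componentsI[where F="{k}"])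
    (auto simp: assms zero_degree finsum_insert degree_carrier[OF assms])

lemma homogeneous_components_add:
  assumes x: "homogeneous_components R Rg x c" and y: "homogeneous_components R Rg y d"
  shows "homogeneous_components R Rg (x \<oplus> y) (\<lambda>n. c n \<oplus> d n)"
proof -
  let ?F = "{n. c n \<noteq> \<zero>} \<union> {n. d n \<noteq> \<zero>}"
  have f: "finite ?F"
    using homogeneous_components_finite[OF x] homogeneous_components_finite[OF y] by simp
  note deg = homogeneous_components_degree[OF x] homogeneous_components_degree[OF y]
  have "x \<oplus> y = (\<Oplus>n\<in>?F. c n) \<oplus> (\<Oplus>n\<in>?F. d n)"
    using homogeneous_components_sum[OF x f] homogeneous_components_sum[OF y f] by simp
  also have "\<dots> = (\<Oplus>n\<in>?F. c n \<oplus> d n)"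
    by (rule finsum_addf[symmetric]) (auto intro: deg degree_carrier)
  finally show ?thesis
    using f by (intro homogeneous_componentsI[where F="?F"]) (auto intro: deg add_degree)
qed

definition homogeneous_span :: "(int \<Rightarrow> 'a set) \<Rightarrow> 'a set" where
  "homogeneous_span H = {x \<in> carrier R. \<exists>c. homogeneous_components R Rg x c \<and> (\<forall>k. c k \<in> H k)}"

lemma homogeneous_span_degree:
  assumes "\<And>k. H k \<subseteq> Rg k" "\<And>k. \<zero> \<in> H k"
  shows "homogeneous_span H \<inter> Rg k = H k"
proof (intro equalityI subsetI)
  fix x assume "x \<in> homogeneous_span H \<inter> Rg k"
  then obtain c where c: "homogeneous_components R Rg x c" "\<forall>k. c k \<in> H k" and x: "x \<in> Rg k"
    by (auto simp: homogeneous_span_def)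
  have "c = (\<lambda>n. if n = k then x else \<zero>)"
    using direct_sum[OF degree_carrier[OF x]] c(1) homogeneous_components_single[OF x] by blast
  then show "x \<in> H k" using c(2) by (metis (full_types))
next
  fix x assume x: "x \<in> H k"
  then have xk: "x \<in> Rg k" using assms by blast
  show "x \<in> homogeneous_span H \<inter> Rg k"
    unfolding homogeneous_span_def using homogeneous_components_single[OF xk] x xk assms(2)
    by (auto intro!: degree_carrier exI[of _ "\<lambda>n. if n = k then x else \<zero>"])
qed

text \<open>Every element is a sum of homogeneous ones, so closure of \<open>H\<close> under multiplication by
  homogeneous elements gives closure under multiplication by all of \<open>R\<close>.\<close>

lemma homogeneous_span_ideal:
  assumes H: "\<And>k. H k \<subseteq> Rg k" "\<And>k. \<zero> \<in> H k"
    and add: "\<And>k x y. x \<in> H k \<Longrightarrow> y \<in> H k \<Longrightarrow> x \<oplus> y \<in> H k"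
    and left: "\<And>k j x r. x \<in> H k \<Longrightarrow> r \<in> Rg j \<Longrightarrow> r \<otimes> x \<in> H (j + k)"
    and right: "\<And>k j x r. x \<in> H k \<Longrightarrow> r \<in> Rg j \<Longrightarrow> x \<otimes> r \<in> H (k + j)"
  shows "homogeneous_ideal R Rg (homogeneous_span H)"
proof -
  let ?I = "homogeneous_span H"
  have I_carrier: "x \<in> carrier R" if "x \<in> ?I" for x using that by (simp add: homogeneous_span_def)
  have H_I: "x \<in> ?I" if "x \<in> H k" for x k using homogeneous_span_degree[OF H, of k] that by blast
  have I_add: "x \<oplus> y \<in> ?I" if xy: "x \<in> ?I" "y \<in> ?I" for x y
  proof -
    obtain c d where "homogeneous_components R Rg x c" "\<forall>k. c k \<in> H k"
        "homogeneous_components R Rg y d" "\<forall>k. d k \<in> H k"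
      using xy unfolding homogeneous_span_def by blast
    then have "homogeneous_components R Rg (x \<oplus> y) (\<lambda>n. c n \<oplus> d n)" "\<forall>k. c k \<oplus> d k \<in> H k"
      using homogeneous_components_add add by blast+
    then show ?thesis using I_carrier[OF xy(1)] I_carrier[OF xy(2)]
      unfolding homogeneous_span_def by blast
  qed
  have I_zero: "\<zero> \<in> ?I" using H_I[OF H(2)] .
  have I_sum: "(\<Oplus>i\<in>F. f i) \<in> ?I" if "finite F" "\<And>i. i \<in> F \<Longrightarrow> f i \<in> ?I" for F :: "int set" and f
    using that
  proof (induction F)
    case empty then show ?case using I_zero by simp
  next
    case (insert i F)
    then show ?case by (subst finsum_insert) (auto intro: I_add I_carrier)
  qed
  have I_decomp: "\<exists>F c. finite F \<and> (\<forall>k. c k \<in> H k) \<and> x = (\<Oplus>n\<in>F. c n)" if "x \<in> ?I" for x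
    using that homogeneous_components_sum homogeneous_components_finite
    unfolding homogeneous_span_def by blast
  have R_decomp: "\<exists>F c. finite F \<and> (\<forall>k. c k \<in> Rg k) \<and> r = (\<Oplus>n\<in>F. c n)" if "r \<in> carrier R" for r
    using direct_sum[OF that] unfolding homogeneous_components_def by blast
  have I_mult: "r \<otimes> x \<in> ?I \<and> x \<otimes> r \<in> ?I" if x: "x \<in> ?I" and r: "r \<in> carrier R" for x r
  proof -
    obtain F c where F: "finite F" "\<And>k. c k \<in> H k" "x = (\<Oplus>n\<in>F. c n)" using I_decomp[OF x] by blast
    obtain G d where G: "finite G" "\<And>k. d k \<in> Rg k" "r = (\<Oplus>n\<in>G. d n)" using R_decomp[OF r] by blast
    have cR: "c \<in> F \<rightarrow> carrier R" using F(2) H(1) degree_carrier by blast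
    have dR: "d \<in> G \<rightarrow> carrier R" using G(2) degree_carrier by blast
    have cn: "c n \<in> carrier R" for n using F(2) H(1) degree_carrier by blast
    have dn: "d n \<in> carrier R" for n using G(2) degree_carrier by blast
    have "r \<otimes> x = (\<Oplus>n\<in>F. \<Oplus>j\<in>G. d j \<otimes> c n)"
    proof -
      have "r \<otimes> x = (\<Oplus>n\<in>F. r \<otimes> c n)"
        unfolding F(3) by (rule finsum_rdistr[OF F(1) r cR])
      also have "\<dots> = (\<Oplus>n\<in>F. \<Oplus>j\<in>G. d j \<otimes> c n)"
        unfolding G(3) by (simp only: finsum_ldistr[OF G(1) cn dR])
      finally show ?thesis .
    qed
    moreover have "x \<otimes> r = (\<Oplus>n\<in>F. \<Oplus>j\<in>G. c n \<otimes> d j)"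
    proof -
      have "x \<otimes> r = (\<Oplus>n\<in>F. c n \<otimes> r)"
        unfolding F(3) by (rule finsum_ldistr[OF F(1) r cR])
      also have "\<dots> = (\<Oplus>n\<in>F. \<Oplus>j\<in>G. c n \<otimes> d j)"
        unfolding G(3) by (simp only: finsum_rdistr[OF G(1) cn dR])
      finally show ?thesis .
    qed
    moreover have "(\<Oplus>n\<in>F. \<Oplus>j\<in>G. d j \<otimes> c n) \<in> ?I"
      using left[OF F(2) G(2)] by (intro I_sum[OF F(1)] I_sum[OF G(1)]) (rule H_I)
    moreover have "(\<Oplus>n\<in>F. \<Oplus>j\<in>G. c n \<otimes> d j) \<in> ?I"
      using right[OF F(2) G(2)] by (intro I_sum[OF F(1)] I_sum[OF G(1)]) (rule H_I)
    ultimately show ?thesis by simp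
  qed
  have I_minus: "\<ominus> x \<in> ?I" if "x \<in> ?I" for x
  proof -
    have "(\<ominus> \<one>) \<otimes> x \<in> ?I" using I_mult[OF that] by simp
    then show ?thesis using I_carrier[OF that] by (simp add: l_minus)
  qed
  have "ideal ?I R"
  proof (rule idealI)
    show "ring R" by (rule ring_axioms)
    show "subgroup ?I (add_monoid R)"
      by (rule group.subgroupI)
        (auto simp: I_add I_carrier I_minus a_inv_def[symmetric] add.group_axioms intro: I_zero)
  qed (use I_mult in auto)
  moreover have "c n \<in> ?I" if "x \<in> ?I" "homogeneous_components R Rg x c" for x c n
  proof -
    obtain d where d: "homogeneous_components R Rg x d" "\<forall>k. d k \<in> H k"
      using \<open>x \<in> ?I\<close> by (auto simp: homogeneous_span_def)
    then have "c = d" using direct_sum[OF I_carrier[OF \<open>x \<in> ?I\<close>]] that(2) by blast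
    then show ?thesis using d(2) H_I by blast
  qed
  ultimately show ?thesis by (simp add: homogeneous_ideal_def)
qed

end

text \<open>A chain of ideals in a noetherian ring contains its union, so Zorn's lemma applies.\<close>

lemma (in noetherian_ring) exists_maximal_ideal_in:
  assumes "\<A> \<noteq> {}" "\<And>I. I \<in> \<A> \<Longrightarrow> ideal I R"
  shows "\<exists>M\<in>\<A>. \<forall>I\<in>\<A>. M \<subseteq> I \<longrightarrow> I = M"
proof (rule subset_Zorn_nonempty[OF assms(1)])
  fix C assume C: "C \<noteq> {}" "subset.chain \<A> C"
  have "\<A> \<subseteq> {I. ideal I R}" using assms(2) by blast
  with C(2) have "subset.chain {I. ideal I R} C"
    unfolding pred_on.chain_def by (meson subset_trans)
  then have "\<Union>C \<in> C" using ideal_chain_is_trivial C(1) by blast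
  then show "\<Union>C \<in> \<A>" using C(2) unfolding pred_on.chain_def by blast
qed

section \<open>Graded modules\<close>

locale graded_module = graded_commutative_ring R Rg
  for R :: "('r, 'z) ring_scheme" (structure) and Rg :: "int \<Rightarrow> 'r set" +
  fixes M :: "int \<Rightarrow> 'm monoid" and act :: "int \<Rightarrow> 'r \<Rightarrow> int \<Rightarrow> 'm \<Rightarrow> 'm"
  assumes module_group: "group (M n)"
    and act_closed: "r \<in> Rg k \<Longrightarrow> m \<in> carrier (M n) \<Longrightarrow> act k r n m \<in> carrier (M (k + n))"
    and act_ring_one: "m \<in> carrier (M n) \<Longrightarrow> act 0 \<one> n m = m"
    and act_unit: "r \<in> Rg k \<Longrightarrow> act k r n \<one>\<^bsub>M n\<^esub> = \<one>\<^bsub>M (k + n)\<^esub>"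
    and act_add: "r \<in> Rg k \<Longrightarrow> s \<in> Rg k \<Longrightarrow> m \<in> carrier (M n) \<Longrightarrow>
      act k (r \<oplus> s) n m = act k r n m \<otimes>\<^bsub>M (k + n)\<^esub> act k s n m"
    and act_mult: "r \<in> Rg j \<Longrightarrow> s \<in> Rg k \<Longrightarrow> m \<in> carrier (M n) \<Longrightarrow>
      act (j + k) (r \<otimes> s) n m = act j r (k + n) (act k s n m)"
begin

lemma act_zero:
  assumes "m \<in> carrier (M n)" shows "act k \<zero> n m = \<one>\<^bsub>M (k + n)\<^esub>"
proof -
  interpret group "M (k + n)" by (rule module_group)
  have "act k \<zero> n m \<otimes>\<^bsub>M (k + n)\<^esub> act k \<zero> n m = act k \<zero> n m"
    using act_add[OF zero_degree zero_degree assms] by simp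
  then show ?thesis using act_closed[OF zero_degree assms] by (simp add: r_cancel_one)
qed

lemma act_minus:
  assumes "r \<in> Rg k" "m \<in> carrier (M n)"
  shows "act k (\<ominus> r) n m = inv\<^bsub>M (k + n)\<^esub> act k r n m"
proof -
  interpret group "M (k + n)" by (rule module_group)
  have "act k (\<ominus> r) n m \<otimes>\<^bsub>M (k + n)\<^esub> act k r n m = \<one>\<^bsub>M (k + n)\<^esub>"
    using act_add[OF minus_degree[OF assms(1)] assms] degree_carrier[OF assms(1)]
    by (simp add: act_zero[OF assms(2)] l_neg)
  then show ?thesis
    by (simp add: inv_equality act_closed minus_degree assms)
qed

definition kills :: "int \<Rightarrow> 'r \<Rightarrow> int \<Rightarrow> 'm \<Rightarrow> bool" where
  "kills k r n m \<longleftrightarrow> act k r n m = \<one>\<^bsub>M (k + n)\<^esub>"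

lemma kills_minus:
  assumes "r \<in> Rg k" "m \<in> carrier (M n)" shows "kills k (\<ominus> r) n m \<longleftrightarrow> kills k r n m"
proof -
  interpret group "M (k + n)" by (rule module_group)
  show ?thesis
    using act_closed[OF assms] by (simp add: kills_def act_minus[OF assms])
qed

lemma kills_mult_left:
  assumes "kills k s n m" "r \<in> Rg j" "s \<in> Rg k" "m \<in> carrier (M n)"
  shows "kills (j + k) (r \<otimes> s) n m"
  using assms act_mult[OF assms(2-4)] act_unit[OF assms(2), of "k + n"]
  by (simp add: kills_def add.assoc)

lemma kills_mult_right:
  assumes "kills k s n m" "r \<in> Rg j" "s \<in> Rg k" "m \<in> carrier (M n)"
  shows "kills (k + j) (s \<otimes> r) n m"
proof -
  have 1: "kills (k + j) (r \<otimes> s) n m" using kills_mult_left[OF assms] by (simp add: add.commute)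
  have "r \<otimes> s \<in> Rg (k + j)" using mult_degree[OF assms(2,3)] by (simp add: add.commute)
  then show ?thesis
    using graded_commute[OF assms(3,2)] kills_minus[OF _ assms(4)] 1 by auto
qed

text \<open>The action is defined for homogeneous scalars only, so an element annihilates \<open>m\<close> if all its
  homogeneous components kill \<open>m\<close>.\<close>

definition annihilator :: "int \<Rightarrow> 'm \<Rightarrow> 'r set" where
  "annihilator n m = homogeneous_span (\<lambda>k. {r \<in> Rg k. kills k r n m})"

lemma annihilator_ideal:
  assumes "m \<in> carrier (M n)" shows "homogeneous_ideal R Rg (annihilator n m)"
  unfolding annihilator_def
proof (rule homogeneous_span_ideal)
  show "\<zero> \<in> {r \<in> Rg k. kills k r n m}" for k
    by (simp add: zero_degree kills_def act_zero[OF assms])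
  show "x \<oplus> y \<in> {r \<in> Rg k. kills k r n m}"
    if "x \<in> {r \<in> Rg k. kills k r n m}" "y \<in> {r \<in> Rg k. kills k r n m}" for k x y
  proof -
    interpret group "M (k + n)" by (rule module_group)
    show ?thesis using that assms by (simp add: add_degree kills_def act_add)
  qed
qed (use assms kills_mult_left kills_mult_right mult_degree in auto)

lemma annihilator_iff:
  assumes "m \<in> carrier (M n)" "r \<in> Rg k"
  shows "r \<in> annihilator n m \<longleftrightarrow> kills k r n m"
proof -
  have "annihilator n m \<inter> Rg k = {r \<in> Rg k. kills k r n m}"
    unfolding annihilator_def
    by (rule homogeneous_span_degree) (auto simp: zero_degree kills_def act_zero[OF assms(1)])
  then show ?thesis using assms(2) by blast
qed

text \<open>A maximal annihilator of a nonzero homogeneous element is prime: if \<open>ab\<close> kills \<open>m\<close> and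
  \<open>b\<close> does not, then \<open>bm\<close> is a nonzero element whose annihilator contains that of \<open>m\<close>, hence
  equals it, and \<open>a\<close> lies in it.\<close>

lemma exists_associated_prime:
  assumes noeth: "noetherian_ring R" and m0: "m0 \<in> carrier (M n0)" "m0 \<noteq> \<one>\<^bsub>M n0\<^esub>"
  shows "\<exists>n m. m \<in> carrier (M n) \<and> m \<noteq> \<one>\<^bsub>M n\<^esub> \<and> annihilator n m \<in> Spec R Rg"
proof -
  define \<A> where "\<A> = {annihilator n m | n m. m \<in> carrier (M n) \<and> m \<noteq> \<one>\<^bsub>M n\<^esub>}"
  have "\<A> \<noteq> {}" using m0 by (auto simp: \<A>_def)
  moreover have "ideal I R" if "I \<in> \<A>" for I
    using that annihilator_ideal by (auto simp: \<A>_def homogeneous_ideal_def)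
  ultimately obtain I where I: "I \<in> \<A>" "\<And>J. J \<in> \<A> \<Longrightarrow> I \<subseteq> J \<Longrightarrow> J = I"
    using noetherian_ring.exists_maximal_ideal_in[OF noeth, of \<A>] by blast
  then obtain n m where m: "m \<in> carrier (M n)" "m \<noteq> \<one>\<^bsub>M n\<^esub>" and In: "I = annihilator n m"
    by (auto simp: \<A>_def)
  have "\<one> \<notin> I"
    using annihilator_iff[OF m(1) one_degree] m act_ring_one[OF m(1)] by (simp add: In kills_def)
  then have proper: "I \<noteq> carrier R" using one_closed by metis
  have prime: "a \<in> I \<or> b \<in> I" if a: "a \<in> Rg i" and b: "b \<in> Rg j" and ab: "a \<otimes> b \<in> I" for a b i j
  proof (cases "b \<in> I")
    case False
    let ?m = "act j b n m"
    have bm: "?m \<in> carrier (M (j + n))" using act_closed[OF b m(1)] .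
    have "?m \<noteq> \<one>\<^bsub>M (j + n)\<^esub>"
      using False annihilator_iff[OF m(1) b] by (simp add: In kills_def)
    then have J: "annihilator (j + n) ?m \<in> \<A>" using bm by (auto simp: \<A>_def)
    have hom_sub: "r \<in> annihilator (j + n) ?m" if "r \<in> I" "r \<in> Rg k" for r k
    proof -
      have "kills k r n m" using that annihilator_iff[OF m(1)] In by blast
      then have "kills (k + j) (r \<otimes> b) n m" by (rule kills_mult_right[OF _ b that(2) m(1)])
      then have "kills k r (j + n) ?m"
        using act_mult[OF that(2) b m(1)] by (simp add: kills_def add.assoc)
      then show ?thesis using annihilator_iff[OF bm that(2)] by blast
    qed
    have "I \<subseteq> annihilator (j + n) ?m"
    proof
      fix x assume "x \<in> I"
      then obtain c where "x \<in> carrier R" "homogeneous_components R Rg x c"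
          "\<forall>k. c k \<in> Rg k \<and> kills k (c k) n m"
        by (auto simp: In annihilator_def homogeneous_span_def)
      moreover from this have "kills k (c k) (j + n) ?m" for k
        using hom_sub[of "c k" k] annihilator_iff[OF m(1)] annihilator_iff[OF bm] In by blast
      ultimately show "x \<in> annihilator (j + n) ?m"
        by (auto simp: annihilator_def homogeneous_span_def)
    qed
    then have "annihilator (j + n) ?m = I" using I(2)[OF J] by blast
    moreover have "a \<in> annihilator (j + n) ?m"
      using ab annihilator_iff[OF m(1) mult_degree[OF a b]] annihilator_iff[OF bm a]
        act_mult[OF a b m(1)] by (simp add: In kills_def add.assoc)
    ultimately show ?thesis by blast
  qed simp
  have "I \<in> Spec R Rg"
    using annihilator_ideal[OF m(1)] proper prime by (auto simp: Spec_def In)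
  then show ?thesis using m In by blast
qed

text \<open>If every element is killed by some homogeneous element outside \<open>\<qq>\<close>, two fractions \<open>s\<inverse>m\<close> and
  \<open>s'\<inverse>m'\<close> have a common expansion with both numerators zero: expand the first by \<open>u\<^sub>2u\<^sub>1s'\<close> and the
  second by \<open>\<plusminus>u\<^sub>2u\<^sub>1s\<close>, where \<open>u\<^sub>1\<close> kills \<open>s'm\<close> and \<open>u\<^sub>2\<close> kills \<open>u\<^sub>1sm'\<close>.\<close>

lemma fractions_related:
  assumes q: "\<qq> \<in> Spec R Rg"
    and killed: "\<And>n m. m \<in> carrier (M n) \<Longrightarrow> \<exists>k s. s \<in> Rg k \<and> s \<notin> \<qq> \<and> kills k s n m"
    and x: "x \<in> fractions Rg \<qq> M n" and y: "y \<in> fractions Rg \<qq> M n"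
  shows "(x, y) \<in> fraction_rel R Rg \<qq> M act n"
proof -
  obtain k s m where xe: "x = (k, s, m)" by (cases x)
  obtain k' s' m' where ye: "y = (k', s', m')" by (cases y)
  have s: "s \<in> Rg k" "s \<notin> \<qq>" "m \<in> carrier (M (n + k))"
    and s': "s' \<in> Rg k'" "s' \<notin> \<qq>" "m' \<in> carrier (M (n + k'))"
    using x y by (auto simp: xe ye fractions_def)
  have idl: "ideal \<qq> R" and prime: "\<And>i j a b. a \<in> Rg i \<Longrightarrow> b \<in> Rg j \<Longrightarrow> a \<otimes> b \<in> \<qq> \<Longrightarrow> a \<in> \<qq> \<or> b \<in> \<qq>"
    using q unfolding Spec_def homogeneous_ideal_def by blast+
  obtain j1 u1 where u1: "u1 \<in> Rg j1" "u1 \<notin> \<qq>" "kills j1 u1 (k' + (n + k)) (act k' s' (n + k) m)"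
    using killed[OF act_closed[OF s'(1) s(3)]] by blast
  have v: "u1 \<otimes> s \<in> Rg (j1 + k)" using mult_degree[OF u1(1) s(1)] .
  obtain j2 u2 where u2: "u2 \<in> Rg j2" "u2 \<notin> \<qq>"
      "kills j2 u2 (j1 + k + (n + k')) (act (j1 + k) (u1 \<otimes> s) (n + k') m')"
    using killed[OF act_closed[OF v s'(3)]] by blast
  note car = degree_carrier[OF s(1)] degree_carrier[OF s'(1)] degree_carrier[OF u1(1)]
    degree_carrier[OF u2(1)]
  have u1s': "u1 \<otimes> s' \<in> Rg (j1 + k')" using mult_degree[OF u1(1) s'(1)] .
  have "kills (j1 + k') (u1 \<otimes> s') (n + k) m"
    using u1(3) act_mult[OF u1(1) s'(1) s(3)] by (simp add: kills_def add.assoc)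
  from kills_mult_left[OF this u2(1) u1s' s(3)]
  have a: "kills (j2 + (j1 + k')) (u2 \<otimes> (u1 \<otimes> s')) (n + k) m" .
  have b: "kills (j2 + (j1 + k)) (u2 \<otimes> (u1 \<otimes> s)) (n + k') m'"
    using u2(3) act_mult[OF u2(1) v s'(3)] by (simp add: kills_def add.assoc)
  define a1 where "a1 = u2 \<otimes> (u1 \<otimes> s')"
  define b0 where "b0 = u2 \<otimes> (u1 \<otimes> s)"
  \<comment> \<open>\<open>s\<close> and \<open>s'\<close> commute up to the sign that is put into the second multiplier.\<close>
  define b1 where "b1 = (if even (k' * k) then b0 else \<ominus> b0)"
  have a1: "a1 \<in> Rg (j2 + (j1 + k'))" using mult_degree[OF u2(1) u1s'] by (simp add: a1_def)
  have b0: "b0 \<in> Rg (j2 + (j1 + k))" using mult_degree[OF u2(1) v] by (simp add: b0_def)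
  then have b1: "b1 \<in> Rg (j2 + (j1 + k))" by (simp add: b1_def minus_degree)
  have "a1 \<otimes> s = b1 \<otimes> s'"
    using graded_commute[OF s'(1) s(1)] car
    by (auto simp: a1_def b1_def b0_def m_assoc r_minus l_minus)
  moreover have "a1 \<otimes> s \<notin> \<qq>"
  proof
    assume "a1 \<otimes> s \<in> \<qq>"
    then have "a1 \<in> \<qq>" using prime[OF a1 s(1)] s(2) by blast
    then have "u1 \<otimes> s' \<in> \<qq>" using prime[OF u2(1) u1s'] u2(2) by (auto simp: a1_def)
    then show False using prime[OF u1(1) s'(1)] u1(2) s'(2) by blast
  qed
  moreover have "act (j2 + (j1 + k')) a1 (n + k) m = act (j2 + (j1 + k)) b1 (n + k') m'"
    using a b kills_minus[OF b0 s'(3)]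
    by (auto simp: kills_def a1_def[symmetric] b0_def[symmetric] b1_def algebra_simps)
  moreover have "j2 + (j1 + k') + k = j2 + (j1 + k) + k'" by simp
  ultimately have "\<exists>i i'. \<exists>a\<in>Rg i. \<exists>a'\<in>Rg i'. i + k = i' + k' \<and> a \<otimes> s = a' \<otimes> s' \<and>
      a \<otimes> s \<notin> \<qq> \<and> act i a (n + k) m = act i' a' (n + k') m'"
    using a1 b1 by blast
  then show ?thesis
    using x y unfolding xe ye fraction_rel_def by simp
qed

lemma localization_vanishes_iff:
  assumes q: "\<qq> \<in> Spec R Rg"
  shows "localization_vanishes R Rg \<qq> M act \<longleftrightarrow>
    (\<forall>n. \<forall>m\<in>carrier (M n). \<exists>k s. s \<in> Rg k \<and> s \<notin> \<qq> \<and> kills k s n m)"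
proof -
  have "\<one> \<notin> \<qq>"
    using q ideal.one_imp_carrier unfolding Spec_def homogeneous_ideal_def by blast
  then have frac1: "(0, \<one>, m) \<in> fractions Rg \<qq> M n \<longleftrightarrow> m \<in> carrier (M n)" for m n
    by (simp add: fractions_def one_degree)
  have unit: "\<one>\<^bsub>M n\<^esub> \<in> carrier (M n)" for n using module_group by (simp add: group.is_monoid)
  show ?thesis
  proof (intro iffI allI ballI)
    fix n m assume van: "localization_vanishes R Rg \<qq> M act" and m: "m \<in> carrier (M n)"
    have "fraction_rel R Rg \<qq> M act n `` {(0, \<one>, m)} \<in> localization R Rg \<qq> M act n"
      unfolding localization_def quotient_def using frac1 m by blast
    then have "fraction_rel R Rg \<qq> M act n `` {(0, \<one>, m)} =
        fraction_rel R Rg \<qq> M act n `` {(0, \<one>, \<one>\<^bsub>M n\<^esub>)}"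
      using van by (simp add: localization_vanishes_def localization_zero_def)
    moreover have "((0, \<one>, m), (0, \<one>, m)) \<in> fraction_rel R Rg \<qq> M act n"
    proof -
      have "\<exists>i i'. \<exists>a\<in>Rg i. \<exists>a'\<in>Rg i'. i + 0 = i' + 0 \<and> a \<otimes> \<one> = a' \<otimes> \<one> \<and> a \<otimes> \<one> \<notin> \<qq> \<and>
          act i a (n + 0) m = act i' a' (n + 0) m"
        by (intro exI[of _ "0 :: int"] bexI[of _ \<one>]) (use one_degree \<open>\<one> \<notin> \<qq>\<close> in auto)
      then show ?thesis using m frac1 unfolding fraction_rel_def by simp
    qed
    ultimately have "((0, \<one>, \<one>\<^bsub>M n\<^esub>), (0, \<one>, m)) \<in> fraction_rel R Rg \<qq> M act n" by blast
    then obtain i a a' where "a \<in> Rg i" "a' \<in> Rg i" "a \<otimes> \<one> = a' \<otimes> \<one>" "a \<otimes> \<one> \<notin> \<qq>"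
        "act i a n \<one>\<^bsub>M n\<^esub> = act i a' n m"
      by (auto simp: fraction_rel_def)
    then have "a \<in> Rg i \<and> a \<notin> \<qq> \<and> kills i a n m"
      using act_unit[of a i n] degree_carrier by (auto simp: kills_def)
    then show "\<exists>k s. s \<in> Rg k \<and> s \<notin> \<qq> \<and> kills k s n m" by blast
  next
    assume killed: "\<forall>n. \<forall>m\<in>carrier (M n). \<exists>k s. s \<in> Rg k \<and> s \<notin> \<qq> \<and> kills k s n m"
    have rel: "fraction_rel R Rg \<qq> M act n `` {x} = fractions Rg \<qq> M n"
      if x: "x \<in> fractions Rg \<qq> M n" for x n
    proof (intro equalityI subsetI)
      fix y assume "y \<in> fraction_rel R Rg \<qq> M act n `` {x}"
      then show "y \<in> fractions Rg \<qq> M n" by (auto simp: fraction_rel_def)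
    next
      fix y assume "y \<in> fractions Rg \<qq> M n"
      then show "y \<in> fraction_rel R Rg \<qq> M act n `` {x}"
        using fractions_related[OF q _ x] killed by blast
    qed
    have one: "(0, \<one>, \<one>\<^bsub>M n\<^esub>) \<in> fractions Rg \<qq> M n" for n
      using frac1 unit by blast
    have "localization R Rg \<qq> M act n = {localization_zero R Rg \<qq> M act n}" for n
    proof -
      have "localization R Rg \<qq> M act n = (\<Union>x\<in>fractions Rg \<qq> M n. {fractions Rg \<qq> M n})"
        unfolding localization_def quotient_def by (rule SUP_cong) (simp_all only: rel)
      then show ?thesis using one[of n] by (auto simp: localization_zero_def rel)
    qed
    then show "localization_vanishes R Rg \<qq> M act" by (simp add: localization_vanishes_def)
  qed
qed

end

section \<open>Preadditive categories\<close>

context preadditive_category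
begin

text \<open>Hom sets are meaningful only between objects, so the typing of a morphism carries membership of
  source and target in \<open>Obj T\<close>; then a composite is typed by the typings of its factors.\<close>

definition arr :: "'o \<Rightarrow> 'o \<Rightarrow> 'm \<Rightarrow> bool" where
  "arr X Y f \<longleftrightarrow> X \<in> Obj T \<and> Y \<in> Obj T \<and> f \<in> Hom T X Y"

abbreviation zero_map :: "'o \<Rightarrow> 'o \<Rightarrow> 'm" where
  "zero_map X Y \<equiv> \<one>\<^bsub>HomG T X Y\<^esub>"

definition orth :: "'o \<Rightarrow> 'o \<Rightarrow> bool" where
  "orth X Y \<longleftrightarrow> (\<forall>f. arr X Y f \<longrightarrow> f = zero_map X Y)"

lemma orthD: "orth X Y \<Longrightarrow> arr X Y f \<Longrightarrow> f = zero_map X Y"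
  by (simp add: orth_def)

lemma arr_obj: "arr X Y f \<Longrightarrow> X \<in> Obj T" "arr X Y f \<Longrightarrow> Y \<in> Obj T"
  by (simp_all add: arr_def)

lemma arr_group: "X \<in> Obj T \<Longrightarrow> Y \<in> Obj T \<Longrightarrow> group (HomG T X Y)"
  using hom_group comm_group_def by blast

lemma arr_ident: "X \<in> Obj T \<Longrightarrow> arr X X (Ident T X)"
  by (simp add: arr_def ident_hom)

lemma arr_comp: "arr X Y f \<Longrightarrow> arr Y Z g \<Longrightarrow> arr X Z (g \<bullet> f)"
  by (meson arr_def comp_hom)

lemma arr_zero: "X \<in> Obj T \<Longrightarrow> Y \<in> Obj T \<Longrightarrow> arr X Y (zero_map X Y)"
  using group.is_monoid[OF arr_group] by (simp add: arr_def monoid.one_closed)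

lemma arr_inv: "arr X Y f \<Longrightarrow> arr X Y (inv\<^bsub>HomG T X Y\<^esub> f)"
  by (simp add: arr_def arr_group group.inv_closed)

lemma arr_unique: "arr X Y f \<Longrightarrow> arr X' Y' f \<Longrightarrow> X = X' \<and> Y = Y'"
  by (meson arr_def hom_disjoint)

lemma assoc: "arr W X f \<Longrightarrow> arr X Y g \<Longrightarrow> arr Y Z h \<Longrightarrow> (h \<bullet> g) \<bullet> f = h \<bullet> (g \<bullet> f)"
  by (meson arr_def comp_assoc)

lemma ident_comp: "arr X Y f \<Longrightarrow> Ident T Y \<bullet> f = f"
  by (meson arr_def ident_left)

lemma comp_ident: "arr X Y f \<Longrightarrow> f \<bullet> Ident T X = f"
  by (meson arr_def ident_right)

lemma postcomp_group_hom:
  assumes "X \<in> Obj T" "arr Y Z g"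
  shows "group_hom (HomG T X Y) (HomG T X Z) (\<lambda>f. g \<bullet> f)"
  using assms unfolding arr_def
  by (intro group_hom.intro arr_group group_hom_axioms.intro homI comp_hom comp_add_right) auto

lemma precomp_group_hom:
  assumes "Z \<in> Obj T" "arr X Y f"
  shows "group_hom (HomG T Y Z) (HomG T X Z) (\<lambda>g. g \<bullet> f)"
  using assms unfolding arr_def
  by (intro group_hom.intro arr_group group_hom_axioms.intro homI comp_hom comp_add_left) auto

lemma comp_zero: "X \<in> Obj T \<Longrightarrow> arr Y Z g \<Longrightarrow> g \<bullet> zero_map X Y = zero_map X Z"
  using group_hom.hom_one[OF postcomp_group_hom] .

lemma zero_comp: "Z \<in> Obj T \<Longrightarrow> arr X Y f \<Longrightarrow> zero_map Y Z \<bullet> f = zero_map X Z"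
  using group_hom.hom_one[OF precomp_group_hom] .

lemma comp_inv:
  "arr X Y f \<Longrightarrow> arr Y Z g \<Longrightarrow> g \<bullet> inv\<^bsub>HomG T X Y\<^esub> f = inv\<^bsub>HomG T X Z\<^esub> (g \<bullet> f)"
  using group_hom.hom_inv[OF postcomp_group_hom] by (simp add: arr_def)

lemma inv_comp:
  "arr X Y f \<Longrightarrow> arr Y Z g \<Longrightarrow> inv\<^bsub>HomG T Y Z\<^esub> g \<bullet> f = inv\<^bsub>HomG T X Z\<^esub> (g \<bullet> f)"
  using group_hom.hom_inv[OF precomp_group_hom] by (simp add: arr_def)

lemma inv_zero_iff: "arr X Y f \<Longrightarrow> inv\<^bsub>HomG T X Y\<^esub> f = zero_map X Y \<longleftrightarrow> f = zero_map X Y"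
  using group.inv_eq_1_iff[OF arr_group] by (simp add: arr_def)

lemma inv_arr_inj:
  "arr X Y f \<Longrightarrow> arr X Y g \<Longrightarrow> inv\<^bsub>HomG T X Y\<^esub> f = inv\<^bsub>HomG T X Y\<^esub> g \<Longrightarrow> f = g"
  using group.inv_inv[OF arr_group] by (metis arr_def)

lemma left_cancel:
  assumes inj: "\<And>a. arr X Y a \<Longrightarrow> g \<bullet> a = zero_map X Z \<Longrightarrow> a = zero_map X Y"
    and "arr Y Z g" "arr X Y a" "arr X Y b" "g \<bullet> a = g \<bullet> b"
  shows "a = b"
proof -
  interpret group_hom "HomG T X Y" "HomG T X Z" "\<lambda>f. g \<bullet> f"
    using postcomp_group_hom assms(2,3) arr_obj by blast
  have a: "a \<in> Hom T X Y" and b: "b \<in> Hom T X Y" using assms(3,4) by (simp_all add: arr_def)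
  have "g \<bullet> (a \<otimes>\<^bsub>HomG T X Y\<^esub> inv\<^bsub>HomG T X Y\<^esub> b) = zero_map X Z"
    using a b assms(5) hom_closed by simp
  then have "a \<otimes>\<^bsub>HomG T X Y\<^esub> inv\<^bsub>HomG T X Y\<^esub> b = zero_map X Y"
    using inj assms(3) a b by (simp add: arr_def)
  then show ?thesis using a b by (metis G.inv_closed G.inv_equality G.inv_inv)
qed

lemma right_cancel:
  assumes inj: "\<And>a. arr Y Z a \<Longrightarrow> a \<bullet> f = zero_map X Z \<Longrightarrow> a = zero_map Y Z"
    and "arr X Y f" "arr Y Z a" "arr Y Z b" "a \<bullet> f = b \<bullet> f"
  shows "a = b"
proof -
  interpret group_hom "HomG T Y Z" "HomG T X Z" "\<lambda>g. g \<bullet> f"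
    using precomp_group_hom assms(2,3) arr_obj by blast
  have a: "a \<in> Hom T Y Z" and b: "b \<in> Hom T Y Z" using assms(3,4) by (simp_all add: arr_def)
  have "(a \<otimes>\<^bsub>HomG T Y Z\<^esub> inv\<^bsub>HomG T Y Z\<^esub> b) \<bullet> f = zero_map X Z"
    using a b assms(5) hom_closed by simp
  then have "a \<otimes>\<^bsub>HomG T Y Z\<^esub> inv\<^bsub>HomG T Y Z\<^esub> b = zero_map Y Z"
    using inj assms(3) a b by (simp add: arr_def)
  then show ?thesis using a b by (metis G.inv_closed G.inv_equality G.inv_inv)
qed

lemma zero_object_obj: "zero_object T Z \<Longrightarrow> Z \<in> Obj T"
  by (simp add: zero_object_def)

lemma zero_object_orth:
  assumes "zero_object T Z" "X \<in> Obj T" shows "orth X Z" "orth Z X"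
proof -
  note Z = zero_object_obj[OF assms(1)]
  have "\<exists>!f. f \<in> Hom T X Z" "\<exists>!f. f \<in> Hom T Z X"
    using assms by (simp_all add: zero_object_def)
  moreover have "zero_map X Z \<in> Hom T X Z" "zero_map Z X \<in> Hom T Z X"
    using arr_zero[OF assms(2) Z] arr_zero[OF Z assms(2)] by (simp_all add: arr_def)
  ultimately have "\<forall>f. f \<in> Hom T X Z \<longrightarrow> f = zero_map X Z" "\<forall>f. f \<in> Hom T Z X \<longrightarrow> f = zero_map Z X"
    by metis+
  then show "orth X Z" "orth Z X" by (auto simp: orth_def arr_def)
qed

lemma orth_zero_object:
  assumes X: "X \<in> Obj T" and id: "Ident T X = zero_map X X" shows "zero_object T X"
proof -
  have 1: "f = zero_map X Y" if "arr X Y f" for f Y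
    using comp_ident[OF that] comp_zero[OF X that] id by simp
  have 2: "f = zero_map Y X" if "arr Y X f" for f Y
    using ident_comp[OF that] zero_comp[OF X that] id by simp
  have "\<exists>!f. f \<in> Hom T X Y" "\<exists>!f. f \<in> Hom T Y X" if "Y \<in> Obj T" for Y
    using 1[of Y] 2[of Y] arr_zero[OF X that] arr_zero[OF that X] X that
    by (auto simp: arr_def intro!: ex1I)
  then show ?thesis using X by (simp add: zero_object_def)
qed

lemma zero_object_iff_orth_self: "X \<in> Obj T \<Longrightarrow> zero_object T X \<longleftrightarrow> orth X X"
  using orth_zero_object zero_object_orth arr_ident orthD by blast

lemma iso_arrE:
  assumes "iso_arr T X Y f"
  obtains g where "arr X Y f" "arr Y X g" "g \<bullet> f = Ident T X" "f \<bullet> g = Ident T Y"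
  using assms unfolding iso_arr_def arr_def by blast

lemma iso_arrI:
  assumes "arr X Y f" "arr Y X g" "g \<bullet> f = Ident T X" "f \<bullet> g = Ident T Y"
  shows "iso_arr T X Y f"
  using assms unfolding iso_arr_def arr_def by blast

lemma iso_comp_zero:
  assumes "iso_arr T X Y f" "arr A X a" "f \<bullet> a = zero_map A Y" shows "a = zero_map A X"
proof -
  obtain g where g: "arr X Y f" "arr Y X g" "g \<bullet> f = Ident T X" using assms(1) by (rule iso_arrE)
  have "a = g \<bullet> (f \<bullet> a)" using assoc[OF assms(2) g(1,2)] g(3) ident_comp[OF assms(2)] by simp
  then show ?thesis using assms(3) comp_zero[OF _ g(2)] arr_obj[OF assms(2)] by simp
qed

lemma zero_iso:
  assumes "iso_arr T X Y (zero_map X Y)" shows "zero_object T X"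
proof -
  obtain g where g: "arr X Y (zero_map X Y)" "arr Y X g" "g \<bullet> zero_map X Y = Ident T X"
    using assms by (rule iso_arrE)
  then have "Ident T X = zero_map X X" using comp_zero[OF _ g(2)] arr_obj(1)[OF g(1)] by metis
  then show ?thesis using orth_zero_object arr_obj(1)[OF g(1)] by blast
qed

lemma zero_object_iso:
  assumes "iso_arr T X Y f" shows "zero_object T X \<longleftrightarrow> zero_object T Y"
proof -
  obtain g where g: "arr X Y f" "arr Y X g" "g \<bullet> f = Ident T X" "f \<bullet> g = Ident T Y"
    using assms by (rule iso_arrE)
  note ob = arr_obj[OF g(1)]
  have "Ident T Y = zero_map Y Y" if "zero_object T X"
    using zero_object_orth(1)[OF that ob(2)] g comp_zero[OF ob(2) g(1)] by (metis orthD)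
  moreover have "Ident T X = zero_map X X" if "zero_object T Y"
    using zero_object_orth(1)[OF that ob(1)] g comp_zero[OF ob(1) g(2)] by (metis orthD)
  ultimately show ?thesis using orth_zero_object ob by blast
qed

lemma orth_retract:
  assumes i: "arr B B' i" and p: "arr B' B p" and pi: "p \<bullet> i = Ident T B" and o: "orth B' X"
    and X: "X \<in> Obj T"
  shows "orth B X"
  unfolding orth_def
proof (intro allI impI)
  fix f assume f: "arr B X f"
  have "f = f \<bullet> (p \<bullet> i)" using pi comp_ident[OF f] by simp
  also have "\<dots> = (f \<bullet> p) \<bullet> i" using assoc[OF i p f] by simp
  also have "\<dots> = zero_map B' X \<bullet> i" using orthD[OF o arr_comp[OF p f]] by simp
  finally show "f = zero_map B X" using zero_comp[OF X i] by simp
qed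

end

section \<open>Suspension\<close>

lemma int_iff_induct [case_names zero step]:
  assumes "P (0 :: int)" "\<And>i. P i \<longleftrightarrow> P (i + 1)" shows "P n"
proof (induction n rule: int_induct[of _ 0])
  case (step2 i)
  then show ?case using assms(2)[of "i - 1"] by simp
qed (use assms in auto)

text \<open>The common form of \<open>suspO T n\<close> on objects and \<open>suspM T n\<close> on morphisms.\<close>

definition power_on :: "'a set \<Rightarrow> ('a \<Rightarrow> 'a) \<Rightarrow> int \<Rightarrow> 'a \<Rightarrow> 'a" where
  "power_on A g n = (if n \<ge> 0 then g ^^ nat n else inv_into A g ^^ nat (- n))"

lemma power_on_closed:
  assumes "bij_betw g A A" "x \<in> A" shows "power_on A g n x \<in> A"
proof -
  have "(g ^^ k) x \<in> A" for k
    by (induction k) (use assms in \<open>auto simp: bij_betw_def\<close>)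
  moreover have "(inv_into A g ^^ k) x \<in> A" for k
    by (induction k) (use assms in \<open>auto simp: bij_betw_def intro: inv_into_into\<close>)
  ultimately show ?thesis by (simp add: power_on_def)
qed

lemma power_on_Suc:
  assumes "bij_betw g A A" "x \<in> A" shows "power_on A g (n + 1) x = g (power_on A g n x)"
proof (cases "n \<ge> 0")
  case True
  then have "nat (n + 1) = Suc (nat n)" by simp
  then show ?thesis using True by (simp add: power_on_def)
next
  case False
  then have e: "nat (- n) = Suc (nat (- (n + 1)))" by simp
  have y: "(inv_into A g ^^ k) x \<in> A" for k
    by (induction k) (use assms in \<open>auto simp: bij_betw_def intro: inv_into_into\<close>)
  have "g (power_on A g n x) = (inv_into A g ^^ nat (- (n + 1))) x"
    using False y[of "nat (- (n + 1))"] e assms(1)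
    by (simp add: power_on_def f_inv_into_f bij_betw_def)
  also have "\<dots> = power_on A g (n + 1) x"
    using False by (cases "n = -1") (auto simp: power_on_def)
  finally show ?thesis by simp
qed

lemma power_on_add:
  assumes "bij_betw g A A" "x \<in> A"
  shows "power_on A g (m + n) x = power_on A g m (power_on A g n x)"
proof (induction m rule: int_iff_induct)
  case zero then show ?case by (simp add: power_on_def)
next
  case (step i)
  have "power_on A g (i + 1 + n) x = g (power_on A g (i + n) x)"
    using power_on_Suc[OF assms, of "i + n"] by (simp add: add_ac)
  moreover have "power_on A g (i + 1) (power_on A g n x) = g (power_on A g i (power_on A g n x))"
    using power_on_Suc[OF assms(1) power_on_closed[OF assms]] .
  moreover have "inj_on g A" using assms(1) by (simp add: bij_betw_def)
  ultimately show ?case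
    using power_on_closed[OF assms(1)] assms(2) by (simp add: inj_on_eq_iff)
qed

context triangulated_category
begin

abbreviation Sus where "Sus n \<equiv> suspO T n"
abbreviation SusM where "SusM n \<equiv> suspM T n"

lemma susp_obj_closed: "X \<in> Obj T \<Longrightarrow> SuspO T X \<in> Obj T"
  using susp_obj bij_betwE by blast

lemma susp_hom_bij:
  assumes "X \<in> Obj T" "Y \<in> Obj T"
  shows "SuspM T \<in> hom (HomG T X Y) (HomG T (SuspO T X) (SuspO T Y))"
    and "bij_betw (SuspM T) (Hom T X Y) (Hom T (SuspO T X) (SuspO T Y))"
  using susp_hom[OF assms] by (simp_all add: iso_def)

lemma arr_susp: "arr X Y f \<Longrightarrow> arr (SuspO T X) (SuspO T Y) (SuspM T f)"
  using susp_hom_bij(2)[of X Y] bij_betwE susp_obj_closed by (fastforce simp: arr_def)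

lemma arr_susp_inj: "arr X Y f \<Longrightarrow> arr X Y g \<Longrightarrow> SuspM T f = SuspM T g \<Longrightarrow> f = g"
  using susp_hom_bij(2)[of X Y] by (auto simp: arr_def bij_betw_def inj_on_eq_iff)

lemma arr_susp_surj:
  assumes "X \<in> Obj T" "Y \<in> Obj T" "arr (SuspO T X) (SuspO T Y) g"
  obtains f where "arr X Y f" "SuspM T f = g"
proof -
  have "g \<in> SuspM T ` Hom T X Y"
    using susp_hom_bij(2)[OF assms(1,2)] assms(3) by (simp add: arr_def bij_betw_def)
  then show ?thesis using that assms(1,2) by (auto simp: arr_def)
qed

lemma susp_group_hom:
  assumes "X \<in> Obj T" "Y \<in> Obj T"
  shows "group_hom (HomG T X Y) (HomG T (SuspO T X) (SuspO T Y)) (SuspM T)"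
  using susp_hom[OF assms] arr_group assms susp_obj_closed
  by (simp add: group_hom_def group_hom_axioms_def iso_def)

lemma susp_zero:
  "X \<in> Obj T \<Longrightarrow> Y \<in> Obj T \<Longrightarrow> SuspM T (zero_map X Y) = zero_map (SuspO T X) (SuspO T Y)"
  using group_hom.hom_one[OF susp_group_hom] .

lemma susp_inv:
  "arr X Y f \<Longrightarrow> SuspM T (inv\<^bsub>HomG T X Y\<^esub> f) = inv\<^bsub>HomG T (SuspO T X) (SuspO T Y)\<^esub> (SuspM T f)"
  using group_hom.hom_inv[OF susp_group_hom] by (simp add: arr_def)

lemma susp_comp_arr: "arr X Y f \<Longrightarrow> arr Y Z g \<Longrightarrow> SuspM T (g \<bullet> f) = SuspM T g \<bullet> SuspM T f"
  by (meson arr_def susp_comp)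

lemma susp_zero_iff:
  assumes "arr X Y f"
  shows "SuspM T f = zero_map (SuspO T X) (SuspO T Y) \<longleftrightarrow> f = zero_map X Y"
  using arr_susp_inj[OF assms arr_zero] susp_zero arr_obj[OF assms] by metis

lemma Arr_iff: "f \<in> Arr T \<longleftrightarrow> (\<exists>X Y. arr X Y f)"
  by (auto simp: Arr_def arr_def)

lemma susp_obj_surj: "X \<in> Obj T \<Longrightarrow> \<exists>Y. Y \<in> Obj T \<and> SuspO T Y = X"
  using susp_obj unfolding bij_betw_def by (metis imageE)

text \<open>Morphisms of different Hom groups are distinct, so the bijections on Hom groups assemble to a
  bijection on all morphisms; this makes the negative powers of \<open>\<Sigma>\<close> inverse to the positive ones.\<close>

lemma susp_arr_bij: "bij_betw (SuspM T) (Arr T) (Arr T)"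
proof (rule bij_betwI')
  fix f g assume "f \<in> Arr T" "g \<in> Arr T"
  then obtain X Y X' Y' where f: "arr X Y f" and g: "arr X' Y' g" by (auto simp: Arr_iff)
  show "(SuspM T f = SuspM T g) = (f = g)"
  proof
    assume e: "SuspM T f = SuspM T g"
    then have "SuspO T X = SuspO T X' \<and> SuspO T Y = SuspO T Y'"
      using arr_unique arr_susp[OF f] arr_susp[OF g] by metis
    then have "X = X' \<and> Y = Y'"
      using susp_obj arr_obj[OF f] arr_obj[OF g] by (auto simp: bij_betw_def inj_on_def)
    then show "f = g" using arr_susp_inj f g e by blast
  qed simp
next
  fix f assume "f \<in> Arr T"
  then show "SuspM T f \<in> Arr T" using arr_susp Arr_iff by blast
next
  fix g assume "g \<in> Arr T"
  then obtain X Y where "arr X Y g" by (auto simp: Arr_iff)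
  moreover from this obtain X' Y' where "X' \<in> Obj T" "Y' \<in> Obj T" "SuspO T X' = X" "SuspO T Y' = Y"
    using susp_obj_surj arr_obj by metis
  ultimately show "\<exists>f\<in>Arr T. g = SuspM T f" using arr_susp_surj Arr_iff by metis
qed

lemma Sus_power: "Sus n = power_on (Obj T) (SuspO T) n"
  by (simp add: suspO_def power_on_def)

lemma SusM_power: "SusM n = power_on (Arr T) (SuspM T) n"
  by (simp add: suspM_def power_on_def)

lemma Sus_0: "Sus 0 X = X" and SusM_0: "SusM 0 f = f"
  by (simp_all add: suspO_def suspM_def)

lemma Sus_1: "Sus 1 X = SuspO T X" and SusM_1: "SusM 1 f = SuspM T f"
  by (simp_all add: suspO_def suspM_def)

lemma Sus_obj: "X \<in> Obj T \<Longrightarrow> Sus n X \<in> Obj T"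
  unfolding Sus_power by (rule power_on_closed[OF susp_obj])

lemma Sus_add: "X \<in> Obj T \<Longrightarrow> Sus (m + n) X = Sus m (Sus n X)"
  unfolding Sus_power by (rule power_on_add[OF susp_obj])

lemma Sus_commute: "X \<in> Obj T \<Longrightarrow> Sus m (Sus n X) = Sus n (Sus m X)"
  by (metis Sus_add add.commute)

lemma Sus_Suc: "X \<in> Obj T \<Longrightarrow> Sus (n + 1) X = SuspO T (Sus n X)"
  unfolding Sus_power by (rule power_on_Suc[OF susp_obj])

lemma SusM_Suc: "arr X Y f \<Longrightarrow> SusM (n + 1) f = SuspM T (SusM n f)"
  unfolding SusM_power by (rule power_on_Suc[OF susp_arr_bij]) (use Arr_iff in blast)

lemma SusM_add: "arr X Y f \<Longrightarrow> SusM (m + n) f = SusM m (SusM n f)"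
  unfolding SusM_power by (rule power_on_add[OF susp_arr_bij]) (use Arr_iff in blast)

lemma Sus_cancel: "X \<in> Obj T \<Longrightarrow> Sus n (Sus (- n) X) = X" "X \<in> Obj T \<Longrightarrow> Sus (- n) (Sus n X) = X"
  using Sus_add[of X n "- n"] Sus_add[of X "- n" n] by (simp_all add: Sus_0)

lemma SusM_cancel: "arr X Y f \<Longrightarrow> SusM n (SusM (- n) f) = f" "arr X Y f \<Longrightarrow> SusM (- n) (SusM n f) = f"
  using SusM_add[of X Y f n "- n"] SusM_add[of X Y f "- n" n] by (simp_all add: SusM_0)

lemma arr_SusM:
  assumes f: "arr X Y f" shows "arr (Sus n X) (Sus n Y) (SusM n f)"
proof (induction n rule: int_iff_induct)
  case zero then show ?case using f by (simp add: Sus_0 SusM_0)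
next
  case (step i)
  note ob = arr_obj[OF f]
  have "\<exists>U V. arr U V (SusM i f)"
    using power_on_closed[OF susp_arr_bij, of f i] f by (simp add: SusM_power Arr_iff[symmetric] ) (use Arr_iff in blast)
  then obtain U V where UV: "arr U V (SusM i f)" by blast
  show ?case
  proof
    assume "arr (Sus i X) (Sus i Y) (SusM i f)"
    then show "arr (Sus (i + 1) X) (Sus (i + 1) Y) (SusM (i + 1) f)"
      using arr_susp by (simp add: Sus_Suc SusM_Suc[OF f] ob)
  next
    assume "arr (Sus (i + 1) X) (Sus (i + 1) Y) (SusM (i + 1) f)"
    then have "arr (SuspO T (Sus i X)) (SuspO T (Sus i Y)) (SuspM T (SusM i f))"
      by (simp add: Sus_Suc SusM_Suc[OF f] ob)
    then have "SuspO T U = SuspO T (Sus i X)" "SuspO T V = SuspO T (Sus i Y)"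
      using arr_unique arr_susp[OF UV] by blast+
    then have "U = Sus i X \<and> V = Sus i Y"
      using susp_obj arr_obj[OF UV] Sus_obj ob by (auto simp: bij_betw_def inj_on_def)
    then show "arr (Sus i X) (Sus i Y) (SusM i f)" using UV by blast
  qed
qed

lemma SusM_comp:
  assumes f: "arr X Y f" and g: "arr Y Z g"
  shows "SusM n (g \<bullet> f) = SusM n g \<bullet> SusM n f"
proof (induction n rule: int_iff_induct)
  case zero then show ?case by (simp add: SusM_0)
next
  case (step i)
  note gf = arr_comp[OF f g]
  have "SuspM T (SusM i (g \<bullet> f)) = SuspM T (SusM i g \<bullet> SusM i f) \<longleftrightarrow> SusM i (g \<bullet> f) = SusM i g \<bullet> SusM i f"
    using arr_susp_inj[OF arr_SusM[OF gf] arr_comp[OF arr_SusM[OF f] arr_SusM[OF g]]] by metis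
  then show ?case
    using SusM_Suc[OF gf] SusM_Suc[OF f] SusM_Suc[OF g]
      susp_comp_arr[OF arr_SusM[OF f] arr_SusM[OF g]] by simp
qed

lemma SusM_add_hom:
  assumes f: "arr X Y f" and g: "arr X Y g"
  shows "SusM n (f \<otimes>\<^bsub>HomG T X Y\<^esub> g) = SusM n f \<otimes>\<^bsub>HomG T (Sus n X) (Sus n Y)\<^esub> SusM n g"
proof (induction n rule: int_iff_induct)
  case zero then show ?case by (simp add: Sus_0 SusM_0)
next
  case (step i)
  note ob = arr_obj[OF f]
  interpret g0: group "HomG T X Y" using arr_group ob by blast
  interpret gi: group "HomG T (Sus i X) (Sus i Y)" using arr_group ob Sus_obj by blast
  interpret h: group_hom "HomG T (Sus i X) (Sus i Y)"
      "HomG T (SuspO T (Sus i X)) (SuspO T (Sus i Y))" "SuspM T"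
    using susp_group_hom Sus_obj ob by blast
  have fg: "arr X Y (f \<otimes>\<^bsub>HomG T X Y\<^esub> g)" using f g by (simp add: arr_def)
  have fi: "SusM i f \<in> Hom T (Sus i X) (Sus i Y)" and gi: "SusM i g \<in> Hom T (Sus i X) (Sus i Y)"
    using arr_SusM[OF f] arr_SusM[OF g] by (simp_all add: arr_def)
  have s: "arr (Sus i X) (Sus i Y) (SusM i f \<otimes>\<^bsub>HomG T (Sus i X) (Sus i Y)\<^esub> SusM i g)"
    using fi gi Sus_obj ob by (simp add: arr_def)
  show ?case
    using arr_susp_inj[OF arr_SusM[OF fg] s] h.hom_mult[OF fi gi]
    by (auto simp: SusM_Suc[OF fg] SusM_Suc[OF f] SusM_Suc[OF g] Sus_Suc ob)
qed

lemma SusM_ident: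
  assumes "X \<in> Obj T" shows "SusM n (Ident T X) = Ident T (Sus n X)"
proof -
  let ?Y = "Sus n X"
  have Y: "?Y \<in> Obj T" using Sus_obj assms .
  have id: "arr X X (Ident T X)" using arr_ident assms .
  have bk: "arr X X (SusM (- n) (Ident T ?Y))"
    using arr_SusM[OF arr_ident[OF Y], of "- n"] by (simp add: Sus_cancel assms)
  have "Ident T ?Y = SusM n (Ident T X) \<bullet> Ident T ?Y"
    using SusM_comp[OF bk id, of n] ident_comp[OF bk] SusM_cancel(1)[OF arr_ident[OF Y], of n] by simp
  then show ?thesis using comp_ident[OF arr_SusM[OF id]] by metis
qed

lemma SusM_group_hom:
  assumes "X \<in> Obj T" "Y \<in> Obj T"
  shows "group_hom (HomG T X Y) (HomG T (Sus n X) (Sus n Y)) (SusM n)"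
  using SusM_add_hom arr_SusM arr_group assms Sus_obj
  by (auto simp: group_hom_def group_hom_axioms_def hom_def arr_def)

lemma SusM_zero: "X \<in> Obj T \<Longrightarrow> Y \<in> Obj T \<Longrightarrow> SusM n (zero_map X Y) = zero_map (Sus n X) (Sus n Y)"
  using group_hom.hom_one[OF SusM_group_hom] .

lemma SusM_iso:
  assumes "iso_arr T X Y f" shows "iso_arr T (Sus n X) (Sus n Y) (SusM n f)"
proof -
  obtain g where g: "arr X Y f" "arr Y X g" "g \<bullet> f = Ident T X" "f \<bullet> g = Ident T Y"
    using assms by (rule iso_arrE)
  show ?thesis
    by (rule iso_arrI[OF arr_SusM[OF g(1)] arr_SusM[OF g(2)]])
      (simp_all add: SusM_comp[OF g(1,2), symmetric] SusM_comp[OF g(2,1), symmetric] g(3,4)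
        SusM_ident arr_obj[OF g(1)])
qed

lemma arr_SusM_back:
  assumes "X \<in> Obj T" "arr A (Sus n X) f" shows "arr (Sus (- n) A) X (SusM (- n) f)"
  using arr_SusM[OF assms(2), of "- n"] by (simp add: Sus_cancel assms(1))

lemma SusM_zero_iff:
  assumes "arr X Y f" shows "SusM n f = zero_map (Sus n X) (Sus n Y) \<longleftrightarrow> f = zero_map X Y"
  using SusM_cancel(2)[OF assms, of n] SusM_zero arr_obj[OF assms] Sus_obj Sus_cancel(2)
  by metis

lemma orth_Sus:
  assumes "X \<in> Obj T" "Y \<in> Obj T" shows "orth (Sus n X) (Sus n Y) \<longleftrightarrow> orth X Y"
proof
  assume o: "orth (Sus n X) (Sus n Y)"
  then show "orth X Y" unfolding orth_def using arr_SusM SusM_zero_iff by blast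
next
  assume o: "orth X Y"
  show "orth (Sus n X) (Sus n Y)"
    unfolding orth_def
  proof (intro allI impI)
    fix f assume f: "arr (Sus n X) (Sus n Y) f"
    have "arr X Y (SusM (- n) f)" using arr_SusM_back[OF assms(2) f] by (simp add: Sus_cancel assms)
    then have "SusM (- n) f = zero_map X Y" by (rule orthD[OF o])
    then show "f = zero_map (Sus n X) (Sus n Y)"
      using SusM_cancel(1)[OF f, of n] SusM_zero assms by metis
  qed
qed

definition susp_closed where
  "susp_closed \<E> \<longleftrightarrow> \<E> \<subseteq> Obj T \<and> (\<forall>n. \<forall>X\<in>\<E>. Sus n X \<in> \<E>)"

lemma susp_closedI:
  assumes "\<E> \<subseteq> Obj T" "\<And>X. X \<in> Obj T \<Longrightarrow> X \<in> \<E> \<longleftrightarrow> SuspO T X \<in> \<E>"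
  shows "susp_closed \<E>"
  unfolding susp_closed_def
proof (intro conjI allI ballI)
  fix n X assume X: "X \<in> \<E>"
  then have ob: "X \<in> Obj T" using assms(1) by blast
  show "Sus n X \<in> \<E>"
    by (induction n rule: int_iff_induct)
      (use X assms(2) ob Sus_obj in \<open>auto simp: Sus_0 Sus_Suc\<close>)
qed (use assms in auto)

section \<open>Long exact sequences\<close>

lemma triD:
  assumes "Tri T X Y Z f g h"
  shows "arr X Y f" "arr Y Z g" "arr Z (SuspO T X) h"
  using tri_typed[OF assms] susp_obj_closed by (auto simp: arr_def)

lemma tri_rotate_fwd:
  assumes "Tri T X Y Z f g h"
  shows "Tri T Y Z (SuspO T X) g h (inv\<^bsub>HomG T (SuspO T X) (SuspO T Y)\<^esub> (SuspM T f))"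
  using tri_rotate tri_typed[OF assms] assms by blast

lemma zero_object_susp:
  assumes "zero_object T Z" shows "zero_object T (SuspO T Z)"
proof -
  have Z: "Z \<in> Obj T" using zero_object_obj assms .
  have "Ident T Z = zero_map Z Z" using zero_object_orth(1)[OF assms Z] arr_ident[OF Z] by (rule orthD)
  then have "Ident T (SuspO T Z) = zero_map (SuspO T Z) (SuspO T Z)"
    using susp_ident susp_zero Z by metis
  then show ?thesis using orth_zero_object susp_obj_closed Z by blast
qed

text \<open>Exactness of \<open>Hom(A, X) \<rightarrow> Hom(A, Y) \<rightarrow> Hom(A, Z)\<close>: complete \<open>a : A \<rightarrow> Y\<close> and \<open>0 \<rightarrow> Z\<close> to a morphism
  from the rotated trivial triangle \<open>A \<rightarrow> 0 \<rightarrow> \<Sigma>A\<close> to \<open>Y \<rightarrow> Z \<rightarrow> \<Sigma>X\<close> and desuspend the third component.\<close>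

lemma tri_lift_Y:
  assumes t: "Tri T X Y Z f g h" and a: "arr A Y a" and z: "g \<bullet> a = zero_map A Z"
  shows "\<exists>b. arr A X b \<and> a = f \<bullet> b"
proof -
  note tt = triD[OF t] and A = arr_obj(1)[OF a]
  note ob = arr_obj[OF tt(1)] arr_obj(2)[OF tt(2)]
  obtain N where N: "zero_object T N" using zero_object_exists by blast
  note No = zero_object_obj[OF N]
  let ?i = "inv\<^bsub>HomG T (SuspO T A) (SuspO T A)\<^esub> (SuspM T (Ident T A))"
  let ?j = "inv\<^bsub>HomG T (SuspO T X) (SuspO T Y)\<^esub> (SuspM T f)"
  have t1: "Tri T A N (SuspO T A) (zero_map A N) (zero_map N (SuspO T A)) ?i"
    using tri_rotate_fwd[OF tri_ident[OF A N]] .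
  have t2: "Tri T Y Z (SuspO T X) g h ?j" using tri_rotate_fwd[OF t] .
  have "zero_map N Z \<bullet> zero_map A N = g \<bullet> a"
    using z zero_comp[OF ob(3) arr_zero[OF A No]] by simp
  then obtain c where c: "c \<in> Hom T (SuspO T A) (SuspO T X)" "SuspM T a \<bullet> ?i = ?j \<bullet> c"
    using tri_complete[OF t1 t2] a arr_zero[OF No ob(3)] unfolding arr_def by blast
  have cA: "arr (SuspO T A) (SuspO T X) c" using c(1) A ob susp_obj_closed by (simp add: arr_def)
  note sid = arr_susp[OF arr_ident[OF A]] and sa = arr_susp[OF a] and sf = arr_susp[OF tt(1)]
  have "inv\<^bsub>HomG T (SuspO T A) (SuspO T Y)\<^esub> (SuspM T a)
      = inv\<^bsub>HomG T (SuspO T A) (SuspO T Y)\<^esub> (SuspM T f \<bullet> c)"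
    using c(2) comp_inv[OF sid sa] inv_comp[OF cA sf] susp_ident[OF A] comp_ident[OF sa] by simp
  then have e: "SuspM T a = SuspM T f \<bullet> c" using inv_arr_inj[OF sa arr_comp[OF cA sf]] by blast
  obtain b where b: "arr A X b" "SuspM T b = c" using arr_susp_surj[OF A ob(1) cA] .
  have "SuspM T a = SuspM T (f \<bullet> b)" using e b susp_comp_arr[OF b(1) tt(1)] by simp
  then show ?thesis using arr_susp_inj[OF a arr_comp[OF b(1) tt(1)]] b(1) by blast
qed

lemma tri_lift_Z:
  assumes t: "Tri T X Y Z f g h" and a: "arr A Z a" and z: "h \<bullet> a = zero_map A (SuspO T X)"
  shows "\<exists>b. arr A Y b \<and> a = g \<bullet> b"
  using tri_lift_Y[OF tri_rotate_fwd[OF t] a z] .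

lemma tri_lift_SX:
  assumes t: "Tri T X Y Z f g h" and a: "arr A (SuspO T X) a"
    and z: "SuspM T f \<bullet> a = zero_map A (SuspO T Y)"
  shows "\<exists>b. arr A Z b \<and> a = h \<bullet> b"
proof (rule tri_lift_Z[OF tri_rotate_fwd[OF t] a])
  note sf = arr_susp[OF triD(1)[OF t]]
  show "inv\<^bsub>HomG T (SuspO T X) (SuspO T Y)\<^esub> (SuspM T f) \<bullet> a = zero_map A (SuspO T Y)"
    using inv_comp[OF a sf] inv_zero_iff[OF arr_comp[OF a sf]] z by simp
qed

text \<open>Exactness of \<open>Hom(Z, B) \<rightarrow> Hom(Y, B) \<rightarrow> Hom(X, B)\<close>: complete \<open>X \<rightarrow> 0\<close> and \<open>a : Y \<rightarrow> B\<close> to a morphism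
  from the given triangle to the trivial triangle \<open>0 \<rightarrow> B \<rightarrow> B\<close>.\<close>

lemma tri_extend_Y:
  assumes t: "Tri T X Y Z f g h" and a: "arr Y B a" and z: "a \<bullet> f = zero_map X B"
  shows "\<exists>b. arr Z B b \<and> a = b \<bullet> g"
proof -
  note tt = triD[OF t] and B = arr_obj(2)[OF a]
  note ob = arr_obj[OF tt(1)] arr_obj(2)[OF tt(2)]
  obtain N where N: "zero_object T N" using zero_object_exists by blast
  note No = zero_object_obj[OF N] and SN = zero_object_susp[OF N]
  note SNo = zero_object_obj[OF SN]
  have oN: "arr N B (zero_map N B)" using arr_zero No B by blast
  have i: "inv\<^bsub>HomG T (SuspO T N) (SuspO T B)\<^esub> (SuspM T (zero_map N B)) = zero_map (SuspO T N) (SuspO T B)"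
    using inv_zero_iff[OF arr_susp[OF oN]] susp_zero[OF No B] by simp
  have t1: "Tri T N B B (zero_map N B) (Ident T B) (zero_map B (SuspO T N))"
    using tri_rotate[OF No B B, of "zero_map N B" "Ident T B" "zero_map B (SuspO T N)"]
      oN arr_ident[OF B] arr_zero[OF B SNo] tri_ident[OF B SN] i by (simp add: arr_def)
  have "a \<bullet> f = zero_map N B \<bullet> zero_map X N"
    using z zero_comp[OF B arr_zero[OF ob(1) No]] by simp
  then obtain c where "c \<in> Hom T Z B" "c \<bullet> g = Ident T B \<bullet> a"
    using tri_complete[OF t t1] a arr_zero[OF ob(1) No] unfolding arr_def by blast
  then show ?thesis using ident_comp[OF a] ob B by (metis arr_def)
qed

lemma tri_extend_Z:
  assumes t: "Tri T X Y Z f g h" and a: "arr Z B a" and z: "a \<bullet> g = zero_map Y B"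
  shows "\<exists>b. arr (SuspO T X) B b \<and> a = b \<bullet> h"
  using tri_extend_Y[OF tri_rotate_fwd[OF t] a z] .

lemma tri_zero_gf:
  assumes t: "Tri T X Y Z f g h" shows "g \<bullet> f = zero_map X Z"
proof -
  note tt = triD[OF t]
  note ob = arr_obj[OF tt(1)] arr_obj(2)[OF tt(2)]
  obtain N where N: "zero_object T N" using zero_object_exists by blast
  note No = zero_object_obj[OF N]
  have "f \<bullet> Ident T X = f \<bullet> Ident T X" ..
  then obtain c where "c \<in> Hom T N Z" "c \<bullet> zero_map X N = g \<bullet> f"
    using tri_complete[OF tri_ident[OF ob(1) N] t] arr_ident[OF ob(1)] tt(1) unfolding arr_def by blast
  then show ?thesis using comp_zero[of X N Z c] ob No by (simp add: arr_def)
qed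

lemma tri_zero_hg: "Tri T X Y Z f g h \<Longrightarrow> h \<bullet> g = zero_map Y (SuspO T X)"
  using tri_zero_gf tri_rotate_fwd by blast

lemma tri_zero_Sfh:
  assumes t: "Tri T X Y Z f g h" shows "SuspM T f \<bullet> h = zero_map Z (SuspO T Y)"
proof -
  note tt = triD[OF t] and sf = arr_susp[OF triD(1)[OF t]]
  have "inv\<^bsub>HomG T (SuspO T X) (SuspO T Y)\<^esub> (SuspM T f) \<bullet> h = zero_map Z (SuspO T Y)"
    using tri_zero_hg tri_rotate_fwd[OF t] by blast
  then show ?thesis using inv_comp[OF tt(3) sf] inv_zero_iff[OF arr_comp[OF tt(3) sf]] by simp
qed

text \<open>Injectivity of \<open>Hom(A, X) \<rightarrow> Hom(A, Y)\<close> is tested after suspension, where the preceding term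
  of the long exact sequence is \<open>Hom(\<Sigma>A, Z)\<close>.\<close>

lemma tri_mono:
  assumes t: "Tri T X Y Z f g h" and o: "orth (SuspO T A) Z"
    and a: "arr A X a" and z: "f \<bullet> a = zero_map A Y"
  shows "a = zero_map A X"
proof -
  note tt = triD[OF t] and A = arr_obj(1)[OF a]
  note ob = arr_obj[OF tt(1)] arr_obj(2)[OF tt(2)]
  have "SuspM T f \<bullet> SuspM T a = zero_map (SuspO T A) (SuspO T Y)"
    using susp_comp_arr[OF a tt(1)] z susp_zero[OF A ob(2)] by simp
  then obtain b where b: "arr (SuspO T A) Z b" "SuspM T a = h \<bullet> b"
    using tri_lift_SX[OF t arr_susp[OF a]] by blast
  then have "SuspM T a = zero_map (SuspO T A) (SuspO T X)"
    using orthD[OF o b(1)] comp_zero[OF _ tt(3)] susp_obj_closed[OF A] by simp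
  then show ?thesis using susp_zero_iff[OF a] by blast
qed

lemma tri_cone_zero_iso:
  assumes t: "Tri T X Y Z f g h" and Z: "zero_object T Z" shows "iso_arr T X Y f"
proof -
  note tt = triD[OF t]
  note ob = arr_obj[OF tt(1)]
  have "g \<bullet> Ident T Y = zero_map Y Z"
    using zero_object_orth(1)[OF Z ob(2)] tt(2) comp_ident[OF tt(2)] by (simp add: orthD)
  then obtain b where b: "arr Y X b" "Ident T Y = f \<bullet> b"
    using tri_lift_Y[OF t arr_ident[OF ob(2)]] by blast
  have "f \<bullet> (b \<bullet> f) = f \<bullet> Ident T X"
    using assoc[OF tt(1) b(1) tt(1)] b(2) ident_comp[OF tt(1)] comp_ident[OF tt(1)] by simp
  then have "b \<bullet> f = Ident T X"
    using left_cancel[OF _ tt(1) arr_comp[OF tt(1) b(1)] arr_ident[OF ob(1)]]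
      tri_mono[OF t zero_object_orth(1)[OF Z susp_obj_closed[OF ob(1)]]] by blast
  then show ?thesis using iso_arrI[OF tt(1) b(1)] b(2) by simp
qed

lemma orth_cone_source:
  assumes t: "Tri T X Y Z f g h" and "orth Y B" "orth (SuspO T X) B" and B: "B \<in> Obj T"
  shows "orth Z B"
  unfolding orth_def
proof (intro allI impI)
  fix a assume a: "arr Z B a"
  note tt = triD[OF t]
  have "a \<bullet> g = zero_map Y B" using arr_comp[OF tt(2) a] assms(2) orthD by blast
  then obtain b where b: "arr (SuspO T X) B b" "a = b \<bullet> h" using tri_extend_Z[OF t a] by blast
  then show "a = zero_map Z B" using orthD[OF assms(3) b(1)] zero_comp[OF B tt(3)] by simp
qed

lemma orth_cone_target:
  assumes t: "Tri T X Y Z f g h" and "orth A Y" "orth A (SuspO T X)" and A: "A \<in> Obj T"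
  shows "orth A Z"
  unfolding orth_def
proof (intro allI impI)
  fix a assume a: "arr A Z a"
  note tt = triD[OF t]
  have "h \<bullet> a = zero_map A (SuspO T X)" using arr_comp[OF a tt(3)] assms(3) orthD by blast
  then obtain b where b: "arr A Y b" "a = g \<bullet> b" using tri_lift_Z[OF t a] by blast
  then show "a = zero_map A Z" using orthD[OF assms(2) b(1)] comp_zero[OF A tt(2)] by simp
qed

end

section \<open>Coreflections\<close>

context triangulated_category
begin

definition coreflection where
  "coreflection \<E> X c \<epsilon> \<longleftrightarrow> c \<in> \<E> \<and> arr c X \<epsilon> \<and>
     (\<forall>B\<in>\<E>. \<forall>f. arr B X f \<longrightarrow> (\<exists>!g. arr B c g \<and> \<epsilon> \<bullet> g = f))"

lemma coreflectionD:
  assumes "coreflection \<E> X c \<epsilon>"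
  shows "c \<in> \<E>" "arr c X \<epsilon>"
    and "B \<in> \<E> \<Longrightarrow> arr B X f \<Longrightarrow> \<exists>g. arr B c g \<and> \<epsilon> \<bullet> g = f"
    and "B \<in> \<E> \<Longrightarrow> arr B c g \<Longrightarrow> arr B c g' \<Longrightarrow> \<epsilon> \<bullet> g = \<epsilon> \<bullet> g' \<Longrightarrow> g = g'"
proof -
  show "c \<in> \<E>" "arr c X \<epsilon>" using assms by (simp_all add: coreflection_def)
  show "\<exists>g. arr B c g \<and> \<epsilon> \<bullet> g = f" if "B \<in> \<E>" "arr B X f"
    using assms that unfolding coreflection_def by (metis (no_types))
  show "g = g'" if "B \<in> \<E>" "arr B c g" "arr B c g'" "\<epsilon> \<bullet> g = \<epsilon> \<bullet> g'"
  proof -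
    have "arr B X (\<epsilon> \<bullet> g)" using arr_comp that(2) \<open>arr c X \<epsilon>\<close> by blast
    then have "\<exists>!h. arr B c h \<and> \<epsilon> \<bullet> h = \<epsilon> \<bullet> g"
      using assms that(1) by (simp add: coreflection_def)
    then show ?thesis using that by metis
  qed
qed

text \<open>A coreflection \<open>c \<rightarrow> X\<close> into \<open>\<E>\<close> represents \<open>Hom(-, X)\<close> on \<open>\<E>\<close>. Coreflecting first into \<open>\<E>\<close> and
  then into \<open>\<F>\<close> gives a coreflection into \<open>\<E> \<inter> \<F>\<close> as soon as the second step does not leave \<open>\<E>\<close>.\<close>

lemma coreflection_trans:
  assumes Y: "coreflection \<E> X Y \<delta>" and c: "coreflection \<F> Y c \<epsilon>" and cE: "c \<in> \<E>"
  shows "coreflection (\<E> \<inter> \<F>) X c (\<delta> \<bullet> \<epsilon>)"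
  unfolding coreflection_def
proof (intro conjI ballI allI impI)
  note y = coreflectionD[OF Y] and e = coreflectionD[OF c]
  show "c \<in> \<E> \<inter> \<F>" using e cE by blast
  show "arr c X (\<delta> \<bullet> \<epsilon>)" using arr_comp y e by blast
  fix B f assume B: "B \<in> \<E> \<inter> \<F>" and f: "arr B X f"
  obtain u where u: "arr B Y u" "\<delta> \<bullet> u = f" using y(3) B f by blast
  obtain g where g: "arr B c g" "\<epsilon> \<bullet> g = u" using e(3) B u by blast
  show "\<exists>!g. arr B c g \<and> (\<delta> \<bullet> \<epsilon>) \<bullet> g = f"
  proof (rule ex1I[of _ g])
    show "arr B c g \<and> (\<delta> \<bullet> \<epsilon>) \<bullet> g = f" using g u assoc[OF g(1) e(2) y(2)] by simp
    fix g' assume g': "arr B c g' \<and> (\<delta> \<bullet> \<epsilon>) \<bullet> g' = f"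
    then have "\<delta> \<bullet> (\<epsilon> \<bullet> g') = \<delta> \<bullet> u" using assoc[of B c g' Y \<epsilon> X \<delta>] e(2) y(2) u by simp
    then have "\<epsilon> \<bullet> g' = \<epsilon> \<bullet> g" using y(4)[of B] B g' arr_comp[OF _ e(2)] u(1) g(2) by blast
    then show "g' = g" using e(4)[of B] B g' g by blast
  qed
qed

lemma coreflection_Sus:
  assumes \<E>: "susp_closed \<E>" and c: "coreflection \<E> X c \<epsilon>"
  shows "coreflection \<E> (Sus n X) (Sus n c) (SusM n \<epsilon>)"
  unfolding coreflection_def
proof (intro conjI ballI allI impI)
  note e = coreflectionD[OF c]
  note ob = arr_obj[OF e(2)]
  show "Sus n c \<in> \<E>" using e(1) \<E> by (simp add: susp_closed_def)
  show "arr (Sus n c) (Sus n X) (SusM n \<epsilon>)" using arr_SusM[OF e(2)] .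
  fix B f assume B: "B \<in> \<E>" and f: "arr B (Sus n X) f"
  have B': "Sus (- n) B \<in> \<E>" and Bo: "B \<in> Obj T" using B \<E> by (auto simp: susp_closed_def)
  have fb: "arr (Sus (- n) B) X (SusM (- n) f)" using arr_SusM_back[OF ob(2) f] .
  obtain g where g: "arr (Sus (- n) B) c g" "\<epsilon> \<bullet> g = SusM (- n) f" using e(3)[OF B' fb] by blast
  have Sg: "arr B (Sus n c) (SusM n g)" using arr_SusM[OF g(1), of n] by (simp add: Sus_cancel Bo)
  show "\<exists>!g. arr B (Sus n c) g \<and> SusM n \<epsilon> \<bullet> g = f"
  proof (rule ex1I[of _ "SusM n g"])
    show "arr B (Sus n c) (SusM n g) \<and> SusM n \<epsilon> \<bullet> SusM n g = f"
      using Sg SusM_comp[OF g(1) e(2), of n, symmetric] g(2) SusM_cancel(1)[OF f] by simp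
    fix g' assume g': "arr B (Sus n c) g' \<and> SusM n \<epsilon> \<bullet> g' = f"
    then have g'a: "arr B (Sus n c) g'" by simp
    have gb: "arr (Sus (- n) B) c (SusM (- n) g')" using arr_SusM_back[OF ob(1) g'a] .
    have "SusM (- n) f = SusM (- n) (SusM n \<epsilon>) \<bullet> SusM (- n) g'"
      using g' SusM_comp[OF g'a arr_SusM[OF e(2)]] by blast
    then have "\<epsilon> \<bullet> SusM (- n) g' = \<epsilon> \<bullet> g" using SusM_cancel(2)[OF e(2)] g(2) by simp
    then have "SusM (- n) g' = g" using e(4)[OF B' gb g(1)] by blast
    then show "g' = SusM n g" using SusM_cancel(1)[OF g'a] by metis
  qed
qed

lemma coreflection_orth:
  assumes c: "coreflection \<E> X c \<epsilon>" and B: "B \<in> \<E>" "B \<in> Obj T" and o: "orth B c"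
  shows "orth B X"
  unfolding orth_def
proof (intro allI impI)
  fix f assume f: "arr B X f"
  obtain g where g: "arr B c g" "\<epsilon> \<bullet> g = f" using coreflectionD(3)[OF c B(1) f] by blast
  then show "f = zero_map B X" using orthD[OF o g(1)] comp_zero[OF B(2) coreflectionD(2)[OF c]] by simp
qed

lemma coreflection_zero_iff:
  assumes c: "coreflection \<E> X c \<epsilon>" and \<E>: "\<E> \<subseteq> Obj T"
  shows "zero_object T c \<longleftrightarrow> (\<forall>B\<in>\<E>. orth B X)"
proof
  assume "zero_object T c"
  then show "\<forall>B\<in>\<E>. orth B X"
    using coreflection_orth[OF c] zero_object_orth(1) \<E> by blast
next
  note e = coreflectionD[OF c]
  note ob = arr_obj[OF e(2)]
  assume "\<forall>B\<in>\<E>. orth B X"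
  then have "\<epsilon> = zero_map c X" using e(1,2) orthD by blast
  then have "\<epsilon> \<bullet> Ident T c = \<epsilon> \<bullet> zero_map c c"
    using comp_ident[OF e(2)] comp_zero[OF ob(1) e(2)] by simp
  then have "Ident T c = zero_map c c"
    using e(4)[OF e(1) arr_ident[OF ob(1)] arr_zero[OF ob(1) ob(1)]] by blast
  then show "zero_object T c" using orth_zero_object ob by blast
qed

lemma coreflection_orth_iff:
  assumes c: "coreflection \<E> X c \<epsilon>" and B: "B \<in> \<E>" "B \<in> Obj T"
  shows "orth B X \<longleftrightarrow> orth B c"
proof
  assume o: "orth B X"
  note e = coreflectionD[OF c]
  note ob = arr_obj[OF e(2)]
  show "orth B c" unfolding orth_def
  proof (intro allI impI)
    fix g assume g: "arr B c g"
    have "\<epsilon> \<bullet> g = \<epsilon> \<bullet> zero_map B c"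
      using orthD[OF o arr_comp[OF g e(2)]] comp_zero[OF B(2) e(2)] by simp
    then show "g = zero_map B c" using e(4)[OF B(1) g arr_zero[OF B(2) ob(1)]] by blast
  qed
qed (rule coreflection_orth[OF c B])

text \<open>Right orthogonal complement; for the kernel of a localization functor these are the local
  objects.\<close>

definition perp where
  "perp \<S> = {Y \<in> Obj T. \<forall>A\<in>\<S>. orth A Y}"

lemma perpI: "Y \<in> Obj T \<Longrightarrow> (\<And>A. A \<in> \<S> \<Longrightarrow> orth A Y) \<Longrightarrow> Y \<in> perp \<S>"
  by (simp add: perp_def)

lemma perpD: "Y \<in> perp \<S> \<Longrightarrow> A \<in> \<S> \<Longrightarrow> orth A Y"
  by (simp add: perp_def)

lemma perp_obj: "Y \<in> perp \<S> \<Longrightarrow> Y \<in> Obj T"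
  by (simp add: perp_def)

lemma perp_susp_closed:
  assumes "susp_closed \<S>" shows "susp_closed (perp \<S>)"
  unfolding susp_closed_def
proof (intro conjI allI ballI)
  show "perp \<S> \<subseteq> Obj T" using perp_obj by blast
  fix n Y assume Y: "Y \<in> perp \<S>"
  show "Sus n Y \<in> perp \<S>"
  proof (rule perpI)
    show "Sus n Y \<in> Obj T" using Sus_obj perp_obj[OF Y] .
    fix A assume "A \<in> \<S>"
    then have A: "A \<in> Obj T" "Sus (- n) A \<in> \<S>" using assms by (auto simp: susp_closed_def)
    have "orth (Sus (- n) A) Y" using perpD[OF Y A(2)] .
    then have "orth (Sus n (Sus (- n) A)) (Sus n Y)"
      using orth_Sus Sus_obj A perp_obj[OF Y] by blast
    then show "orth A (Sus n Y)" by (simp add: Sus_cancel A)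
  qed
qed

lemma susp_closed_susp: "susp_closed \<E> \<Longrightarrow> X \<in> \<E> \<Longrightarrow> SuspO T X \<in> \<E>"
  unfolding susp_closed_def by (metis Sus_1)

definition cone_closed where
  "cone_closed \<E> \<longleftrightarrow> (\<forall>X Y Z f g h. Tri T X Y Z f g h \<longrightarrow> X \<in> \<E> \<longrightarrow> Y \<in> \<E> \<longrightarrow> Z \<in> \<E>)"

lemma cone_closedD: "cone_closed \<E> \<Longrightarrow> Tri T X Y Z f g h \<Longrightarrow> X \<in> \<E> \<Longrightarrow> Y \<in> \<E> \<Longrightarrow> Z \<in> \<E>"
  unfolding cone_closed_def by blast

lemma perp_cone_closed:
  assumes "susp_closed \<S>" shows "cone_closed (perp \<S>)"
  unfolding cone_closed_def
proof (intro allI impI)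
  fix X Y Z f g h assume t: "Tri T X Y Z f g h" and X: "X \<in> perp \<S>" and Y: "Y \<in> perp \<S>"
  have "SuspO T X \<in> perp \<S>" using susp_closed_susp perp_susp_closed assms X by blast
  then show "Z \<in> perp \<S>"
    using orth_cone_target[OF t] perpD Y assms arr_obj(2)[OF triD(2)[OF t]]
    by (auto intro!: perpI simp: susp_closed_def)
qed

section \<open>Localization functors\<close>

lemma endofunctor_obj: "endofunctor T F \<Longrightarrow> X \<in> Obj T \<Longrightarrow> onO F X \<in> Obj T"
  by (simp add: endofunctor_def)

lemma right_adjoint_functors: "right_adjoint T F G \<Longrightarrow> endofunctor T F" "right_adjoint T F G \<Longrightarrow> endofunctor T G"
  by (simp_all add: right_adjoint_def)

lemma right_adjoint_orth_iff:
  assumes adj: "right_adjoint T F G" and A: "A \<in> Obj T" and X: "X \<in> Obj T"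
  shows "orth A (onO G X) \<longleftrightarrow> orth (onO F A) X"
proof -
  obtain \<Phi> where bij: "bij_betw (\<Phi> A X) (Hom T (onO F A) X) (Hom T A (onO G X))"
    using adj A X unfolding right_adjoint_def by blast
  have ob: "onO F A \<in> Obj T" "onO G X \<in> Obj T"
    using endofunctor_obj right_adjoint_functors[OF adj] A X by blast+
  have iff: "orth U V \<longleftrightarrow> (\<exists>x. Hom T U V = {x})" if "U \<in> Obj T" "V \<in> Obj T" for U V
    using that arr_zero[OF that] by (auto simp: orth_def arr_def)
  have img: "Hom T A (onO G X) = \<Phi> A X ` Hom T (onO F A) X"
    using bij by (simp add: bij_betw_def)
  have inv_img: "Hom T (onO F A) X = inv_into (Hom T (onO F A) X) (\<Phi> A X) ` Hom T A (onO G X)"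
    using bij_betw_inv_into[OF bij] by (simp add: bij_betw_def)
  have "(\<exists>x. Hom T (onO F A) X = {x}) \<longleftrightarrow> (\<exists>x. Hom T A (onO G X) = {x})"
  proof
    assume "\<exists>x. Hom T (onO F A) X = {x}"
    then obtain x where "Hom T (onO F A) X = {x}" ..
    with img have "Hom T A (onO G X) = {\<Phi> A X x}" by simp
    then show "\<exists>x. Hom T A (onO G X) = {x}" ..
  next
    assume "\<exists>x. Hom T A (onO G X) = {x}"
    then obtain x where x: "Hom T A (onO G X) = {x}" ..
    have "Hom T (onO F A) X = {inv_into (Hom T (onO F A) X) (\<Phi> A X) x}"
      by (subst inv_img) (simp add: x)
    then show "\<exists>x. Hom T (onO F A) X = {x}" ..
  qed
  then show ?thesis using iff ob A X by simp
qed

lemma right_adjoint_zero_iff: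
  assumes adj: "right_adjoint T F G" and X: "X \<in> Obj T"
  shows "zero_object T (onO G X) \<longleftrightarrow> (\<forall>A\<in>Obj T. orth (onO F A) X)"
proof -
  have ob: "onO G X \<in> Obj T"
    using endofunctor_obj[OF right_adjoint_functors(2)[OF adj] X] .
  have "zero_object T (onO G X) \<longleftrightarrow> (\<forall>A\<in>Obj T. orth A (onO G X))"
    using zero_object_orth(1) zero_object_iff_orth_self[OF ob] ob by blast
  then show ?thesis using right_adjoint_orth_iff[OF adj _ X] by blast
qed

end

text \<open>The transformations of a localization triangle are fixed here, so that they can be named.\<close>

locale bousfield_localization = triangulated_category T
  for T :: "('o, 'm, 'x) tricat_scheme" (structure) +
  fixes \<S> :: "'o set" and \<Gamma> L :: "('o, 'm) endofun" and \<theta> \<eta> \<nu> :: "'o \<Rightarrow> 'm"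
  assumes localization: "localization_functor T L \<eta>"
    and kernel: "{X \<in> Obj T. zero_object T (onO L X)} = \<S>"
    and triangle: "X \<in> Obj T \<Longrightarrow>
      onO \<Gamma> X \<in> \<S> \<and> Tri T (onO \<Gamma> X) X (onO L X) (\<theta> X) (\<eta> X) (\<nu> X)"
begin

lemma L_exact: "exact_endofunctor T L"
  using localization by (simp add: localization_functor_def)

lemma L_functor: "endofunctor T L"
  using L_exact by (simp add: exact_endofunctor_def)

lemma L_obj: "X \<in> Obj T \<Longrightarrow> onO L X \<in> Obj T"
  using L_functor by (simp add: endofunctor_def)

lemma L_arr: "arr X Y f \<Longrightarrow> arr (onO L X) (onO L Y) (onM L f)"
  using L_functor by (simp add: endofunctor_def arr_def)

lemma \<theta>_arr: "X \<in> Obj T \<Longrightarrow> arr (onO \<Gamma> X) X (\<theta> X)"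
  and \<eta>_arr: "X \<in> Obj T \<Longrightarrow> arr X (onO L X) (\<eta> X)"
  and \<nu>_arr: "X \<in> Obj T \<Longrightarrow> arr (onO L X) (SuspO T (onO \<Gamma> X)) (\<nu> X)"
  using triangle triD by blast+

lemma \<eta>_natural: "arr X Y f \<Longrightarrow> \<eta> Y \<bullet> f = onM L f \<bullet> \<eta> X"
  using localization by (simp add: localization_functor_def nat_trans_def id_endofun_def arr_def)

lemma unit_iso:
  assumes "X \<in> Obj T"
  shows "iso_arr T (onO L X) (onO L (onO L X)) (onM L (\<eta> X))" "onM L (\<eta> X) = \<eta> (onO L X)"
  using localization assms unfolding localization_functor_def by blast+

lemma S_iff: "X \<in> \<S> \<longleftrightarrow> X \<in> Obj T \<and> zero_object T (onO L X)"
  using kernel by blast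

lemma \<Gamma>_S: "X \<in> Obj T \<Longrightarrow> onO \<Gamma> X \<in> \<S>"
  using triangle by blast

text \<open>For \<open>A\<close> in the kernel and \<open>f : A \<rightarrow> LX\<close>, naturality of the unit gives \<open>\<eta>\<^sub>L\<^sub>X f = L(f) \<eta>\<^sub>A\<close>, which
  vanishes since \<open>LA = 0\<close>; and \<open>\<eta>\<^sub>L\<^sub>X = L(\<eta>\<^sub>X)\<close> is invertible.\<close>

lemma L_perp:
  assumes X: "X \<in> Obj T" shows "onO L X \<in> perp \<S>"
proof (rule perpI[OF L_obj[OF X]])
  fix A assume A: "A \<in> \<S>"
  show "orth A (onO L X)"
    unfolding orth_def
  proof (intro allI impI)
    fix f assume f: "arr A (onO L X) f"
    have iso: "iso_arr T (onO L X) (onO L (onO L X)) (\<eta> (onO L X))"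
      using unit_iso[OF X] by simp
    have Ao: "A \<in> Obj T" and LA: "zero_object T (onO L A)" using A S_iff by simp_all
    note LLX = L_obj[OF L_obj[OF X]]
    have "onM L f = zero_map (onO L A) (onO L (onO L X))"
      using zero_object_orth(2)[OF LA LLX] L_arr[OF f] by (rule orthD)
    then have "\<eta> (onO L X) \<bullet> f = zero_map A (onO L (onO L X))"
      using \<eta>_natural[OF f] zero_comp[OF LLX \<eta>_arr[OF Ao]] by simp
    then show "f = zero_map A (onO L X)" using iso_comp_zero[OF iso f] by blast
  qed
qed

text \<open>If \<open>\<eta>\<^sub>X = 0\<close>, then \<open>L(\<eta>\<^sub>X) : LX \<rightarrow> LLX\<close> is both zero and invertible.\<close>

lemma S_if_unit_zero:
  assumes X: "X \<in> Obj T" and z: "\<eta> X = zero_map X (onO L X)" shows "X \<in> \<S>"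
proof -
  have LX: "onO L X \<in> Obj T" and LLX: "onO L (onO L X) \<in> Obj T" using L_obj X by blast+
  have "onM L \<in> hom (HomG T X (onO L X)) (HomG T (onO L X) (onO L (onO L X)))"
    using L_exact X LX by (simp add: exact_endofunctor_def)
  then have "onM L (\<eta> X) = zero_map (onO L X) (onO L (onO L X))"
    using hom_one[OF _ arr_group[OF X LX] arr_group[OF LX LLX]] z by simp
  moreover have "iso_arr T (onO L X) (onO L (onO L X)) (onM L (\<eta> X))"
    using unit_iso[OF X] by simp
  ultimately show ?thesis using zero_iso S_iff X by metis
qed

text \<open>One local object suffices as a test, namely \<open>LA\<close> with the unit \<open>A \<rightarrow> LA\<close>. As a left orthogonal
  complement the kernel inherits closure under cones from the long exact sequence.\<close>

lemma S_iff_left_orth: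
  assumes A: "A \<in> Obj T" shows "A \<in> \<S> \<longleftrightarrow> (\<forall>Y\<in>perp \<S>. orth A Y)"
proof
  assume "\<forall>Y\<in>perp \<S>. orth A Y"
  then have "\<eta> A = zero_map A (onO L A)" using L_perp[OF A] \<eta>_arr[OF A] orthD by blast
  then show "A \<in> \<S>" using S_if_unit_zero A by blast
qed (use perpD in blast)

lemma S_susp_closed: "susp_closed \<S>"
proof (rule susp_closedI)
  show "\<S> \<subseteq> Obj T" using S_iff by blast
  fix X assume X: "X \<in> Obj T"
  obtain \<tau> where "iso_arr T (onO L (SuspO T X)) (SuspO T (onO L X)) \<tau>"
    using L_exact X unfolding exact_endofunctor_def by blast
  then have 1: "zero_object T (onO L (SuspO T X)) \<longleftrightarrow> zero_object T (SuspO T (onO L X))"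
    by (rule zero_object_iso)
  have LX: "onO L X \<in> Obj T" using L_obj X .
  have "orth (SuspO T (onO L X)) (SuspO T (onO L X)) \<longleftrightarrow> orth (onO L X) (onO L X)"
    using orth_Sus[OF LX LX, of 1] by (simp add: Sus_1)
  then have "zero_object T (SuspO T (onO L X)) \<longleftrightarrow> zero_object T (onO L X)"
    using zero_object_iff_orth_self LX susp_obj_closed by blast
  then show "X \<in> \<S> \<longleftrightarrow> SuspO T X \<in> \<S>" using 1 X susp_obj_closed by (simp add: S_iff)
qed

lemma S_cone_closed: "cone_closed \<S>"
  unfolding cone_closed_def
proof (intro allI impI)
  fix X Y Z f g h assume t: "Tri T X Y Z f g h" and X: "X \<in> \<S>" and Y: "Y \<in> \<S>"
  have Z: "Z \<in> Obj T" using arr_obj(2)[OF triD(2)[OF t]] .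
  have "SuspO T X \<in> \<S>" using susp_closed_susp[OF S_susp_closed X] .
  then have "\<forall>B\<in>perp \<S>. orth Z B"
    using orth_cone_source[OF t] perpD Y perp_obj by blast
  then show "Z \<in> \<S>" using S_iff_left_orth[OF Z] by blast
qed

text \<open>For \<open>B\<close> in the kernel, \<open>Hom(B, LX)\<close> and \<open>Hom(\<Sigma>B, LX)\<close> vanish, so \<open>Hom(B, \<Gamma>X) \<rightarrow> Hom(B, X)\<close> is
  bijective.\<close>

lemma coreflection_\<Gamma>:
  assumes X: "X \<in> Obj T" shows "coreflection \<S> X (onO \<Gamma> X) (\<theta> X)"
  unfolding coreflection_def
proof (intro conjI ballI allI impI)
  note t = conjunct2[OF triangle[OF X]]
  show "onO \<Gamma> X \<in> \<S>" "arr (onO \<Gamma> X) X (\<theta> X)" using \<Gamma>_S \<theta>_arr X by blast+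
  fix B f assume B: "B \<in> \<S>" and f: "arr B X f"
  have "\<eta> X \<bullet> f = zero_map B (onO L X)"
    using perpD[OF L_perp[OF X] B] arr_comp[OF f \<eta>_arr[OF X]] by (rule orthD)
  then obtain g where g: "arr B (onO \<Gamma> X) g" "f = \<theta> X \<bullet> g" using tri_lift_Y[OF t f] by blast
  have "orth (SuspO T B) (onO L X)"
    using perpD[OF L_perp[OF X] susp_closed_susp[OF S_susp_closed B]] .
  then have "g' = g" if "arr B (onO \<Gamma> X) g'" "\<theta> X \<bullet> g' = \<theta> X \<bullet> g" for g'
    using left_cancel[OF tri_mono[OF t] \<theta>_arr[OF X] that(1) g(1) that(2)] by blast
  then show "\<exists>!g. arr B (onO \<Gamma> X) g \<and> \<theta> X \<bullet> g = f" using g by (intro ex1I[of _ g]) auto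
qed

lemma unit_extends:
  assumes X: "X \<in> Obj T" and Y: "Y \<in> perp \<S>" and f: "arr X Y f"
  shows "\<exists>g. arr (onO L X) Y g \<and> g \<bullet> \<eta> X = f"
proof -
  note t = conjunct2[OF triangle[OF X]]
  have "f \<bullet> \<theta> X = zero_map (onO \<Gamma> X) Y"
    using perpD[OF Y \<Gamma>_S[OF X]] arr_comp[OF \<theta>_arr[OF X] f] by (rule orthD)
  then show ?thesis using tri_extend_Y[OF t f] by blast
qed

lemma unit_epi:
  assumes X: "X \<in> Obj T" and Y: "Y \<in> perp \<S>" and g: "arr (onO L X) Y g"
    and z: "g \<bullet> \<eta> X = zero_map X Y"
  shows "g = zero_map (onO L X) Y"
proof -
  note t = conjunct2[OF triangle[OF X]]
  obtain k where k: "arr (SuspO T (onO \<Gamma> X)) Y k" "g = k \<bullet> \<nu> X"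
    using tri_extend_Z[OF t g z] by blast
  have "orth (SuspO T (onO \<Gamma> X)) Y"
    using perpD[OF Y susp_closed_susp[OF S_susp_closed \<Gamma>_S[OF X]]] .
  then show ?thesis using orthD k zero_comp[OF perp_obj[OF Y] \<nu>_arr[OF X]] by metis
qed

lemma local_retract:
  assumes B: "B \<in> perp \<S>"
  obtains p where "arr (onO L B) B p" "p \<bullet> \<eta> B = Ident T B"
  using unit_extends[OF perp_obj[OF B] B arr_ident[OF perp_obj[OF B]]] by blast

lemma acyclic_retract:
  assumes B: "B \<in> \<S>"
  obtains i where "arr B (onO \<Gamma> B) i" "\<theta> B \<bullet> i = Ident T B"
  using coreflectionD(3)[OF coreflection_\<Gamma> B arr_ident] B S_iff by blast

lemma \<Gamma>_zero_iff:
  assumes X: "X \<in> Obj T" shows "zero_object T (onO \<Gamma> X) \<longleftrightarrow> X \<in> perp \<S>"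
  using coreflection_zero_iff[OF coreflection_\<Gamma>[OF X]] S_iff X by (auto simp: perp_def)

text \<open>The counit \<open>L \<Upsilon> X \<rightarrow> X\<close>, composed with the unit of \<open>L\<close> at \<open>\<Upsilon> X\<close>, exhibits \<open>\<Upsilon> X\<close> as the
  coreflection of \<open>X\<close> into the local objects.\<close>

lemma coreflection_right_adjoint:
  assumes adj: "right_adjoint T L \<Upsilon>" and X: "X \<in> Obj T"
  shows "\<exists>\<epsilon>. coreflection (perp \<S>) X (onO \<Upsilon> X) \<epsilon>"
proof -
  let ?U = "onO \<Upsilon> X"
  have UX: "?U \<in> Obj T" using endofunctor_obj[OF right_adjoint_functors(2)[OF adj] X] .
  obtain \<Phi> where bij: "\<And>A Y. A \<in> Obj T \<Longrightarrow> Y \<in> Obj T \<Longrightarrow>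
        bij_betw (\<Phi> A Y) (Hom T (onO L A) Y) (Hom T A (onO \<Upsilon> Y))"
    and nat: "\<And>A A' Y Y' a y f. A \<in> Obj T \<Longrightarrow> A' \<in> Obj T \<Longrightarrow> Y \<in> Obj T \<Longrightarrow> Y' \<in> Obj T \<Longrightarrow>
        a \<in> Hom T A' A \<Longrightarrow> y \<in> Hom T Y Y' \<Longrightarrow> f \<in> Hom T (onO L A) Y \<Longrightarrow>
        \<Phi> A' Y' (y \<bullet> f \<bullet> onM L a) = onM \<Upsilon> y \<bullet> \<Phi> A Y f \<bullet> a"
    using adj unfolding right_adjoint_def by metis
  have \<Phi>_arr: "arr A ?U (\<Phi> A X f)" if "arr (onO L A) X f" "A \<in> Obj T" for A f
    using bij[OF that(2) X] that UX by (auto simp: arr_def bij_betw_def)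
  have \<Phi>_inj: "f = g" if "arr (onO L A) X f" "arr (onO L A) X g" "\<Phi> A X f = \<Phi> A X g" "A \<in> Obj T" for A f g
    using bij[OF that(4) X] that by (auto simp: arr_def bij_betw_def inj_on_eq_iff)
  have \<Phi>_surj: "\<exists>f. arr (onO L A) X f \<and> \<Phi> A X f = g" if "arr A ?U g" for A g
  proof -
    have "A \<in> Obj T" using that by (simp add: arr_def)
    moreover have "g \<in> \<Phi> A X ` Hom T (onO L A) X"
      using bij[OF \<open>A \<in> Obj T\<close> X] that by (auto simp: arr_def bij_betw_def)
    ultimately show ?thesis using L_obj X by (auto simp: arr_def)
  qed
  have idX: "onM \<Upsilon> (Ident T X) = Ident T ?U"
    using right_adjoint_functors(2)[OF adj] X by (simp add: endofunctor_def)
  have \<Phi>_nat: "\<Phi> A X (f \<bullet> onM L g) = \<Phi> A' X f \<bullet> g"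
    if g: "arr A A' g" and f: "arr (onO L A') X f" for A A' g f
  proof -
    note ob = arr_obj[OF g]
    have "\<Phi> A X (Ident T X \<bullet> (f \<bullet> onM L g)) = onM \<Upsilon> (Ident T X) \<bullet> (\<Phi> A' X f \<bullet> g)"
      using nat[OF ob(2) ob(1) X X] g f ident_hom[OF X] by (simp add: arr_def)
    then show ?thesis
      using ident_comp[OF arr_comp[OF L_arr[OF g] f]] ident_comp[OF arr_comp[OF g \<Phi>_arr[OF f ob(2)]]] idX
      by simp
  qed
  have U_perp: "?U \<in> perp \<S>"
  proof (rule perpI[OF UX])
    fix A assume A: "A \<in> \<S>"
    then have "A \<in> Obj T" "orth (onO L A) X" using S_iff zero_object_orth(2) X by blast+
    then show "orth A ?U" using right_adjoint_orth_iff[OF adj _ X] by blast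
  qed
  \<comment> \<open>the counit at \<open>X\<close>\<close>
  obtain e where e: "arr (onO L ?U) X e" "\<Phi> ?U X e = Ident T ?U" using \<Phi>_surj[OF arr_ident[OF UX]] by blast
  note \<eta>U = \<eta>_arr[OF UX]
  have lift: "\<Phi> B X (e \<bullet> onM L g) = g" "(e \<bullet> \<eta> ?U) \<bullet> g = (e \<bullet> onM L g) \<bullet> \<eta> B"
    if g: "arr B ?U g" for B g
  proof -
    show "\<Phi> B X (e \<bullet> onM L g) = g" using \<Phi>_nat[OF g e(1)] e(2) ident_comp[OF g] by simp
    show "(e \<bullet> \<eta> ?U) \<bullet> g = (e \<bullet> onM L g) \<bullet> \<eta> B"
      using assoc[OF g \<eta>U e(1)] assoc[OF \<eta>_arr[OF arr_obj(1)[OF g]] L_arr[OF g] e(1)] \<eta>_natural[OF g]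
      by simp
  qed
  have "coreflection (perp \<S>) X ?U (e \<bullet> \<eta> ?U)"
    unfolding coreflection_def
  proof (intro conjI ballI allI impI)
    show "?U \<in> perp \<S>" by (rule U_perp)
    show "arr ?U X (e \<bullet> \<eta> ?U)" using arr_comp[OF \<eta>U e(1)] .
    fix B f assume B: "B \<in> perp \<S>" and f: "arr B X f"
    note Bo = perp_obj[OF B]
    obtain p where p: "arr (onO L B) B p" "p \<bullet> \<eta> B = Ident T B" using local_retract[OF B] .
    have \<eta>p: "\<eta> B \<bullet> p = Ident T (onO L B)"
    proof (rule right_cancel[OF unit_epi[OF Bo L_perp[OF Bo]] \<eta>_arr[OF Bo]])
      show "arr (onO L B) (onO L B) (\<eta> B \<bullet> p)" using arr_comp[OF p(1) \<eta>_arr[OF Bo]] .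
      show "arr (onO L B) (onO L B) (Ident T (onO L B))" using arr_ident[OF L_obj[OF Bo]] .
      show "(\<eta> B \<bullet> p) \<bullet> \<eta> B = Ident T (onO L B) \<bullet> \<eta> B"
        using assoc[OF \<eta>_arr[OF Bo] p(1) \<eta>_arr[OF Bo]] p(2)
          comp_ident[OF \<eta>_arr[OF Bo]] ident_comp[OF \<eta>_arr[OF Bo]] by simp
    qed
    have fp: "arr (onO L B) X (f \<bullet> p)" using arr_comp[OF p(1) f] .
    let ?g = "\<Phi> B X (f \<bullet> p)"
    have g: "arr B ?U ?g" using \<Phi>_arr[OF fp Bo] .
    have "e \<bullet> onM L ?g = f \<bullet> p"
      using \<Phi>_inj[OF arr_comp[OF L_arr[OF g] e(1)] fp _ Bo] lift(1)[OF g] by blast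
    then have ex: "(e \<bullet> \<eta> ?U) \<bullet> ?g = f"
      using lift(2)[OF g] assoc[OF \<eta>_arr[OF Bo] p(1) f] p(2) comp_ident[OF f] by simp
    have uniq: "g' = ?g" if g': "arr B ?U g'" "(e \<bullet> \<eta> ?U) \<bullet> g' = f" for g'
    proof -
      note Lg = arr_comp[OF L_arr[OF g'(1)] e(1)]
      have "f \<bullet> p = (e \<bullet> onM L g') \<bullet> (\<eta> B \<bullet> p)"
        using g'(2) lift(2)[OF g'(1)] assoc[OF p(1) \<eta>_arr[OF Bo] Lg] by simp
      also have "\<dots> = e \<bullet> onM L g'" using \<eta>p comp_ident[OF Lg] by simp
      finally show ?thesis using lift(1)[OF g'(1)] by simp
    qed
    show "\<exists>!g. arr B ?U g \<and> (e \<bullet> \<eta> ?U) \<bullet> g = f"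
      by (rule ex1I[of _ ?g], rule conjI[OF g ex]) (elim conjE, rule uniq)
  qed
  then show ?thesis by blast
qed

end

section \<open>The action of the ring\<close>

context triangulated_category
begin

text \<open>The action on \<open>\<Sigma>X\<close> agrees with the suspension of the action on \<open>X\<close> only up to sign. Vanishing of
  composites is insensitive to this sign.\<close>

definition equal_up_to_sign where
  "equal_up_to_sign X Y f g \<longleftrightarrow> arr X Y f \<and> arr X Y g \<and> (f = g \<or> f = inv\<^bsub>HomG T X Y\<^esub> g)"

lemma inv_inv_arr: "arr X Y f \<Longrightarrow> inv\<^bsub>HomG T X Y\<^esub> (inv\<^bsub>HomG T X Y\<^esub> f) = f"
  using group.inv_inv[OF arr_group] by (simp add: arr_def)

lemma equal_up_to_sign_trans:
  "equal_up_to_sign X Y f g \<Longrightarrow> equal_up_to_sign X Y g h \<Longrightarrow> equal_up_to_sign X Y f h"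
  unfolding equal_up_to_sign_def by (auto simp: inv_inv_arr)

lemma equal_up_to_sign_sym: "equal_up_to_sign X Y f g \<Longrightarrow> equal_up_to_sign X Y g f"
  unfolding equal_up_to_sign_def by (auto simp: inv_inv_arr)

lemma equal_up_to_sign_susp:
  assumes "arr X Y f" "arr X Y g"
  shows "equal_up_to_sign (SuspO T X) (SuspO T Y) (SuspM T f) (SuspM T g) \<longleftrightarrow> equal_up_to_sign X Y f g"
proof -
  have "SuspM T f = SuspM T g \<longleftrightarrow> f = g" using arr_susp_inj[OF assms] by blast
  moreover have "SuspM T f = inv\<^bsub>HomG T (SuspO T X) (SuspO T Y)\<^esub> (SuspM T g) \<longleftrightarrow> f = inv\<^bsub>HomG T X Y\<^esub> g"
    using arr_susp_inj[OF assms(1) arr_inv[OF assms(2)]] susp_inv[OF assms(2)] by metis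
  ultimately show ?thesis using assms arr_susp by (simp add: equal_up_to_sign_def)
qed

lemma equal_up_to_sign_comp_zero:
  assumes "equal_up_to_sign X Y f g"
  shows "arr Y Z a \<Longrightarrow> a \<bullet> f = zero_map X Z \<longleftrightarrow> a \<bullet> g = zero_map X Z"
    and "arr W X b \<Longrightarrow> f \<bullet> b = zero_map W Y \<longleftrightarrow> g \<bullet> b = zero_map W Y"
proof -
  have fg: "arr X Y g" "f = g \<or> f = inv\<^bsub>HomG T X Y\<^esub> g"
    using assms by (simp_all add: equal_up_to_sign_def)
  show "a \<bullet> f = zero_map X Z \<longleftrightarrow> a \<bullet> g = zero_map X Z" if a: "arr Y Z a"
    using fg(2) comp_inv[OF fg(1) a] inv_zero_iff[OF arr_comp[OF fg(1) a]] by metis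
  show "f \<bullet> b = zero_map W Y \<longleftrightarrow> g \<bullet> b = zero_map W Y" if b: "arr W X b"
    using fg(2) inv_comp[OF b fg(1)] inv_zero_iff[OF arr_comp[OF b fg(1)]] by metis
qed

end

context compactly_generated_linear_category
begin

lemma act_one: "X \<in> Obj T \<Longrightarrow> \<phi> 0 \<one> X = Ident T X"
  and act_plus: "r \<in> Rg n \<Longrightarrow> s \<in> Rg n \<Longrightarrow> X \<in> Obj T \<Longrightarrow>
    \<phi> n (r \<oplus> s) X = \<phi> n r X \<otimes>\<^bsub>HomG T X (Sus n X)\<^esub> \<phi> n s X"
  and act_times: "r \<in> Rg m \<Longrightarrow> s \<in> Rg n \<Longrightarrow> X \<in> Obj T \<Longrightarrow>
    \<phi> (m + n) (r \<otimes> s) X = SusM n (\<phi> m r X) \<bullet>\<^bsub>T\<^esub> \<phi> n s X"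
  using linear unfolding linear_over_def by blast+

lemma act_natural_transformation:
  assumes "r \<in> Rg d" shows "nat_trans T id_endofun (susp_endofun T d) (\<phi> d r)"
  using linear assms by (simp add: linear_over_def graded_center_def)

lemma act_arr: "r \<in> Rg d \<Longrightarrow> X \<in> Obj T \<Longrightarrow> arr X (Sus d X) (\<phi> d r X)"
  using act_natural_transformation[of r d] Sus_obj
  by (simp add: nat_trans_def id_endofun_def susp_endofun_def arr_def)

lemma act_natural: "r \<in> Rg d \<Longrightarrow> arr X Y f \<Longrightarrow> \<phi> d r Y \<bullet>\<^bsub>T\<^esub> f = SusM d f \<bullet>\<^bsub>T\<^esub> \<phi> d r X"
  using act_natural_transformation[of r d]
  by (simp add: nat_trans_def id_endofun_def susp_endofun_def arr_def)

lemma act_susp: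
  assumes r: "r \<in> Rg d" and X: "X \<in> Obj T"
  shows "equal_up_to_sign (SuspO T X) (SuspO T (Sus d X)) (\<phi> d r (SuspO T X)) (SuspM T (\<phi> d r X))"
proof -
  have "Sus d (SuspO T X) = SuspO T (Sus d X)"
    using Sus_commute[OF X, of d 1] by (simp add: Sus_1)
  moreover have "\<phi> d r \<in> graded_center T d" using linear r by (simp add: linear_over_def)
  ultimately show ?thesis
    using X act_arr[OF r susp_obj_closed[OF X]] arr_susp[OF act_arr[OF r X]]
    by (auto simp: graded_center_def equal_up_to_sign_def split: if_splits)
qed

lemma act_Sus:
  assumes r: "r \<in> Rg d" and X: "X \<in> Obj T"
  shows "equal_up_to_sign (Sus n X) (Sus d (Sus n X)) (\<phi> d r (Sus n X)) (SusM n (\<phi> d r X))"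
proof (induction n rule: int_iff_induct)
  case zero
  then show ?case using act_arr[OF r X] by (simp add: Sus_0 SusM_0 equal_up_to_sign_def)
next
  case (step i)
  let ?Y = "Sus i X"
  have Y: "?Y \<in> Obj T" using Sus_obj X .
  have comm: "Sus d (SuspO T ?Y) = SuspO T (Sus d ?Y)"
    using Sus_commute[OF Y, of d 1] by (simp add: Sus_1)
  have b: "arr ?Y (Sus d ?Y) (SusM i (\<phi> d r X))"
    using arr_SusM[OF act_arr[OF r X], of i] by (simp add: Sus_commute[OF X, of d i])
  note a = act_arr[OF r Y] and s = act_susp[OF r Y]
  have "equal_up_to_sign (SuspO T ?Y) (SuspO T (Sus d ?Y)) (\<phi> d r (SuspO T ?Y)) (SuspM T (SusM i (\<phi> d r X)))
    \<longleftrightarrow> equal_up_to_sign (SuspO T ?Y) (SuspO T (Sus d ?Y)) (SuspM T (\<phi> d r ?Y)) (SuspM T (SusM i (\<phi> d r X)))"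
    using equal_up_to_sign_trans[OF s] equal_up_to_sign_trans[OF equal_up_to_sign_sym[OF s]] by blast
  then show ?case
    using equal_up_to_sign_susp[OF a b]
    by (simp add: Sus_Suc[OF X] SusM_Suc[OF act_arr[OF r X]] comm)
qed

definition invertible where
  "invertible d s X \<longleftrightarrow> iso_arr T X (Sus d X) (\<phi> d s X)"

text \<open>Let \<open>s\<^sub>K\<close> be the action of \<open>s\<close> on the cone \<open>A \<rightarrow> \<Sigma>\<^sup>dA \<rightarrow> K \<rightarrow> \<Sigma>A\<close> of \<open>s\<^sub>A\<close>, with second and third map
  \<open>g\<close> and \<open>h\<close>. Naturality gives \<open>s\<^sub>K g = \<plusminus>\<Sigma>\<^sup>d(g s\<^sub>A) = 0\<close>, so \<open>s\<^sub>K = v h\<close> for some \<open>v\<close>. Applying \<open>s\<close> once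
  more gives \<open>\<Sigma>\<^sup>d(v) s\<^sub>\<Sigma>\<^sub>A h = \<plusminus>\<Sigma>\<^sup>d(v) \<Sigma>(s\<^sub>A) h = 0\<close>.\<close>

lemma cone_killed_by_square:
  assumes t: "Tri T A (Sus d A) K (\<phi> d s A) g h" and s: "s \<in> Rg d"
  shows "\<phi> (d + d) (s \<otimes> s) K = zero_map K (Sus (d + d) K)"
proof -
  note tt = triD[OF t]
  note ob = arr_obj[OF tt(1)] arr_obj(2)[OF tt(2)]
  have SK: "Sus d K \<in> Obj T" using Sus_obj ob by blast
  note sK = act_arr[OF s ob(3)]
  have "SusM d g \<bullet>\<^bsub>T\<^esub> SusM d (\<phi> d s A) = zero_map (Sus d A) (Sus d K)"
    using SusM_comp[OF tt(1,2), of d] tri_zero_gf[OF t] SusM_zero[OF ob(1,3)] by simp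
  then have "SusM d g \<bullet>\<^bsub>T\<^esub> \<phi> d s (Sus d A) = zero_map (Sus d A) (Sus d K)"
    using equal_up_to_sign_comp_zero(1)[OF act_Sus[OF s ob(1)] arr_SusM[OF tt(2)]] by blast
  then have "\<phi> d s K \<bullet>\<^bsub>T\<^esub> g = zero_map (Sus d A) (Sus d K)"
    using act_natural[OF s tt(2)] by simp
  then obtain v where v: "arr (SuspO T A) (Sus d K) v" "\<phi> d s K = v \<bullet>\<^bsub>T\<^esub> h"
    using tri_extend_Z[OF t sK] by blast
  have SA: "SuspO T A \<in> Obj T" using susp_obj_closed ob by blast
  note sSA = act_arr[OF s SA] and sSK = act_arr[OF s SK] and Sv = arr_SusM[OF v(1), of d]
  have comm: "Sus d (SuspO T A) = SuspO T (Sus d A)"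
    using Sus_commute[OF ob(1), of d 1] by (simp add: Sus_1)
  have z: "\<phi> d s (SuspO T A) \<bullet>\<^bsub>T\<^esub> h = zero_map K (Sus d (SuspO T A))"
    using equal_up_to_sign_comp_zero(2)[OF act_susp[OF s ob(1)] tt(3)] tri_zero_Sfh[OF t] comm by simp
  have "\<phi> d s (Sus d K) \<bullet>\<^bsub>T\<^esub> \<phi> d s K = (\<phi> d s (Sus d K) \<bullet>\<^bsub>T\<^esub> v) \<bullet>\<^bsub>T\<^esub> h"
    using assoc[OF tt(3) v(1) sSK] v(2) by simp
  also have "\<dots> = SusM d v \<bullet>\<^bsub>T\<^esub> (\<phi> d s (SuspO T A) \<bullet>\<^bsub>T\<^esub> h)"
    using act_natural[OF s v(1)] assoc[OF tt(3) sSA Sv] by simp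
  also have "\<dots> = zero_map K (Sus d (Sus d K))" using z comp_zero[OF ob(3) Sv] by simp
  finally have "SusM d (\<phi> d s K) \<bullet>\<^bsub>T\<^esub> \<phi> d s K = zero_map K (Sus d (Sus d K))"
    using equal_up_to_sign_comp_zero(2)[OF act_Sus[OF s ob(3)] sK] by blast
  moreover have "\<phi> (d + d) (s \<otimes> s) K = SusM d (\<phi> d s K) \<bullet>\<^bsub>T\<^esub> \<phi> d s K"
    by (rule act_times[OF s s ob(3)])
  ultimately show ?thesis using Sus_add[OF ob(3), of d d] by simp
qed

lemma graded_module_Hom:
  assumes C: "C \<in> Obj T" and X: "X \<in> Obj T"
  shows "graded_module R Rg (graded_Hom T C X) (graded_Hom_act T \<phi> X)"
proof -
  have M: "graded_Hom T C X n = HomG T C (Sus n X)" for n by (simp add: graded_Hom_def)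
  have act: "graded_Hom_act T \<phi> X k r n f = SusM n (\<phi> k r X) \<bullet>\<^bsub>T\<^esub> f" for k r n f
    by (simp add: graded_Hom_act_def)
  have SX: "Sus n X \<in> Obj T" for n using Sus_obj X .
  have arrM: "arr C (Sus n X) f" if "f \<in> carrier (graded_Hom T C X n)" for n f
    using that C SX by (simp add: M arr_def)
  have Sact: "arr (Sus n X) (Sus (k + n) X) (SusM n (\<phi> k r X))" if "r \<in> Rg k" for n k r
    using arr_SusM[OF act_arr[OF that X], of n] Sus_add[OF X, of n k] by (simp add: add.commute)
  show ?thesis
  proof (intro graded_module.intro graded_module_axioms.intro)
    show "graded_commutative_ring R Rg" by (rule graded_commutative_ring_axioms)
    show "group (graded_Hom T C X n)" for n using arr_group C SX by (simp add: M)
    show "graded_Hom_act T \<phi> X k r n m \<in> carrier (graded_Hom T C X (k + n))"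
      if "r \<in> Rg k" "m \<in> carrier (graded_Hom T C X n)" for r k n m
      using arr_comp[OF arrM[OF that(2)] Sact[OF that(1)]] by (simp add: act M arr_def)
    show "graded_Hom_act T \<phi> X 0 \<one> n m = m" if "m \<in> carrier (graded_Hom T C X n)" for n m
      using ident_comp[OF arrM[OF that]] act_one[OF X] SusM_ident[OF X] by (simp add: act)
    show "graded_Hom_act T \<phi> X k r n \<one>\<^bsub>graded_Hom T C X n\<^esub> = \<one>\<^bsub>graded_Hom T C X (k + n)\<^esub>"
      if "r \<in> Rg k" for r k n
      using comp_zero[OF C Sact[OF that]] by (simp add: act M)
    show "graded_Hom_act T \<phi> X k (r \<oplus> s) n m =
        graded_Hom_act T \<phi> X k r n m \<otimes>\<^bsub>graded_Hom T C X (k + n)\<^esub> graded_Hom_act T \<phi> X k s n m"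
      if "r \<in> Rg k" "s \<in> Rg k" "m \<in> carrier (graded_Hom T C X n)" for r k s m n
    proof -
      have "\<phi> k (r \<oplus> s) X = \<phi> k r X \<otimes>\<^bsub>HomG T X (Sus k X)\<^esub> \<phi> k s X"
        by (rule act_plus[OF that(1,2) X])
      then have "SusM n (\<phi> k (r \<oplus> s) X) =
          SusM n (\<phi> k r X) \<otimes>\<^bsub>HomG T (Sus n X) (Sus (k + n) X)\<^esub> SusM n (\<phi> k s X)"
        using SusM_add_hom[OF act_arr[OF that(1) X] act_arr[OF that(2) X], of n] Sus_add[OF X, of n k]
        by (simp add: add.commute)
      then show ?thesis
        using comp_add_left[OF C SX SX] arrM[OF that(3)] Sact[OF that(1)] Sact[OF that(2)]
        by (simp add: act M arr_def)
    qed
    show "graded_Hom_act T \<phi> X (j + k) (r \<otimes> s) n m =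
        graded_Hom_act T \<phi> X j r (k + n) (graded_Hom_act T \<phi> X k s n m)"
      if "r \<in> Rg j" "s \<in> Rg k" "m \<in> carrier (graded_Hom T C X n)" for r j s k m n
    proof -
      have "\<phi> (j + k) (r \<otimes> s) X = SusM k (\<phi> j r X) \<bullet>\<^bsub>T\<^esub> \<phi> k s X"
        by (rule act_times[OF that(1,2) X])
      moreover note SusM_comp[OF act_arr[OF that(2) X] arr_SusM[OF act_arr[OF that(1) X]], of n]
      moreover have "SusM n (SusM k (\<phi> j r X)) = SusM (k + n) (\<phi> j r X)"
        using SusM_add[OF act_arr[OF that(1) X], of n k] by (simp add: add.commute)
      ultimately show ?thesis
        using assoc[OF arrM[OF that(3)] Sact[OF that(2)] Sact[OF that(1)]] by (simp add: act)
    qed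
  qed
qed

abbreviation supported where "supported V \<equiv> supported_on R Rg T \<phi> \<kappa> V"

lemma compact_obj: "C \<in> compact_objects T \<kappa> \<Longrightarrow> C \<in> Obj T"
  by (simp add: compact_objects_def)

lemma supported_iff:
  assumes X: "X \<in> Obj T"
  shows "X \<in> supported V \<longleftrightarrow> (\<forall>C\<in>compact_objects T \<kappa>. \<forall>q\<in>Spec R Rg - V. \<forall>n f. arr C (Sus n X) f \<longrightarrow>
    (\<exists>k s. s \<in> Rg k \<and> s \<notin> q \<and> SusM n (\<phi> k s X) \<bullet>\<^bsub>T\<^esub> f = zero_map C (Sus (k + n) X)))"
proof -
  have "localization_vanishes R Rg q (graded_Hom T C X) (graded_Hom_act T \<phi> X) \<longleftrightarrow>
      (\<forall>n f. arr C (Sus n X) f \<longrightarrow>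
        (\<exists>k s. s \<in> Rg k \<and> s \<notin> q \<and> SusM n (\<phi> k s X) \<bullet>\<^bsub>T\<^esub> f = zero_map C (Sus (k + n) X)))"
    if C: "C \<in> compact_objects T \<kappa>" and q: "q \<in> Spec R Rg - V" for C q
  proof -
    interpret graded_module R Rg "graded_Hom T C X" "graded_Hom_act T \<phi> X"
      using graded_module_Hom[OF compact_obj[OF C] X] .
    show ?thesis
      using localization_vanishes_iff[of q] q compact_obj[OF C] Sus_obj[OF X]
      by (simp add: kills_def arr_def graded_Hom_def graded_Hom_act_def Ball_def)
  qed
  then show ?thesis using X by (simp add: supported_on_def)
qed

text \<open>Since \<open>s\<^sup>2\<close> annihilates \<open>K\<close>, the cohomology of \<open>K\<close> vanishes at every prime that does not contain
  \<open>s\<close>.\<close>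

lemma cone_supported:
  assumes t: "Tri T A (Sus d A) K (\<phi> d s A) g h" and s: "s \<in> Rg d"
    and V: "\<And>q. q \<in> Spec R Rg \<Longrightarrow> s \<in> q \<Longrightarrow> q \<in> V"
  shows "K \<in> supported V"
proof -
  have K: "K \<in> Obj T" using arr_obj(2)[OF triD(2)[OF t]] .
  show ?thesis unfolding supported_iff[OF K]
  proof (intro ballI allI impI)
    fix C q n f assume q: "q \<in> Spec R Rg - V" and f: "arr C (Sus n K) f"
    then have sq: "s \<notin> q" using V by blast
    have "s \<otimes> s \<notin> q"
    proof
      assume "s \<otimes> s \<in> q"
      then show False using q s sq unfolding Spec_def by blast
    qed
    moreover have "SusM n (\<phi> (d + d) (s \<otimes> s) K) \<bullet>\<^bsub>T\<^esub> f = zero_map C (Sus (d + d + n) K)"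
      using cone_killed_by_square[OF t s] SusM_zero[OF K Sus_obj[OF K], of n "d + d"]
        zero_comp[OF Sus_obj[OF Sus_obj[OF K, of "d + d"], of n] f] Sus_add[OF K, of n "d + d"]
      by (simp add: add.commute)
    ultimately show "\<exists>k s. s \<in> Rg k \<and> s \<notin> q \<and> SusM n (\<phi> k s K) \<bullet>\<^bsub>T\<^esub> f = zero_map C (Sus (k + n) K)"
      using mult_degree[OF s s] by blast
  qed
qed

text \<open>A nonzero \<open>G\<close> has nonzero cohomology for some compact \<open>C\<close>, hence an associated prime \<open>q\<close>, the
  annihilator of a nonzero class. Support in \<open>V\<close> forces \<open>q \<in> V\<close>. But an element of \<open>q\<close> kills that class,
  so none of them acts invertibly.\<close>

lemma supported_invertible_zero:
  assumes G: "G \<in> supported V" and inv: "\<And>q. q \<in> V \<Longrightarrow> \<exists>d s. s \<in> Rg d \<and> s \<in> q \<and> invertible d s G"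
  shows "zero_object T G"
proof (rule ccontr)
  assume nz: "\<not> zero_object T G"
  have Go: "G \<in> Obj T" using G by (simp add: supported_on_def)
  obtain Gen where Gen: "Gen \<subseteq> compact_objects T \<kappa>" and gen: "\<forall>X\<in>Obj T.
      (\<forall>C\<in>Gen. \<forall>n. Hom T C (Sus n X) = {zero_map C (Sus n X)}) \<longrightarrow> zero_object T X"
    using compact_generation unfolding compactly_generated_def by blast
  obtain C n0 where C: "C \<in> Gen" and ne: "Hom T C (Sus n0 G) \<noteq> {zero_map C (Sus n0 G)}"
    using gen Go nz by blast
  have Co: "C \<in> Obj T" and Cc: "C \<in> compact_objects T \<kappa>" using C Gen compact_obj by blast+
  have SG: "Sus n G \<in> Obj T" for n using Sus_obj Go .
  interpret graded_module R Rg "graded_Hom T C G" "graded_Hom_act T \<phi> G"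
    using graded_module_Hom[OF Co Go] .
  have "zero_map C (Sus n0 G) \<in> Hom T C (Sus n0 G)" using arr_zero[OF Co SG] by (simp add: arr_def)
  then obtain f0 where "f0 \<in> carrier (graded_Hom T C G n0)" "f0 \<noteq> \<one>\<^bsub>graded_Hom T C G n0\<^esub>"
    using ne by (auto simp: graded_Hom_def)
  then obtain n f where f: "f \<in> carrier (graded_Hom T C G n)" "f \<noteq> \<one>\<^bsub>graded_Hom T C G n\<^esub>"
      and prime: "annihilator n f \<in> Spec R Rg"
    using exists_associated_prime[OF noetherian_ring_axioms] by blast
  have fa: "arr C (Sus n G) f" using f(1) Co SG by (simp add: graded_Hom_def arr_def)
  have kill: "SusM n (\<phi> k s G) \<bullet>\<^bsub>T\<^esub> f = zero_map C (Sus (k + n) G) \<longleftrightarrow> s \<in> annihilator n f"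
    if "s \<in> Rg k" for k s
    using annihilator_iff[OF f(1) that] by (simp add: kills_def graded_Hom_def graded_Hom_act_def)
  show False
  proof (cases "annihilator n f \<in> V")
    case True
    then obtain d s where s: "s \<in> Rg d" "s \<in> annihilator n f" "invertible d s G" using inv by blast
    have "iso_arr T (Sus n G) (Sus n (Sus d G)) (SusM n (\<phi> d s G))"
      using SusM_iso s(3) by (simp add: invertible_def)
    moreover have "SusM n (\<phi> d s G) \<bullet>\<^bsub>T\<^esub> f = zero_map C (Sus n (Sus d G))"
      using kill[OF s(1)] s(2) Sus_add[OF Go, of n d] by (simp add: add.commute)
    ultimately have "f = zero_map C (Sus n G)" using iso_comp_zero[OF _ fa] by blast
    then show False using f(2) by (simp add: graded_Hom_def)
  next
    case False
    then obtain k s where "s \<in> Rg k" "s \<notin> annihilator n f"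
        "SusM n (\<phi> k s G) \<bullet>\<^bsub>T\<^esub> f = zero_map C (Sus (k + n) G)"
      using G supported_iff[OF Go] Cc prime fa by blast
    then show False using kill by blast
  qed
qed

definition acts_bijectively where
  "acts_bijectively d s \<E> X \<longleftrightarrow> (\<forall>B\<in>\<E>.
     (\<forall>a. arr B X a \<longrightarrow> \<phi> d s X \<bullet>\<^bsub>T\<^esub> a = zero_map B (Sus d X) \<longrightarrow> a = zero_map B X) \<and>
     (\<forall>v. arr B (Sus d X) v \<longrightarrow> (\<exists>w. arr B X w \<and> v = \<phi> d s X \<bullet>\<^bsub>T\<^esub> w)))"

text \<open>The long exact sequences obtained by mapping from \<open>B\<close>, for all \<open>B \<in> \<E>\<close> at once.\<close>

lemma orth_cone_iff:
  assumes t: "Tri T X (Sus d X) Z (\<phi> d s X) g h" and \<E>: "susp_closed \<E>"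
  shows "(\<forall>B\<in>\<E>. orth B Z) \<longleftrightarrow> acts_bijectively d s \<E> X"
proof
  note tt = triD[OF t]
  note ob = arr_obj[OF tt(1)] arr_obj(2)[OF tt(2)]
  assume o: "\<forall>B\<in>\<E>. orth B Z"
  show "acts_bijectively d s \<E> X"
    unfolding acts_bijectively_def
  proof (intro ballI conjI allI impI)
    fix B a assume B: "B \<in> \<E>" and a: "arr B X a" "\<phi> d s X \<bullet>\<^bsub>T\<^esub> a = zero_map B (Sus d X)"
    have "orth (SuspO T B) Z" using o susp_closed_susp[OF \<E> B] by blast
    then show "a = zero_map B X" using tri_mono[OF t _ a] by blast
  next
    fix B v assume B: "B \<in> \<E>" and v: "arr B (Sus d X) v"
    have "g \<bullet>\<^bsub>T\<^esub> v = zero_map B Z" using orthD o B arr_comp[OF v tt(2)] by blast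
    then show "\<exists>w. arr B X w \<and> v = \<phi> d s X \<bullet>\<^bsub>T\<^esub> w" using tri_lift_Y[OF t v] by blast
  qed
next
  note tt = triD[OF t]
  note ob = arr_obj[OF tt(1)] arr_obj(2)[OF tt(2)]
  assume b: "acts_bijectively d s \<E> X"
  show "\<forall>B\<in>\<E>. orth B Z"
  proof
    fix B assume B: "B \<in> \<E>"
    then have Bo: "B \<in> Obj T" using \<E> by (auto simp: susp_closed_def)
    show "orth B Z" unfolding orth_def
    proof (intro allI impI)
      fix f assume f: "arr B Z f"
      have S1: "SuspO T X = Sus 1 X" "SuspO T (Sus d X) = Sus 1 (Sus d X)" by (simp_all add: Sus_1)
      have hf: "arr B (SuspO T X) (h \<bullet>\<^bsub>T\<^esub> f)" using arr_comp[OF f tt(3)] .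
      \<comment> \<open>\<open>h f\<close> is killed by \<open>\<Sigma>(s\<^sub>X)\<close>; injectivity applies to its desuspension \<open>\<Sigma>\<inverse>B \<rightarrow> X\<close>\<close>
      let ?u = "SusM (- 1) (h \<bullet>\<^bsub>T\<^esub> f)"
      have B': "Sus (- 1) B \<in> \<E>" using \<E> B by (simp add: susp_closed_def)
      have u: "arr (Sus (- 1) B) X ?u" using arr_SusM_back[OF ob(1), of B 1] hf by (simp add: S1)
      have hu: "SuspM T ?u = h \<bullet>\<^bsub>T\<^esub> f" using SusM_cancel(1)[OF hf, of 1] by (simp add: SusM_1)
      have "SuspM T (\<phi> d s X) \<bullet>\<^bsub>T\<^esub> (h \<bullet>\<^bsub>T\<^esub> f) = zero_map B (SuspO T (Sus d X))"
        using assoc[OF f tt(3) arr_susp[OF tt(1)]] tri_zero_Sfh[OF t]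
          zero_comp[OF susp_obj_closed[OF ob(2)] f] by simp
      then have "SuspM T (\<phi> d s X \<bullet>\<^bsub>T\<^esub> ?u) = zero_map B (SuspO T (Sus d X))"
        using susp_comp_arr[OF u tt(1)] hu by simp
      moreover have "SuspO T (Sus (- 1) B) = B" using Sus_cancel(1)[OF Bo, of 1] by (simp add: Sus_1)
      ultimately have "\<phi> d s X \<bullet>\<^bsub>T\<^esub> ?u = zero_map (Sus (- 1) B) (Sus d X)"
        using susp_zero_iff[OF arr_comp[OF u tt(1)]] by simp
      then have "?u = zero_map (Sus (- 1) B) X"
        using b B' u unfolding acts_bijectively_def by blast
      then have "h \<bullet>\<^bsub>T\<^esub> f = zero_map B (SuspO T X)"
        using hu susp_zero[OF arr_obj[OF u]] \<open>SuspO T (Sus (- 1) B) = B\<close> by simp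
      then obtain v where v: "arr B (Sus d X) v" "f = g \<bullet>\<^bsub>T\<^esub> v" using tri_lift_Z[OF t f] by blast
      obtain w where w: "arr B X w" "v = \<phi> d s X \<bullet>\<^bsub>T\<^esub> w"
        using b B v(1) unfolding acts_bijectively_def by blast
      have "f = (g \<bullet>\<^bsub>T\<^esub> \<phi> d s X) \<bullet>\<^bsub>T\<^esub> w" using assoc[OF w(1) tt(1,2)] v(2) w(2) by simp
      then show "f = zero_map B Z" using tri_zero_gf[OF t] zero_comp[OF ob(3) w(1)] by simp
    qed
  qed
qed

text \<open>Maps from \<open>\<E>\<close> into \<open>X\<close> are maps into \<open>c\<close>, and into \<open>\<Sigma>\<^sup>dX\<close> are maps into \<open>\<Sigma>\<^sup>dc\<close>, compatibly with \<open>s\<close>. Hence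
  this is the Yoneda lemma for \<open>s\<^sub>c : c \<rightarrow> \<Sigma>\<^sup>dc\<close> inside \<open>\<E>\<close>.\<close>

lemma coreflection_invertible_iff:
  assumes \<E>: "susp_closed \<E>" and cor: "coreflection \<E> X c \<epsilon>" and s: "s \<in> Rg d"
  shows "invertible d s c \<longleftrightarrow> acts_bijectively d s \<E> X"
proof
  note e = coreflectionD[OF cor] and Se = coreflectionD[OF coreflection_Sus[OF \<E> cor, of d]]
  note ob = arr_obj[OF e(2)]
  note sX = act_arr[OF s ob(2)] and sc = act_arr[OF s ob(1)]
  note nat = act_natural[OF s e(2)]
  {
    assume "invertible d s c"
    then obtain t where t: "arr (Sus d c) c t" "t \<bullet>\<^bsub>T\<^esub> \<phi> d s c = Ident T c" "\<phi> d s c \<bullet>\<^bsub>T\<^esub> t = Ident T (Sus d c)"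
      unfolding invertible_def by (elim iso_arrE)
    show "acts_bijectively d s \<E> X"
      unfolding acts_bijectively_def
    proof (intro ballI conjI allI impI)
      fix B a assume B: "B \<in> \<E>" and a: "arr B X a" "\<phi> d s X \<bullet>\<^bsub>T\<^esub> a = zero_map B (Sus d X)"
      have Bo: "B \<in> Obj T" using arr_obj a by blast
      obtain b where b: "arr B c b" "\<epsilon> \<bullet>\<^bsub>T\<^esub> b = a" using e(3) B a by blast
      have "SusM d \<epsilon> \<bullet>\<^bsub>T\<^esub> (\<phi> d s c \<bullet>\<^bsub>T\<^esub> b) = SusM d \<epsilon> \<bullet>\<^bsub>T\<^esub> zero_map B (Sus d c)"
        using assoc[OF b(1) sc Se(2)] assoc[OF b(1) e(2) sX] nat b(2) a(2) comp_zero[OF Bo Se(2)] by simp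
      then have "\<phi> d s c \<bullet>\<^bsub>T\<^esub> b = zero_map B (Sus d c)"
        using Se(4)[OF B arr_comp[OF b(1) sc] arr_zero[OF Bo Sus_obj[OF ob(1)]]] by blast
      then have "b = zero_map B c"
        using iso_comp_zero[OF _ b(1)] \<open>invertible d s c\<close> by (simp add: invertible_def)
      then show "a = zero_map B X" using b(2) comp_zero[OF Bo e(2)] by simp
    next
      fix B v assume B: "B \<in> \<E>" and v: "arr B (Sus d X) v"
      obtain b where b: "arr B (Sus d c) b" "SusM d \<epsilon> \<bullet>\<^bsub>T\<^esub> b = v" using Se(3) B v by blast
      have tb: "arr B c (t \<bullet>\<^bsub>T\<^esub> b)" using arr_comp[OF b(1) t(1)] .
      have "\<phi> d s X \<bullet>\<^bsub>T\<^esub> (\<epsilon> \<bullet>\<^bsub>T\<^esub> (t \<bullet>\<^bsub>T\<^esub> b)) = SusM d \<epsilon> \<bullet>\<^bsub>T\<^esub> (\<phi> d s c \<bullet>\<^bsub>T\<^esub> (t \<bullet>\<^bsub>T\<^esub> b))"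
        using assoc[OF tb e(2) sX] assoc[OF tb sc Se(2)] nat by simp
      also have "\<dots> = v" using assoc[OF b(1) t(1) sc] t(3) ident_comp[OF b(1)] b(2) by simp
      finally show "\<exists>w. arr B X w \<and> v = \<phi> d s X \<bullet>\<^bsub>T\<^esub> w" using arr_comp[OF tb e(2)] by blast
    qed
  next
    assume bij: "acts_bijectively d s \<E> X"
    have inj: "a = b" if "B \<in> \<E>" "arr B X a" "arr B X b" "\<phi> d s X \<bullet>\<^bsub>T\<^esub> a = \<phi> d s X \<bullet>\<^bsub>T\<^esub> b" for B a b
      using left_cancel[OF _ sX that(2,3,4)] bij that(1) unfolding acts_bijectively_def by blast
    obtain w where w: "arr (Sus d c) X w" "SusM d \<epsilon> = \<phi> d s X \<bullet>\<^bsub>T\<^esub> w"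
      using bij Se(1,2) unfolding acts_bijectively_def by blast
    obtain t where t: "arr (Sus d c) c t" "\<epsilon> \<bullet>\<^bsub>T\<^esub> t = w" using e(3) Se(1) w(1) by blast
    note ts = arr_comp[OF sc t(1)] and st = arr_comp[OF t(1) sc]
    have "\<phi> d s X \<bullet>\<^bsub>T\<^esub> (\<epsilon> \<bullet>\<^bsub>T\<^esub> (t \<bullet>\<^bsub>T\<^esub> \<phi> d s c)) = \<phi> d s X \<bullet>\<^bsub>T\<^esub> (\<epsilon> \<bullet>\<^bsub>T\<^esub> Ident T c)"
      using assoc[OF sc t(1) e(2)] t(2) assoc[OF sc w(1) sX] w(2) nat comp_ident[OF e(2)] by simp
    then have "\<epsilon> \<bullet>\<^bsub>T\<^esub> (t \<bullet>\<^bsub>T\<^esub> \<phi> d s c) = \<epsilon> \<bullet>\<^bsub>T\<^esub> Ident T c"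
      using inj[OF e(1) arr_comp[OF ts e(2)] arr_comp[OF arr_ident[OF ob(1)] e(2)]] by blast
    then have 1: "t \<bullet>\<^bsub>T\<^esub> \<phi> d s c = Ident T c" using e(4)[OF e(1) ts arr_ident[OF ob(1)]] by blast
    have "SusM d \<epsilon> \<bullet>\<^bsub>T\<^esub> (\<phi> d s c \<bullet>\<^bsub>T\<^esub> t) = SusM d \<epsilon> \<bullet>\<^bsub>T\<^esub> Ident T (Sus d c)"
      using assoc[OF t(1) sc Se(2)] nat assoc[OF t(1) e(2) sX] t(2) w(2) comp_ident[OF Se(2)] by simp
    then have "\<phi> d s c \<bullet>\<^bsub>T\<^esub> t = Ident T (Sus d c)"
      using Se(4)[OF Se(1) st arr_ident[OF Sus_obj[OF ob(1)]]] by blast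
    then show "invertible d s c" unfolding invertible_def using iso_arrI[OF sc t(1) 1] by blast
  }
qed

lemma invertible_acts_bijectively:
  assumes "invertible d s X" shows "acts_bijectively d s \<E> X"
proof -
  obtain t where t: "arr X (Sus d X) (\<phi> d s X)" "arr (Sus d X) X t" "\<phi> d s X \<bullet>\<^bsub>T\<^esub> t = Ident T (Sus d X)"
    using assms unfolding invertible_def by (elim iso_arrE)
  show ?thesis
    unfolding acts_bijectively_def
  proof (intro ballI conjI allI impI)
    fix B a assume "arr B X a" "\<phi> d s X \<bullet>\<^bsub>T\<^esub> a = zero_map B (Sus d X)"
    then show "a = zero_map B X" using iso_comp_zero assms unfolding invertible_def by blast
  next
    fix B v assume v: "arr B (Sus d X) v"
    have "v = \<phi> d s X \<bullet>\<^bsub>T\<^esub> (t \<bullet>\<^bsub>T\<^esub> v)"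
      using assoc[OF v t(2,1)] t(3) ident_comp[OF v] by simp
    then show "\<exists>w. arr B X w \<and> v = \<phi> d s X \<bullet>\<^bsub>T\<^esub> w" using arr_comp[OF v t(2)] by blast
  qed
qed

lemma supported_inter: "supported (V \<inter> V') = supported V \<inter> supported V'"
  by (auto simp: supported_on_def)

lemma supported_Spec: "supported (Spec R Rg) = Obj T"
  by (auto simp: supported_on_def)

lemma closed_locus_specialization_closed: "specialization_closed R Rg (closed_locus R Rg \<aa>)"
  by (auto simp: specialization_closed_def closed_locus_def)

lemma non_generalizations_specialization_closed:
  "specialization_closed R Rg (non_generalizations R Rg \<pp>)"
  by (auto simp: specialization_closed_def non_generalizations_def)

lemma closed_locus_Idl:
  assumes "S \<subseteq> carrier R" shows "closed_locus R Rg (Idl\<^bsub>R\<^esub> S) = closed_locus R Rg S"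
  using genideal_self[OF assms] genideal_minimal[of _ S]
  by (auto simp: closed_locus_def Spec_def homogeneous_ideal_def)

text \<open>The homogeneous components of an element of \<open>q\<close> outside \<open>\<pp>\<close> lie in \<open>q\<close>, and not all of them in
  \<open>\<pp>\<close>.\<close>

lemma homogeneous_witness:
  assumes q: "q \<in> Spec R Rg" and p: "\<pp> \<in> Spec R Rg" and n: "\<not> q \<subseteq> \<pp>"
  shows "\<exists>d s. s \<in> Rg d \<and> s \<in> q \<and> s \<notin> \<pp>"
proof (rule ccontr)
  assume none: "\<nexists>d s. s \<in> Rg d \<and> s \<in> q \<and> s \<notin> \<pp>"
  have hq: "homogeneous_ideal R Rg q" and iq: "ideal q R" and ip: "ideal \<pp> R"
    using q p by (simp_all add: Spec_def homogeneous_ideal_def)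
  obtain x where x: "x \<in> q" "x \<notin> \<pp>" using n by blast
  have "x \<in> carrier R"
    using ideal.Icarr[OF iq x(1)] .
  then obtain c where c: "homogeneous_components R Rg x c" using direct_sum by blast
  have "c k \<in> q" for k using hq c x(1) unfolding homogeneous_ideal_def by blast
  then have cp: "c k \<in> \<pp>" for k using none homogeneous_components_degree[OF c] by blast
  interpret ip: ideal \<pp> R by (rule ip)
  have "(\<Oplus>k\<in>F. c k) \<in> \<pp>" if "finite F" for F
    using that
  proof (induction F)
    case (insert k F)
    then show ?case using cp ip.Icarr by (subst finsum_insert) auto
  qed simp
  then have "x \<in> \<pp>"
    using homogeneous_components_sum[OF c homogeneous_components_finite[OF c]] homogeneous_components_finite[OF c]
    by simp
  then show False using x(2) by blast
qed

end

section \<open>Local cohomology and homology\<close>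

locale local_cohomology = compactly_generated_linear_category R Rg T \<phi> \<kappa>
  for R :: "('r, 'z) ring_scheme" (structure) and Rg :: "int \<Rightarrow> 'r set"
    and T :: "('o, 'm, 'x) tricat_scheme" and \<phi> :: "int \<Rightarrow> 'r \<Rightarrow> 'o \<Rightarrow> 'm"
    and \<kappa> :: "'i rel" +
  fixes \<Gamma> L \<Lambda> \<Upsilon> :: "'r set set \<Rightarrow> ('o, 'm) endofun"
  assumes functors: "local_functors R Rg T \<phi> \<kappa> \<Gamma> L \<Lambda> \<Upsilon>"
begin

lemma bousfield:
  assumes "specialization_closed R Rg V"
  obtains \<theta> \<eta> \<nu> where "bousfield_localization T (supported V) (\<Gamma> V) (L V) \<theta> \<eta> \<nu>"
proof -
  have "localization_triangle T (supported V) (\<Gamma> V) (L V)"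
    using functors assms by (simp add: local_functors_def)
  then obtain \<theta> \<eta> \<nu> where "localization_functor T (L V) \<eta>"
      "{X \<in> Obj T. zero_object T (onO (L V) X)} = supported V"
      "\<forall>X\<in>Obj T. onO (\<Gamma> V) X \<in> supported V \<and>
         Tri T (onO (\<Gamma> V) X) X (onO (L V) X) (\<theta> X) (\<eta> X) (\<nu> X)"
    unfolding localization_triangle_def by blast
  then have "bousfield_localization T (supported V) (\<Gamma> V) (L V) \<theta> \<eta> \<nu>"
    using triangulated_category_axioms
    by (simp add: bousfield_localization_def bousfield_localization_axioms_def)
  then show ?thesis by (rule that)
qed

lemma adjoints:
  assumes "specialization_closed R Rg V"
  shows "right_adjoint T (\<Gamma> V) (\<Lambda> V)" "right_adjoint T (L V) (\<Upsilon> V)"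
  using functors assms by (simp_all add: local_functors_def)

text \<open>\<open>\<Gamma>X\<close> is the coreflection of \<open>X\<close> into the objects supported on \<open>V\<close>.\<close>

lemma \<Gamma>_invertible:
  assumes V: "specialization_closed R Rg V" and s: "s \<in> Rg d" and X: "X \<in> Obj T"
    and inv: "invertible d s X"
  shows "invertible d s (onO (\<Gamma> V) X)"
proof -
  obtain \<theta> \<eta> \<nu> where "bousfield_localization T (supported V) (\<Gamma> V) (L V) \<theta> \<eta> \<nu>" using bousfield[OF V] .
  then interpret B: bousfield_localization T "supported V" "\<Gamma> V" "L V" \<theta> \<eta> \<nu> .
  show ?thesis
    using coreflection_invertible_iff[OF B.S_susp_closed B.coreflection_\<Gamma>[OF X] s]
      invertible_acts_bijectively[OF inv] by blast
qed

text \<open>The local objects for \<open>\<Z>(\<pp>)\<close> are those on which \<open>R\<close> acts through its localization at \<open>\<pp>\<close>. If \<open>Y\<close> is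
  local and \<open>s \<notin> \<pp>\<close>, the cone of \<open>s\<^sub>Y\<close> is local, and supported on \<open>\<Z>(\<pp>)\<close> because a prime containing
  \<open>s\<close> is not contained in \<open>\<pp>\<close>; so it vanishes. Conversely, invertibility passes from \<open>Y\<close> to its
  coreflection \<open>\<Gamma>Y\<close> into the objects supported on \<open>\<Z>(\<pp>)\<close>, every prime of \<open>\<Z>(\<pp>)\<close> contains a homogeneous
  \<open>s \<notin> \<pp>\<close>, and therefore \<open>\<Gamma>Y = 0\<close>.\<close>

lemma local_iff_invertible:
  assumes p: "\<pp> \<in> Spec R Rg" and Y: "Y \<in> Obj T"
  shows "Y \<in> perp (supported (non_generalizations R Rg \<pp>)) \<longleftrightarrow>
    (\<forall>d s. s \<in> Rg d \<longrightarrow> s \<notin> \<pp> \<longrightarrow> invertible d s Y)"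
proof -
  let ?Z = "non_generalizations R Rg \<pp>"
  note Z = non_generalizations_specialization_closed[of \<pp>]
  obtain \<theta> \<eta> \<nu> where "bousfield_localization T (supported ?Z) (\<Gamma> ?Z) (L ?Z) \<theta> \<eta> \<nu>" using bousfield[OF Z] .
  then interpret B: bousfield_localization T "supported ?Z" "\<Gamma> ?Z" "L ?Z" \<theta> \<eta> \<nu> .
  show ?thesis
  proof (intro iffI allI impI)
    fix d s assume loc: "Y \<in> perp (supported ?Z)" and s: "s \<in> Rg d" "s \<notin> \<pp>"
    obtain K g h where t: "Tri T Y (Sus d Y) K (\<phi> d s Y) g h"
      using tri_cone act_arr[OF s(1) Y] unfolding arr_def by blast
    have "K \<in> supported ?Z"
      by (rule cone_supported[OF t s(1)]) (use s(2) in \<open>auto simp: non_generalizations_def\<close>)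
    moreover have "Sus d Y \<in> perp (supported ?Z)"
      using loc perp_susp_closed[OF B.S_susp_closed] by (simp add: susp_closed_def)
    then have "K \<in> perp (supported ?Z)"
      using cone_closedD[OF perp_cone_closed[OF B.S_susp_closed] t loc] by blast
    ultimately have "zero_object T K" using perpD zero_object_iff_orth_self perp_obj by blast
    then show "invertible d s Y" using tri_cone_zero_iso[OF t] by (simp add: invertible_def)
  next
    assume inv: "\<forall>d s. s \<in> Rg d \<longrightarrow> s \<notin> \<pp> \<longrightarrow> invertible d s Y"
    have "zero_object T (onO (\<Gamma> ?Z) Y)"
    proof (rule supported_invertible_zero[OF B.\<Gamma>_S[OF Y]])
      fix q assume "q \<in> ?Z"
      then have "q \<in> Spec R Rg" "\<not> q \<subseteq> \<pp>" by (simp_all add: non_generalizations_def)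
      then obtain d s where "s \<in> Rg d" "s \<in> q" "s \<notin> \<pp>"
        using homogeneous_witness[OF _ p] by blast
      then show "\<exists>d s. s \<in> Rg d \<and> s \<in> q \<and> invertible d s (onO (\<Gamma> ?Z) Y)"
        using \<Gamma>_invertible[OF Z _ Y] inv by blast
    qed
    then show "Y \<in> perp (supported ?Z)" using B.\<Gamma>_zero_iff[OF Y] by blast
  qed
qed

lemma \<Gamma>_local:
  assumes V: "specialization_closed R Rg V" and p: "\<pp> \<in> Spec R Rg"
    and Y: "Y \<in> perp (supported (non_generalizations R Rg \<pp>))"
  shows "onO (\<Gamma> V) Y \<in> perp (supported (non_generalizations R Rg \<pp>))"
proof -
  note Yo = perp_obj[OF Y]
  have "onO (\<Gamma> V) Y \<in> Obj T"
    using endofunctor_obj[OF right_adjoint_functors(1)[OF adjoints(1)[OF V]] Yo] .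
  then show ?thesis
    using Y \<Gamma>_invertible[OF V _ Yo] by (simp add: local_iff_invertible[OF p] Yo)
qed

text \<open>Let \<open>A\<close> be supported on \<open>V\<close> and write \<open>L\<close> for localization away from \<open>\<Z>(\<pp>)\<close>. In the triangle
  \<open>\<Gamma>\<^sub>V L A \<rightarrow> L A \<rightarrow> L\<^sub>V L A\<close> the first two terms are local for \<open>\<Z>(\<pp>)\<close>, hence so is the third. Maps
  \<open>L A \<rightarrow> L\<^sub>V L A\<close> are then determined by their restriction to \<open>A\<close>, which vanishes because \<open>L\<^sub>V L A\<close> is
  local for \<open>V\<close>. So the unit at \<open>L A\<close> is zero.\<close>

lemma L_supported:
  assumes V: "specialization_closed R Rg V" and p: "\<pp> \<in> Spec R Rg" and A: "A \<in> supported V"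
  shows "onO (L (non_generalizations R Rg \<pp>)) A \<in> supported V"
proof -
  let ?Z = "non_generalizations R Rg \<pp>"
  note Z = non_generalizations_specialization_closed[of \<pp>]
  obtain \<theta> \<eta> \<nu> where "bousfield_localization T (supported ?Z) (\<Gamma> ?Z) (L ?Z) \<theta> \<eta> \<nu>" using bousfield[OF Z] .
  then interpret B: bousfield_localization T "supported ?Z" "\<Gamma> ?Z" "L ?Z" \<theta> \<eta> \<nu> .
  obtain \<theta>' \<eta>' \<nu>' where "bousfield_localization T (supported V) (\<Gamma> V) (L V) \<theta>' \<eta>' \<nu>'" using bousfield[OF V] .
  then interpret C: bousfield_localization T "supported V" "\<Gamma> V" "L V" \<theta>' \<eta>' \<nu>' .
  let ?A = "onO (L ?Z) A"
  have Ao: "A \<in> Obj T" using A C.S_iff by blast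
  note LA = B.L_perp[OF Ao] and LAo = B.L_obj[OF Ao]
  have loc: "onO (L V) ?A \<in> perp (supported ?Z)"
    using cone_closedD[OF perp_cone_closed[OF B.S_susp_closed] conjunct2[OF C.triangle[OF LAo]]
      \<Gamma>_local[OF V p LA] LA] .
  have "\<eta>' ?A \<bullet>\<^bsub>T\<^esub> \<eta> A = zero_map A (onO (L V) ?A)"
    using perpD[OF C.L_perp[OF LAo] A] arr_comp[OF B.\<eta>_arr[OF Ao] C.\<eta>_arr[OF LAo]] by (rule orthD)
  then have "\<eta>' ?A = zero_map ?A (onO (L V) ?A)"
    using B.unit_epi[OF Ao loc C.\<eta>_arr[OF LAo]] by blast
  then show ?thesis using C.S_if_unit_zero[OF LAo] by blast
qed

text \<open>Both sides say that \<open>s\<close> is invertible on the coreflection \<open>c\<close> of \<open>X\<close> into \<open>\<E>\<close>. For the left side this is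
  the long exact sequence and Yoneda. For the right side, the part of \<open>c\<close> supported on the primes
  containing \<open>s\<close> vanishes when \<open>s\<close> is invertible; conversely the cone of \<open>s\<^sub>c\<close> lies in \<open>\<E>\<close> and is
  supported on those primes, so if no such object has nonzero maps to \<open>c\<close>, and hence to shifts
  of \<open>c\<close>, this cone has no nonzero endomorphism.\<close>

lemma orth_koszul_step:
  assumes p: "\<pp> \<in> Spec R Rg" and V: "specialization_closed R Rg V" and s: "s \<in> Rg d"
    and t: "Tri T X (Sus d X) Z (\<phi> d s X) g h"
  defines "\<E> \<equiv> perp (supported (non_generalizations R Rg \<pp>)) \<inter> supported V"
  shows "(\<forall>B\<in>\<E>. orth B Z) \<longleftrightarrow> (\<forall>B\<in>\<E> \<inter> supported (closed_locus R Rg {s}). orth B X)"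
proof -
  let ?Z = "non_generalizations R Rg \<pp>" and ?W = "closed_locus R Rg {s}"
  note Z = non_generalizations_specialization_closed[of \<pp>]
  note W = closed_locus_specialization_closed[of "{s}"]
  obtain \<theta> \<eta> \<nu> where "bousfield_localization T (supported ?Z) (\<Gamma> ?Z) (L ?Z) \<theta> \<eta> \<nu>" using bousfield[OF Z] .
  then interpret B: bousfield_localization T "supported ?Z" "\<Gamma> ?Z" "L ?Z" \<theta> \<eta> \<nu> .
  obtain \<theta>' \<eta>' \<nu>' where "bousfield_localization T (supported V) (\<Gamma> V) (L V) \<theta>' \<eta>' \<nu>'" using bousfield[OF V] .
  then interpret C: bousfield_localization T "supported V" "\<Gamma> V" "L V" \<theta>' \<eta>' \<nu>' .
  obtain \<theta>'' \<eta>'' \<nu>'' where "bousfield_localization T (supported ?W) (\<Gamma> ?W) (L ?W) \<theta>'' \<eta>'' \<nu>''" using bousfield[OF W] .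
  then interpret D: bousfield_localization T "supported ?W" "\<Gamma> ?W" "L ?W" \<theta>'' \<eta>'' \<nu>'' .
  have Xo: "X \<in> Obj T" using arr_obj(1)[OF triD(1)[OF t]] .
  have E: "susp_closed \<E>" and EW: "susp_closed (\<E> \<inter> supported ?W)"
    using perp_susp_closed[OF B.S_susp_closed] C.S_susp_closed D.S_susp_closed
    by (auto simp: \<E>_def susp_closed_def)
  obtain \<delta> where \<delta>: "coreflection (perp (supported ?Z)) X (onO (\<Upsilon> ?Z) X) \<delta>"
    using B.coreflection_right_adjoint[OF adjoints(2)[OF Z] Xo] by blast
  define c where "c = onO (\<Gamma> V) (onO (\<Upsilon> ?Z) X)"
  have U: "onO (\<Upsilon> ?Z) X \<in> perp (supported ?Z)" using coreflectionD(1)[OF \<delta>] .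
  have cor: "coreflection \<E> X c (\<delta> \<bullet>\<^bsub>T\<^esub> \<theta>' (onO (\<Upsilon> ?Z) X))"
    unfolding \<E>_def c_def
    by (rule coreflection_trans[OF \<delta> C.coreflection_\<Gamma>[OF perp_obj[OF U]] \<Gamma>_local[OF V p U]])
  have cE: "c \<in> \<E>" using coreflectionD(1)[OF cor] .
  then have co: "c \<in> Obj T" using E by (auto simp: susp_closed_def)
  have "invertible d s c \<longleftrightarrow> (\<forall>B\<in>\<E> \<inter> supported ?W. orth B c)"
  proof
    assume inv: "invertible d s c"
    have "zero_object T (onO (\<Gamma> ?W) c)"
    proof (rule supported_invertible_zero[OF D.\<Gamma>_S[OF co]])
      fix q assume "q \<in> ?W"
      then have "s \<in> q" by (simp add: closed_locus_def)
      then show "\<exists>d s. s \<in> Rg d \<and> s \<in> q \<and> invertible d s (onO (\<Gamma> ?W) c)"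
        using s \<Gamma>_invertible[OF W s co inv] by blast
    qed
    then have "c \<in> perp (supported ?W)" using D.\<Gamma>_zero_iff[OF co] by blast
    then show "\<forall>B\<in>\<E> \<inter> supported ?W. orth B c" using perpD by blast
  next
    assume "\<forall>B\<in>\<E> \<inter> supported ?W. orth B c"
    then have cp: "c \<in> perp (\<E> \<inter> supported ?W)" using co by (auto intro: perpI)
    obtain K g' h' where t': "Tri T c (Sus d c) K (\<phi> d s c) g' h'"
      using tri_cone act_arr[OF s co] unfolding arr_def by blast
    have Scp: "Sus d c \<in> perp (\<E> \<inter> supported ?W)" and ScE: "Sus d c \<in> \<E>"
      using cp cE perp_susp_closed[OF EW] E by (simp_all add: susp_closed_def)
    have "K \<in> perp (supported ?Z)"
      using cone_closedD[OF perp_cone_closed[OF B.S_susp_closed] t'] cE ScE by (simp add: \<E>_def)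
    moreover have "K \<in> supported V"
      using cone_closedD[OF C.S_cone_closed t'] cE ScE by (simp add: \<E>_def)
    moreover have "K \<in> supported ?W"
      by (rule cone_supported[OF t' s]) (simp add: closed_locus_def)
    ultimately have "K \<in> \<E> \<inter> supported ?W" by (simp add: \<E>_def)
    moreover have "K \<in> perp (\<E> \<inter> supported ?W)"
      using cone_closedD[OF perp_cone_closed[OF EW] t' cp Scp] .
    ultimately have "zero_object T K" using perpD zero_object_iff_orth_self perp_obj by blast
    then show "invertible d s c" using tri_cone_zero_iso[OF t'] by (simp add: invertible_def)
  qed
  moreover have "(\<forall>B\<in>\<E> \<inter> supported ?W. orth B c) \<longleftrightarrow> (\<forall>B\<in>\<E> \<inter> supported ?W. orth B X)"
  proof (intro ball_cong refl coreflection_orth_iff[OF cor, symmetric])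
    fix B assume "B \<in> \<E> \<inter> supported ?W"
    then show "B \<in> \<E>" "B \<in> Obj T" using E by (auto simp: susp_closed_def)
  qed
  ultimately show ?thesis
    using orth_cone_iff[OF t E] coreflection_invertible_iff[OF E cor s] by simp
qed

text \<open>Each generator intersects the class of test objects with those supported on the primes containing
  it; in the end these primes contain all generators.\<close>

lemma orth_koszul_iff:
  assumes p: "\<pp> \<in> Spec R Rg"
  shows "koszul T \<phi> X rs Y \<Longrightarrow> (\<forall>(d, r)\<in>set rs. r \<in> Rg d) \<Longrightarrow>
    (\<forall>B\<in>perp (supported (non_generalizations R Rg \<pp>)). orth B Y) \<longleftrightarrow>
    (\<forall>B\<in>perp (supported (non_generalizations R Rg \<pp>)) \<inter> supported (closed_locus R Rg (snd ` set rs)). orth B X)"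
proof (induction rule: koszul.induct)
  case (koszul_Nil X)
  have "closed_locus R Rg (snd ` set []) = Spec R Rg" by (simp add: closed_locus_def)
  then show ?case using supported_Spec perp_obj by auto
next
  case (koszul_Cons X d Z r g h rs Y)
  let ?N = "perp (supported (non_generalizations R Rg \<pp>))"
  have r: "r \<in> Rg d" and rs: "\<forall>(d, r)\<in>set rs. r \<in> Rg d" using koszul_Cons.prems by auto
  have "closed_locus R Rg (snd ` set ((d, r) # rs)) = closed_locus R Rg (snd ` set rs) \<inter> closed_locus R Rg {r}"
    by (auto simp: closed_locus_def)
  then have "?N \<inter> supported (closed_locus R Rg (snd ` set ((d, r) # rs))) =
      ?N \<inter> supported (closed_locus R Rg (snd ` set rs)) \<inter> supported (closed_locus R Rg {r})"
    by (simp add: supported_inter Int_assoc)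
  then show ?case
    using koszul_Cons.IH[OF rs]
      orth_koszul_step[OF p closed_locus_specialization_closed r koszul_Cons.hyps(1)] by simp
qed

abbreviation local_torsion where
  "local_torsion \<pp> \<equiv> perp (supported (non_generalizations R Rg \<pp>)) \<inter> supported (closed_locus R Rg \<pp>)"

lemma orth_all_localizations_iff:
  assumes X: "X \<in> Obj T"
  shows "(\<forall>A\<in>Obj T. orth (onO (L (non_generalizations R Rg \<pp>)) A) X) \<longleftrightarrow>
    (\<forall>B\<in>perp (supported (non_generalizations R Rg \<pp>)). orth B X)"
proof -
  let ?Z = "non_generalizations R Rg \<pp>"
  note Z = non_generalizations_specialization_closed[of \<pp>]
  obtain \<theta> \<eta> \<nu> where "bousfield_localization T (supported ?Z) (\<Gamma> ?Z) (L ?Z) \<theta> \<eta> \<nu>" using bousfield[OF Z] .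
  then interpret B: bousfield_localization T "supported ?Z" "\<Gamma> ?Z" "L ?Z" \<theta> \<eta> \<nu> .
  show ?thesis
  proof (intro iffI ballI)
    fix B assume o: "\<forall>A\<in>Obj T. orth (onO (L ?Z) A) X" and B: "B \<in> perp (supported ?Z)"
    obtain r where "arr (onO (L ?Z) B) B r" "r \<bullet>\<^bsub>T\<^esub> \<eta> B = Ident T B" using B.local_retract[OF B] .
    then show "orth B X" using orth_retract[OF B.\<eta>_arr] o perp_obj[OF B] X by blast
  qed (use B.L_perp in blast)
qed

text \<open>Localizing a \<open>\<pp>\<close>-torsion object at \<open>\<pp>\<close> gives a local torsion object, and each of these is a retract
  of its own localization.\<close>

lemma orth_torsion_localizations_iff:
  assumes p: "\<pp> \<in> Spec R Rg" and X: "X \<in> Obj T"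
  shows "(\<forall>A\<in>supported (closed_locus R Rg \<pp>). orth (onO (L (non_generalizations R Rg \<pp>)) A) X) \<longleftrightarrow>
    (\<forall>B\<in>local_torsion \<pp>. orth B X)"
proof -
  let ?Z = "non_generalizations R Rg \<pp>" and ?W = "closed_locus R Rg \<pp>"
  note Z = non_generalizations_specialization_closed[of \<pp>]
  note W = closed_locus_specialization_closed[of \<pp>]
  obtain \<theta> \<eta> \<nu> where "bousfield_localization T (supported ?Z) (\<Gamma> ?Z) (L ?Z) \<theta> \<eta> \<nu>" using bousfield[OF Z] .
  then interpret B: bousfield_localization T "supported ?Z" "\<Gamma> ?Z" "L ?Z" \<theta> \<eta> \<nu> .
  show ?thesis
  proof (intro iffI ballI)
    fix B assume o: "\<forall>A\<in>supported ?W. orth (onO (L ?Z) A) X" and B: "B \<in> local_torsion \<pp>"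
    then have Bp: "B \<in> perp (supported ?Z)" by blast
    obtain r where "arr (onO (L ?Z) B) B r" "r \<bullet>\<^bsub>T\<^esub> \<eta> B = Ident T B" using B.local_retract[OF Bp] .
    then show "orth B X" using orth_retract[OF B.\<eta>_arr] o perp_obj[OF Bp] X B by blast
  next
    fix A assume o: "\<forall>B\<in>local_torsion \<pp>. orth B X" and A: "A \<in> supported ?W"
    have "A \<in> Obj T" using A by (simp add: supported_on_def)
    then show "orth (onO (L ?Z) A) X" using o B.L_perp L_supported[OF W p A] by blast
  qed
qed

lemma \<Gamma>\<Upsilon>_zero_iff:
  assumes p: "\<pp> \<in> Spec R Rg" and X: "X \<in> Obj T"
  shows "zero_object T (onO (\<Gamma> (closed_locus R Rg \<pp>)) (onO (\<Upsilon> (non_generalizations R Rg \<pp>)) X)) \<longleftrightarrow>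
    (\<forall>B\<in>local_torsion \<pp>. orth B X)"
proof -
  let ?Z = "non_generalizations R Rg \<pp>" and ?W = "closed_locus R Rg \<pp>"
  note Z = non_generalizations_specialization_closed[of \<pp>]
  note W = closed_locus_specialization_closed[of \<pp>]
  obtain \<theta> \<eta> \<nu> where "bousfield_localization T (supported ?W) (\<Gamma> ?W) (L ?W) \<theta> \<eta> \<nu>" using bousfield[OF W] .
  then interpret C: bousfield_localization T "supported ?W" "\<Gamma> ?W" "L ?W" \<theta> \<eta> \<nu> .
  note adj = adjoints(2)[OF Z]
  have UX: "onO (\<Upsilon> ?Z) X \<in> Obj T" using endofunctor_obj[OF right_adjoint_functors(2)[OF adj] X] .
  have "zero_object T (onO (\<Gamma> ?W) (onO (\<Upsilon> ?Z) X)) \<longleftrightarrow> (\<forall>A\<in>supported ?W. orth A (onO (\<Upsilon> ?Z) X))"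
    using C.\<Gamma>_zero_iff[OF UX] UX by (simp add: perp_def)
  also have "\<dots> \<longleftrightarrow> (\<forall>A\<in>supported ?W. orth (onO (L ?Z) A) X)"
    using right_adjoint_orth_iff[OF adj _ X] C.S_iff by blast
  finally show ?thesis using orth_torsion_localizations_iff[OF p X] by simp
qed

lemma \<Upsilon>\<Lambda>_zero_iff:
  assumes p: "\<pp> \<in> Spec R Rg" and X: "X \<in> Obj T"
  shows "zero_object T (onO (\<Upsilon> (non_generalizations R Rg \<pp>)) (onO (\<Lambda> (closed_locus R Rg \<pp>)) X)) \<longleftrightarrow>
    (\<forall>B\<in>local_torsion \<pp>. orth B X)"
proof -
  let ?Z = "non_generalizations R Rg \<pp>" and ?W = "closed_locus R Rg \<pp>"
  note Z = non_generalizations_specialization_closed[of \<pp>]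
  note W = closed_locus_specialization_closed[of \<pp>]
  obtain \<theta> \<eta> \<nu> where "bousfield_localization T (supported ?W) (\<Gamma> ?W) (L ?W) \<theta> \<eta> \<nu>" using bousfield[OF W] .
  then interpret C: bousfield_localization T "supported ?W" "\<Gamma> ?W" "L ?W" \<theta> \<eta> \<nu> .
  note adjU = adjoints(2)[OF Z] and adjL = adjoints(1)[OF W]
  have LX: "onO (\<Lambda> ?W) X \<in> Obj T" using endofunctor_obj[OF right_adjoint_functors(2)[OF adjL] X] .
  have "zero_object T (onO (\<Upsilon> ?Z) (onO (\<Lambda> ?W) X)) \<longleftrightarrow>
      (\<forall>B\<in>perp (supported ?Z). orth B (onO (\<Lambda> ?W) X))"
    using right_adjoint_zero_iff[OF adjU LX] orth_all_localizations_iff[OF LX] by simp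
  also have "\<dots> \<longleftrightarrow> (\<forall>B\<in>perp (supported ?Z). orth (onO (\<Gamma> ?W) B) X)"
    using right_adjoint_orth_iff[OF adjL _ X] perp_obj by blast
  also have "\<dots> \<longleftrightarrow> (\<forall>B\<in>local_torsion \<pp>. orth B X)"
  proof (intro iffI ballI)
    fix B assume o: "\<forall>B\<in>perp (supported ?Z). orth (onO (\<Gamma> ?W) B) X" and B: "B \<in> local_torsion \<pp>"
    then have Bs: "B \<in> supported ?W" and Bo: "B \<in> Obj T" using perp_obj by blast+
    obtain i where "arr B (onO (\<Gamma> ?W) B) i" "\<theta> B \<bullet>\<^bsub>T\<^esub> i = Ident T B"
      using C.acyclic_retract[OF Bs] .
    then show "orth B X" using orth_retract[OF _ C.\<theta>_arr[OF Bo]] o B X by blast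
  next
    fix B assume "\<forall>B\<in>local_torsion \<pp>. orth B X" and "B \<in> perp (supported ?Z)"
    then show "orth (onO (\<Gamma> ?W) B) X"
      using \<Gamma>_local[OF W p] C.\<Gamma>_S perp_obj by blast
  qed
  finally show ?thesis .
qed

lemma \<Upsilon>_koszul_zero_iff:
  assumes p: "\<pp> \<in> Spec R Rg" and kos: "koszul_object R Rg T \<phi> \<pp> X Y" and Y: "Y \<in> Obj T"
  shows "zero_object T (onO (\<Upsilon> (non_generalizations R Rg \<pp>)) Y) \<longleftrightarrow>
    (\<forall>B\<in>local_torsion \<pp>. orth B X)"
proof -
  obtain rs where rs: "\<forall>(d, r)\<in>set rs. r \<in> Rg d" "Idl\<^bsub>R\<^esub> (snd ` set rs) = \<pp>" "koszul T \<phi> X rs Y"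
    using kos unfolding koszul_object_def by blast
  have "snd ` set rs \<subseteq> carrier R" using rs(1) degree_carrier by auto
  then have "closed_locus R Rg (snd ` set rs) = closed_locus R Rg \<pp>"
    using closed_locus_Idl rs(2) by blast
  then show ?thesis
    using right_adjoint_zero_iff[OF adjoints(2)[OF non_generalizations_specialization_closed] Y]
      orth_all_localizations_iff[OF Y] orth_koszul_iff[OF p rs(3,1)] by simp
qed

lemma local_torsion_orth_\<Upsilon>_iff:
  assumes X: "X \<in> Obj T"
  shows "(\<forall>B\<in>local_torsion \<pp>. orth B (onO (\<Upsilon> (non_generalizations R Rg \<pp>)) X)) \<longleftrightarrow>
    (\<forall>B\<in>local_torsion \<pp>. orth B X)"
proof -
  let ?Z = "non_generalizations R Rg \<pp>"
  note Z = non_generalizations_specialization_closed[of \<pp>]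
  obtain \<theta> \<eta> \<nu> where "bousfield_localization T (supported ?Z) (\<Gamma> ?Z) (L ?Z) \<theta> \<eta> \<nu>" using bousfield[OF Z] .
  then interpret B: bousfield_localization T "supported ?Z" "\<Gamma> ?Z" "L ?Z" \<theta> \<eta> \<nu> .
  obtain \<delta> where "coreflection (perp (supported ?Z)) X (onO (\<Upsilon> ?Z) X) \<delta>"
    using B.coreflection_right_adjoint[OF adjoints(2)[OF Z] X] by blast
  then show ?thesis using coreflection_orth_iff perp_obj by blast
qed

lemma cosupp_iff:
  assumes p: "\<pp> \<in> Spec R Rg" and X: "X \<in> Obj T"
  shows "\<pp> \<in> cosupp R Rg T \<Lambda> \<Upsilon> X \<longleftrightarrow> \<not> (\<forall>B\<in>local_torsion \<pp>. orth B X)"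
  using \<Upsilon>\<Lambda>_zero_iff[OF p X] p by (simp add: cosupp_def comp_endofun_def)

lemma koszul_obj: "koszul T \<phi> X rs Y \<Longrightarrow> Y \<in> Obj T"
  by (induction rule: koszul.induct)

end

theorem proposition3p2:
  fixes R :: "('r, 'z) ring_scheme" and Rg :: "int \<Rightarrow> 'r set"
    and T :: "('o, 'm, 'x) tricat_scheme" and \<phi> :: "int \<Rightarrow> 'r \<Rightarrow> 'o \<Rightarrow> 'm"
    and \<kappa> :: "'i rel"
    and \<Gamma> L \<Lambda> \<Upsilon> :: "'r set set \<Rightarrow> ('o, 'm) endofun"
    and X Xp :: 'o and \<pp> :: "'r set"
  assumes setting: "compactly_generated_linear_category R Rg T \<phi> \<kappa>"
    and functors: "local_functors R Rg T \<phi> \<kappa> \<Gamma> L \<Lambda> \<Upsilon>"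
    and object: "X \<in> Obj T"
    and prime: "\<pp> \<in> Spec R Rg"
    and koszul: "koszul_object R Rg T \<phi> \<pp> X Xp"
  shows "(\<pp> \<in> cosupp R Rg T \<Lambda> \<Upsilon> X \<longleftrightarrow>
            \<not> zero_object T (onO (\<Upsilon> (non_generalizations R Rg \<pp>)) Xp))
    \<and> (\<not> zero_object T (onO (\<Upsilon> (non_generalizations R Rg \<pp>)) Xp) \<longleftrightarrow>
            \<not> zero_object T (onO (\<Gamma> (closed_locus R Rg \<pp>)) (onO (\<Upsilon> (non_generalizations R Rg \<pp>)) X)))
    \<and> (\<not> zero_object T (onO (\<Gamma> (closed_locus R Rg \<pp>)) (onO (\<Upsilon> (non_generalizations R Rg \<pp>)) X)) \<longleftrightarrow>
            \<pp> \<in> cosupp R Rg T \<Lambda> \<Upsilon> (onO (\<Upsilon> (non_generalizations R Rg \<pp>)) X))"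
proof -
  interpret local_cohomology R Rg T \<phi> \<kappa> \<Gamma> L \<Lambda> \<Upsilon>
    using setting functors by (simp add: local_cohomology_def local_cohomology_axioms_def)
  have Xp: "Xp \<in> Obj T" using koszul koszul_obj unfolding koszul_object_def by blast
  have UX: "onO (\<Upsilon> (non_generalizations R Rg \<pp>)) X \<in> Obj T"
    using endofunctor_obj[OF right_adjoint_functors(2)[OF adjoints(2)] object]
      non_generalizations_specialization_closed by blast
  show ?thesis
    using cosupp_iff[OF prime object] cosupp_iff[OF prime UX] \<Upsilon>_koszul_zero_iff[OF prime koszul Xp]
      \<Gamma>\<Upsilon>_zero_iff[OF prime object] local_torsion_orth_\<Upsilon>_iff[OF object] by simp
qed

end
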